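(* Let $\mathbb{M}$ be a monster model of a complete $C$-minimal expansion of ACVF whose language contains a constant symbol $t$ with $v(t)>0$. Suppose $\mathbb{M}$ has characteristic $0$ and is definably complete. If $B\subseteq\mathbb{M}$ is a ball and $f:B\to\mathbb{M}$ is definable, then there is a smaller ball $B'\subseteq B$ on which $f$ is differentiable. Consequently, $f$ is differentiable at all but finitely many points of $B$.
   Context: ACVF is the theory of algebraically closed non-trivially valued fields; $C$-minimal means that in every model every definable subset of the home sort is a finite boolean combination of balls and points. "Definable" means with parameters; differentiability is with respect to the valuation topology. $\mathbb{M}$ is definably complete if every definable chain of balls whose radii approach $+\infty$ has non-empty intersection. *)

theory Defs
  imports "HOL-Analysis.Analysis" "HOL-Algebra.Algebra"
begin

section \<open>First-order logic\<close>

record ('f, 'r) lang =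
  fsyms :: "'f set"
  rsyms :: "'r set"
  farity :: "'f \<Rightarrow> nat"
  rarity :: "'r \<Rightarrow> nat"

datatype 'f tm = Var nat | App 'f "'f tm list"

datatype ('f, 'r) fm =
    Equal "'f tm" "'f tm"
  | Atom 'r "'f tm list"
  | Not "('f, 'r) fm"
  | And "('f, 'r) fm" "('f, 'r) fm"
  | Exists nat "('f, 'r) fm"

record ('a, 'f, 'r) struct =
  univ :: "'a set"
  Fn :: "'f \<Rightarrow> 'a list \<Rightarrow> 'a"
  Rl :: "'r \<Rightarrow> 'a list \<Rightarrow> bool"

fun tm_vars :: "'f tm \<Rightarrow> nat set" where
  "tm_vars (Var i) = {i}"
| "tm_vars (App f ts) = (\<Union>t\<in>set ts. tm_vars t)"

fun wf_tm :: "('f, 'r) lang \<Rightarrow> 'f tm \<Rightarrow> bool" where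
  "wf_tm L (Var i) = True"
| "wf_tm L (App f ts) = (f \<in> fsyms L \<and> length ts = farity L f \<and> (\<forall>t\<in>set ts. wf_tm L t))"

fun tm_val :: "('a, 'f, 'r) struct \<Rightarrow> (nat \<Rightarrow> 'a) \<Rightarrow> 'f tm \<Rightarrow> 'a" where
  "tm_val N e (Var i) = e i"
| "tm_val N e (App f ts) = Fn N f (map (tm_val N e) ts)"

fun free_vars :: "('f, 'r) fm \<Rightarrow> nat set" where
  "free_vars (Equal s t) = tm_vars s \<union> tm_vars t"
| "free_vars (Atom R ts) = (\<Union>t\<in>set ts. tm_vars t)"
| "free_vars (Not \<phi>) = free_vars \<phi>"
| "free_vars (And \<phi> \<psi>) = free_vars \<phi> \<union> free_vars \<psi>"
| "free_vars (Exists i \<phi>) = free_vars \<phi> - {i}"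

fun wf_fm :: "('f, 'r) lang \<Rightarrow> ('f, 'r) fm \<Rightarrow> bool" where
  "wf_fm L (Equal s t) = (wf_tm L s \<and> wf_tm L t)"
| "wf_fm L (Atom R ts) = (R \<in> rsyms L \<and> length ts = rarity L R \<and> (\<forall>t\<in>set ts. wf_tm L t))"
| "wf_fm L (Not \<phi>) = wf_fm L \<phi>"
| "wf_fm L (And \<phi> \<psi>) = (wf_fm L \<phi> \<and> wf_fm L \<psi>)"
| "wf_fm L (Exists i \<phi>) = wf_fm L \<phi>"

fun sat :: "('a, 'f, 'r) struct \<Rightarrow> (nat \<Rightarrow> 'a) \<Rightarrow> ('f, 'r) fm \<Rightarrow> bool" where
  "sat N e (Equal s t) = (tm_val N e s = tm_val N e t)"
| "sat N e (Atom R ts) = Rl N R (map (tm_val N e) ts)"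
| "sat N e (Not \<phi>) = (\<not> sat N e \<phi>)"
| "sat N e (And \<phi> \<psi>) = (sat N e \<phi> \<and> sat N e \<psi>)"
| "sat N e (Exists i \<phi>) = (\<exists>x\<in>univ N. sat N (e(i := x)) \<phi>)"

definition is_struct :: "('f, 'r) lang \<Rightarrow> ('a, 'f, 'r) struct \<Rightarrow> bool" where
  "is_struct L N \<longleftrightarrow> univ N \<noteq> {} \<and>
     (\<forall>f\<in>fsyms L. \<forall>xs. length xs = farity L f \<and> set xs \<subseteq> univ N \<longrightarrow> Fn N f xs \<in> univ N)"

definition sentences :: "('f, 'r) lang \<Rightarrow> ('f, 'r) fm set" where
  "sentences L = {\<phi>. wf_fm L \<phi> \<and> free_vars \<phi> = {}}"

definition holds :: "('a, 'f, 'r) struct \<Rightarrow> ('f, 'r) fm \<Rightarrow> bool" where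
  "holds N \<phi> \<longleftrightarrow> (\<forall>e. range e \<subseteq> univ N \<longrightarrow> sat N e \<phi>)"

text \<open>
  Quantification over all models of a theory is rendered as quantification over the models
  whose universe is a (possibly proper) subset of the type \<open>'a\<close>. The type \<open>'a\<close> will carry a
  model of cardinality larger than that of the language, so by Loewenheim-Skolem every model is
  elementarily equivalent to one of these, and every configuration in a model witnessing the
  failure of one of the properties below already occurs in a model whose universe is contained
  in \<open>'a\<close>.
\<close>

definition models :: "('f, 'r) lang \<Rightarrow> ('f, 'r) fm set \<Rightarrow> ('a, 'f, 'r) struct set" where
  "models L T = {N. is_struct L N \<and> (\<forall>\<phi>\<in>T. holds N \<phi>)}"

definition complete_theory :: "'a itself \<Rightarrow> ('f, 'r) lang \<Rightarrow> ('f, 'r) fm set \<Rightarrow> bool" where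
  "complete_theory _ L T \<longleftrightarrow>
     T \<subseteq> sentences L \<and>
     (models L T :: ('a, 'f, 'r) struct set) \<noteq> {} \<and>
     (\<forall>\<phi>\<in>sentences L.
        (\<forall>N\<in>(models L T :: ('a, 'f, 'r) struct set). holds N \<phi>) \<or>
        (\<forall>N\<in>(models L T :: ('a, 'f, 'r) struct set). holds N (Not \<phi>)))"

text \<open>
  Definability is with parameters: the variables below \<open>n\<close> are the object variables, and \<open>e\<close>
  supplies the parameters as values of the remaining variables.
\<close>

definition definable :: "('f, 'r) lang \<Rightarrow> ('a, 'f, 'r) struct \<Rightarrow> nat \<Rightarrow> 'a list set \<Rightarrow> bool" where
  "definable L N n D \<longleftrightarrow>
     (\<exists>\<phi> e. wf_fm L \<phi> \<and> range e \<subseteq> univ N \<and>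
        D = {xs. length xs = n \<and> set xs \<subseteq> univ N \<and>
                 sat N (\<lambda>i. if i < n then xs ! i else e i) \<phi>})"

definition definable_set :: "('f, 'r) lang \<Rightarrow> ('a, 'f, 'r) struct \<Rightarrow> 'a set \<Rightarrow> bool" where
  "definable_set L N A \<longleftrightarrow> definable L N 1 {[x] |x. x \<in> A}"

definition definable_fun ::
  "('f, 'r) lang \<Rightarrow> ('a, 'f, 'r) struct \<Rightarrow> 'a set \<Rightarrow> ('a \<Rightarrow> 'a) \<Rightarrow> bool" where
  "definable_fun L N A f \<longleftrightarrow> definable L N 2 {[x, f x] |x. x \<in> A}"

definition definable_family ::
  "('f, 'r) lang \<Rightarrow> ('a, 'f, 'r) struct \<Rightarrow> 'a set set \<Rightarrow> bool" where
  "definable_family L N C \<longleftrightarrow>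
     (\<exists>n Y D. definable L N n Y \<and> definable L N (Suc n) D \<and>
        C = {{x. x # b \<in> D} |b. b \<in> Y})"


section \<open>Monster models\<close>

text \<open>
  A set of formulas in the variable \<open>0\<close> over a parameter set \<open>A\<close> is a set of pairs \<open>(\<phi>, e)\<close>,
  where the assignment \<open>e\<close> sends the other free variables of \<open>\<phi>\<close> into \<open>A\<close>.
\<close>

definition saturated ::
  "'k rel \<Rightarrow> ('f, 'r) lang \<Rightarrow> ('a, 'f, 'r) struct \<Rightarrow> bool" where
  "saturated \<kappa> L N \<longleftrightarrow>
     (\<forall>A p. A \<subseteq> univ N \<and> card_of A <o \<kappa> \<and>
        (\<forall>(\<phi>, e)\<in>p. wf_fm L \<phi> \<and> (\<forall>i\<in>free_vars \<phi> - {0}. e i \<in> A)) \<and>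
        (\<forall>q. finite q \<and> q \<subseteq> p \<longrightarrow> (\<exists>x\<in>univ N. \<forall>(\<phi>, e)\<in>q. sat N (e(0 := x)) \<phi>))
        \<longrightarrow> (\<exists>x\<in>univ N. \<forall>(\<phi>, e)\<in>p. sat N (e(0 := x)) \<phi>))"

definition partial_elementary ::
  "('f, 'r) lang \<Rightarrow> ('a, 'f, 'r) struct \<Rightarrow> 'a set \<Rightarrow> ('a \<Rightarrow> 'a) \<Rightarrow> bool" where
  "partial_elementary L N A g \<longleftrightarrow>
     g \<in> A \<rightarrow> univ N \<and>
     (\<forall>\<phi> e. wf_fm L \<phi> \<and> (\<forall>i\<in>free_vars \<phi>. e i \<in> A) \<longrightarrow>
        (sat N e \<phi> \<longleftrightarrow> sat N (g \<circ> e) \<phi>))"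

definition automorphism ::
  "('f, 'r) lang \<Rightarrow> ('a, 'f, 'r) struct \<Rightarrow> ('a \<Rightarrow> 'a) \<Rightarrow> bool" where
  "automorphism L N \<sigma> \<longleftrightarrow>
     bij_betw \<sigma> (univ N) (univ N) \<and>
     (\<forall>f\<in>fsyms L. \<forall>xs. length xs = farity L f \<and> set xs \<subseteq> univ N \<longrightarrow>
        \<sigma> (Fn N f xs) = Fn N f (map \<sigma> xs)) \<and>
     (\<forall>R\<in>rsyms L. \<forall>xs. length xs = rarity L R \<and> set xs \<subseteq> univ N \<longrightarrow>
        (Rl N R xs \<longleftrightarrow> Rl N R (map \<sigma> xs)))"

definition strongly_homogeneous ::
  "'k rel \<Rightarrow> ('f, 'r) lang \<Rightarrow> ('a, 'f, 'r) struct \<Rightarrow> bool" where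
  "strongly_homogeneous \<kappa> L N \<longleftrightarrow>
     (\<forall>A g. A \<subseteq> univ N \<and> card_of A <o \<kappa> \<and> partial_elementary L N A g \<longrightarrow>
        (\<exists>\<sigma>. automorphism L N \<sigma> \<and> (\<forall>x\<in>A. \<sigma> x = g x)))"

definition monster_model ::
  "'k rel \<Rightarrow> ('f, 'r) lang \<Rightarrow> ('f, 'r) fm set \<Rightarrow> ('a, 'f, 'r) struct \<Rightarrow> bool" where
  "monster_model \<kappa> L T M \<longleftrightarrow>
     Card_order \<kappa> \<and> natLeq <o \<kappa> \<and> card_of (fsyms L) <o \<kappa> \<and> card_of (rsyms L) <o \<kappa> \<and>
     M \<in> models L T \<and> saturated \<kappa> L M \<and> strongly_homogeneous \<kappa> L M"


section \<open>Expansions of ACVF\<close>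

text \<open>
  The field is the only sort, and the valuation is given by the divisibility predicate
  \<open>v x \<le> v y\<close>. The value group (written additively, with \<open>v 0 = \<infinity>\<close>) is the group of nonzero
  field elements modulo those of valuation \<open>0\<close>; its elements are represented by nonzero field
  elements \<open>r\<close>, standing for \<open>v r\<close>.
\<close>

datatype 'f vf_fun = Zero | One | Add | Mult | ExtraFn 'f
datatype 'r vf_rel = Div | ExtraRl 'r

definition expands_vf_language :: "('f vf_fun, 'r vf_rel) lang \<Rightarrow> bool" where
  "expands_vf_language L \<longleftrightarrow>
     {Zero, One, Add, Mult} \<subseteq> fsyms L \<and> Div \<in> rsyms L \<and>
     farity L Zero = 0 \<and> farity L One = 0 \<and> farity L Add = 2 \<and> farity L Mult = 2 \<and>
     rarity L Div = 2"

definition ring_of :: "('a, 'f vf_fun, 'r vf_rel) struct \<Rightarrow> 'a ring" where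
  "ring_of N = \<lparr>carrier = univ N,
     monoid.mult = (\<lambda>x y. Fn N Mult [x, y]), monoid.one = Fn N One [],
     ring.zero = Fn N Zero [], ring.add = (\<lambda>x y. Fn N Add [x, y])\<rparr>"

definition val_le :: "('a, 'f vf_fun, 'r vf_rel) struct \<Rightarrow> 'a \<Rightarrow> 'a \<Rightarrow> bool" where
  "val_le N x y \<longleftrightarrow> Rl N Div [x, y]"

definition val_less :: "('a, 'f vf_fun, 'r vf_rel) struct \<Rightarrow> 'a \<Rightarrow> 'a \<Rightarrow> bool" where
  "val_less N x y \<longleftrightarrow> val_le N x y \<and> \<not> val_le N y x"

definition is_valuation :: "('a, 'f vf_fun, 'r vf_rel) struct \<Rightarrow> bool" where
  "is_valuation N \<longleftrightarrow> (let R = ring_of N in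
     (\<forall>x\<in>univ N. \<forall>y\<in>univ N. val_le N x y \<or> val_le N y x) \<and>
     (\<forall>x\<in>univ N. \<forall>y\<in>univ N. \<forall>z\<in>univ N. val_le N x y \<and> val_le N y z \<longrightarrow> val_le N x z) \<and>
     (\<forall>x\<in>univ N. val_le N \<zero>\<^bsub>R\<^esub> x \<longleftrightarrow> x = \<zero>\<^bsub>R\<^esub>) \<and>
     (\<forall>x\<in>univ N. \<forall>y\<in>univ N. \<forall>z\<in>univ N.
        val_le N x y \<longrightarrow> val_le N (x \<otimes>\<^bsub>R\<^esub> z) (y \<otimes>\<^bsub>R\<^esub> z)) \<and>
     (\<forall>x\<in>univ N. \<forall>y\<in>univ N. \<forall>z\<in>univ N.
        val_le N z x \<and> val_le N z y \<longrightarrow> val_le N z (x \<oplus>\<^bsub>R\<^esub> y)))"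

definition nontrivial_valuation :: "('a, 'f vf_fun, 'r vf_rel) struct \<Rightarrow> bool" where
  "nontrivial_valuation N \<longleftrightarrow>
     (\<exists>x\<in>univ N. x \<noteq> \<zero>\<^bsub>ring_of N\<^esub> \<and>
        (val_less N x \<one>\<^bsub>ring_of N\<^esub> \<or> val_less N \<one>\<^bsub>ring_of N\<^esub> x))"

definition acvf :: "('a, 'f vf_fun, 'r vf_rel) struct \<Rightarrow> bool" where
  "acvf N \<longleftrightarrow> algebraically_closed (ring_of N) \<and> is_valuation N \<and> nontrivial_valuation N"

definition char_zero :: "('a, 'b) ring_scheme \<Rightarrow> bool" where
  "char_zero R \<longleftrightarrow> (\<forall>n::nat. n > 0 \<longrightarrow> [n] \<cdot>\<^bsub>R\<^esub> \<one>\<^bsub>R\<^esub> \<noteq> \<zero>\<^bsub>R\<^esub>)"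

definition closed_ball :: "('a, 'f vf_fun, 'r vf_rel) struct \<Rightarrow> 'a \<Rightarrow> 'a \<Rightarrow> 'a set" where
  "closed_ball N a r = {x\<in>univ N. val_le N r (x \<ominus>\<^bsub>ring_of N\<^esub> a)}"

definition open_ball :: "('a, 'f vf_fun, 'r vf_rel) struct \<Rightarrow> 'a \<Rightarrow> 'a \<Rightarrow> 'a set" where
  "open_ball N a r = {x\<in>univ N. val_less N r (x \<ominus>\<^bsub>ring_of N\<^esub> a)}"

text \<open>
  Radii lie in the value group, so neither points (radius \<open>+\<infinity>\<close>) nor the whole field are balls.
\<close>

definition ball_of_radius ::
  "('a, 'f vf_fun, 'r vf_rel) struct \<Rightarrow> 'a \<Rightarrow> 'a set \<Rightarrow> bool" where
  "ball_of_radius N r B \<longleftrightarrow>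
     r \<in> univ N \<and> r \<noteq> \<zero>\<^bsub>ring_of N\<^esub> \<and>
     (\<exists>a\<in>univ N. B = closed_ball N a r \<or> B = open_ball N a r)"

definition is_ball :: "('a, 'f vf_fun, 'r vf_rel) struct \<Rightarrow> 'a set \<Rightarrow> bool" where
  "is_ball N B \<longleftrightarrow> (\<exists>r. ball_of_radius N r B)"

inductive_set ball_combinations :: "('a, 'f vf_fun, 'r vf_rel) struct \<Rightarrow> 'a set set"
  for N :: "('a, 'f vf_fun, 'r vf_rel) struct" where
  ball: "is_ball N B \<Longrightarrow> B \<in> ball_combinations N"
| point: "a \<in> univ N \<Longrightarrow> {a} \<in> ball_combinations N"
| complement: "A \<in> ball_combinations N \<Longrightarrow> univ N - A \<in> ball_combinations N"
| union: "A \<in> ball_combinations N \<Longrightarrow> A' \<in> ball_combinations N \<Longrightarrow>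
    A \<union> A' \<in> ball_combinations N"

definition C_minimal_ACVF_expansion ::
  "'a itself \<Rightarrow> ('f vf_fun, 'r vf_rel) lang \<Rightarrow> ('f vf_fun, 'r vf_rel) fm set \<Rightarrow> bool" where
  "C_minimal_ACVF_expansion _ L T \<longleftrightarrow>
     expands_vf_language L \<and>
     (\<forall>N\<in>(models L T :: ('a, 'f vf_fun, 'r vf_rel) struct set).
        acvf N \<and> (\<forall>A. definable_set L N A \<longrightarrow> A \<in> ball_combinations N))"

definition definably_complete ::
  "('f vf_fun, 'r vf_rel) lang \<Rightarrow> ('a, 'f vf_fun, 'r vf_rel) struct \<Rightarrow> bool" where
  "definably_complete L N \<longleftrightarrow>
     (\<forall>C. definable_family L N C \<and> (\<forall>B\<in>C. is_ball N B) \<and> chain\<^sub>\<subseteq> C \<and>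
        (\<forall>c\<in>univ N. c \<noteq> \<zero>\<^bsub>ring_of N\<^esub> \<longrightarrow>
           (\<exists>B\<in>C. \<exists>r. ball_of_radius N r B \<and> val_less N c r))
        \<longrightarrow> \<Inter>C \<noteq> {})"

definition val_topology :: "('a, 'f vf_fun, 'r vf_rel) struct \<Rightarrow> 'a topology" where
  "val_topology N = topology_generated_by {B. is_ball N B}"

definition differentiable_at_within ::
  "('a, 'f vf_fun, 'r vf_rel) struct \<Rightarrow> ('a \<Rightarrow> 'a) \<Rightarrow> 'a \<Rightarrow> 'a set \<Rightarrow> bool" where
  "differentiable_at_within N f a S \<longleftrightarrow> (let R = ring_of N in
     \<exists>d\<in>univ N. limitin (val_topology N)
       (\<lambda>x. (f x \<ominus>\<^bsub>R\<^esub> f a) \<otimes>\<^bsub>R\<^esub> inv\<^bsub>R\<^esub> (x \<ominus>\<^bsub>R\<^esub> a)) d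
       (atin_within (val_topology N) a S))"

end

theory Submission
  imports Defs "HOL-Algebra.Algebraic_Closure_Type"
begin

text \<open>
  A definable function of \<open>d\<close> has, as \<open>d\<close> tends to \<open>0\<close>, a limit in \<open>\<PP>\<^sup>1\<close> of the field. For by C-minimality
  a definable set is, on all but finitely many annuli around \<open>0\<close>, almost empty or almost everything
  modulo residues, and together with saturation this forces a definable integral function to have an
  eventually constant residue and the quotients \<open>F (b d) / F d\<close> to have eventually constant valuation.
  The first rules out that the balls containing the function values near \<open>0\<close> have a smallest radius,
  the second that these radii have a proper infimum, and definable completeness provides the limit.

  Suppose now that \<open>f\<close> is differentiable at no point of a ball. With \<open>F a d = f (a + d) - f a\<close>, the
  difference quotient \<open>F a d / d\<close> tends to infinity, and \<open>\<chi> a s = lim F a (s d) / F a d\<close> is a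
  multiplicative character of \<open>s\<close>. For almost all \<open>a\<close> the limit may also be taken along the moving
  base point \<open>a + d\<close>, so that \<open>F a ((1 + s) d) = F a d + F (a + d) (s d)\<close> yields
  \<open>\<chi> a (1 + s) = 1 + \<chi> a s\<close> after normalization. Hence \<open>\<chi> a n = n\<close> for natural numbers \<open>n\<close>; in
  characteristic \<open>0\<close> the definable set of fixed points of \<open>\<chi> a\<close> is therefore infinite and contains a
  ball, which gives some \<open>t\<close> of positive valuation with \<open>\<chi> a t = t\<close>. But then the valuation of the
  difference quotient is the same at \<open>d\<close> and \<open>t d\<close>, and it cannot tend to infinity.

  Thus every ball contains a point of differentiability. The points where \<open>f\<close> is not differentiable
  form a definable set, which is finite because it contains no ball.
\<close>

text \<open>C-minimality speaks of one definable set at a time and bounds nothing in families;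
  uniformity comes from saturation. An increasing definable union, indexed by values, of finite sets
  is finite, and conditions that hold at almost all residues can be imposed countably many at once.
  Neither value group nor residue field is a sort, so both are reached through field elements:
  powers of a unit \<open>gen\<close>, with pairwise distinct residues, probe the residue field, and
  multiplication by an element of positive valuation probes the values near 0. The normalization of
  the additivity law rests on the limit \<open>chi a 2 - 1\<close> of
  \<open>F (a + d) d / F a d\<close>. Comparing \<open>chi a (1 + t)\<close> with
  \<open>chi a t * chi a (1 + 1 / t)\<close> gives \<open>(chi a t - 1) * (2 - chi a 2) = 0\<close>,
  and \<open>chi a t = 1\<close> with \<open>t\<close> of positive valuation would contradict
  continuity at \<open>a\<close>. Since each additivity law may fail on a finite set of points that
  depends on \<open>s\<close>, the radius of a ball of fixed points around 1 is made independent of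
  \<open>a\<close> before \<open>t\<close> is chosen.\<close>

no_notation lesspoll (infixl "\<prec>" 50)
no_notation eqpoll (infixl "\<approx>" 50)

section \<open>Valued fields and balls\<close>

text \<open>\<open>x \<preceq> y\<close> stands for \<open>v x \<le> v y\<close>; hence \<open>0\<close> is the largest element.\<close>

locale valued =
  fixes vle :: "'k::field_char_0 \<Rightarrow> 'k \<Rightarrow> bool"  (infix "\<preceq>" 50)
  assumes vle_total: "x \<preceq> y \<or> y \<preceq> x"
    and vle_trans [trans]: "x \<preceq> y \<Longrightarrow> y \<preceq> z \<Longrightarrow> x \<preceq> z"
    and vle_0_left [simp]: "0 \<preceq> x \<longleftrightarrow> x = 0"
    and vle_mult_right: "x \<preceq> y \<Longrightarrow> x * z \<preceq> y * z"
    and vle_add: "z \<preceq> x \<Longrightarrow> z \<preceq> y \<Longrightarrow> z \<preceq> x + y"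
    and val_nontrivial: "\<exists>x. x \<noteq> 0 \<and> \<not> (x \<preceq> 1 \<and> 1 \<preceq> x)"
    and root_exists: "Polynomial.degree (p :: 'k poly) > 0 \<Longrightarrow> \<exists>x. poly p x = 0"
begin

abbreviation vlt (infix "\<prec>" 50) where "x \<prec> y \<equiv> \<not> y \<preceq> x"
abbreviation veq (infix "\<approx>" 50) where "x \<approx> y \<equiv> x \<preceq> y \<and> y \<preceq> x"

lemma vle_refl [simp]: "x \<preceq> x"
  using vle_total by blast

lemma vle_0_right [simp]: "x \<preceq> 0"
  using vle_total[of x 0] by auto

lemma vlt_imp_vle: "x \<prec> y \<Longrightarrow> x \<preceq> y"
  using vle_total by blast

lemma vlt_trans [trans]: "x \<prec> y \<Longrightarrow> y \<prec> z \<Longrightarrow> x \<prec> z"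
  using vle_trans vlt_imp_vle by blast

lemma vle_mult_left: "x \<preceq> y \<Longrightarrow> z * x \<preceq> z * y"
  using vle_mult_right[of x y z] by (simp add: mult.commute)

lemma vle_mult: "x \<preceq> y \<Longrightarrow> x' \<preceq> y' \<Longrightarrow> x * x' \<preceq> y * y'"
  using vle_mult_left vle_mult_right vle_trans by blast

lemma vle_mult_cancel_right [simp]: "x * z \<preceq> y * z \<longleftrightarrow> z = 0 \<or> x \<preceq> y"
proof (cases "z = 0")
  case False
  have "x * z * inverse z \<preceq> y * z * inverse z" if "x * z \<preceq> y * z"
    using that by (rule vle_mult_right)
  then show ?thesis using False vle_mult_right by (auto simp: mult.assoc)
qed auto

lemma vle_mult_cancel_left [simp]: "z * x \<preceq> z * y \<longleftrightarrow> z = 0 \<or> x \<preceq> y"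
  using vle_mult_cancel_right[of x z y] by (simp add: mult.commute del: vle_mult_cancel_right)

lemma vle_divide_iff: "z \<noteq> 0 \<Longrightarrow> x \<preceq> y / z \<longleftrightarrow> x * z \<preceq> y"
  using vle_mult_cancel_right[of x z "y / z"] by simp

lemma divide_vle_iff: "z \<noteq> 0 \<Longrightarrow> x / z \<preceq> y \<longleftrightarrow> x \<preceq> y * z"
  using vle_mult_cancel_right[of "x / z" z y] by simp

lemma vle_minus_one: "-1 \<approx> 1"
proof -
  have "-1 \<preceq> 1 \<longleftrightarrow> 1 \<preceq> -1"
    using vle_mult_cancel_right[of "-1" "-1" 1] by simp
  then show ?thesis using vle_total[of "-1" 1] by blast
qed

lemma vle_minus_right [simp]: "x \<preceq> - y \<longleftrightarrow> x \<preceq> y"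
proof -
  have "- y \<approx> y"
    using vle_minus_one vle_mult_right[of "-1" 1 y] vle_mult_right[of 1 "-1" y] by simp
  then show ?thesis using vle_trans by blast
qed

lemma vle_minus_left [simp]: "- x \<preceq> y \<longleftrightarrow> x \<preceq> y"
  by (metis vle_minus_right vle_refl vle_trans minus_minus)

lemma vle_diff: "z \<preceq> x \<Longrightarrow> z \<preceq> y \<Longrightarrow> z \<preceq> x - y"
  using vle_add[of z x "-y"] by simp

lemma vle_diff_commute: "z \<preceq> x - y \<longleftrightarrow> z \<preceq> y - x"
  using vle_minus_right[of z "x - y"] by simp

lemma diff_vle_commute: "x - y \<preceq> z \<longleftrightarrow> y - x \<preceq> z"
  using vle_minus_left[of "x - y" z] by simp

lemma vlt_add: "z \<prec> x \<Longrightarrow> z \<prec> y \<Longrightarrow> z \<prec> x + y"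
  by (metis vle_add vle_total vle_trans)

lemma vlt_diff: "z \<prec> x \<Longrightarrow> z \<prec> y \<Longrightarrow> z \<prec> x - y"
  using vlt_add[of x z "-y"] by simp

lemma vle_diff_trans: "r \<preceq> x - y \<Longrightarrow> r \<preceq> y - z \<Longrightarrow> r \<preceq> x - z"
  using vle_add[of r "x - y" "y - z"] by simp

lemma vlt_diff_trans: "r \<prec> x - y \<Longrightarrow> r \<prec> y - z \<Longrightarrow> r \<prec> x - z"
  using vlt_add[of "x - y" r "y - z"] by simp

lemma veq_diff: "x \<prec> x - y \<Longrightarrow> x \<approx> y"
proof -
  assume *: "x \<prec> x - y"
  have "x \<preceq> y" using vle_diff[of x x "x - y"] vlt_imp_vle[OF *] by simp
  moreover have "y \<preceq> x"
  proof (rule ccontr)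
    assume "\<not> y \<preceq> x"
    then have "x \<prec> (x - y) + y" using * by (intro vlt_add)
    then show False by simp
  qed
  ultimately show ?thesis by blast
qed

lemma vle_cong_right: "x \<approx> y \<Longrightarrow> z \<preceq> x \<longleftrightarrow> z \<preceq> y"
  using vle_trans by blast

lemma vle_cong_left: "x \<approx> y \<Longrightarrow> x \<preceq> z \<longleftrightarrow> y \<preceq> z"
  using vle_trans by blast

lemma veq_mult: "x \<approx> y \<Longrightarrow> x' \<approx> y' \<Longrightarrow> x * x' \<approx> y * y'"
  using vle_mult by blast

lemma vle_1_mult: "1 \<preceq> x \<Longrightarrow> 1 \<preceq> y \<Longrightarrow> 1 \<preceq> x * y"
  using vle_mult[of 1 x 1 y] by simp

lemma vle_inverse: "x \<noteq> 0 \<Longrightarrow> y \<noteq> 0 \<Longrightarrow> inverse x \<preceq> inverse y \<longleftrightarrow> y \<preceq> x"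
  by (metis divide_vle_iff divide_inverse mult.commute mult_1 vle_divide_iff inverse_eq_divide)

lemma vle_1_divide: "z \<noteq> 0 \<Longrightarrow> 1 \<preceq> x / z \<longleftrightarrow> z \<preceq> x"
  by (simp add: vle_divide_iff)

lemma divide_vle_1: "z \<noteq> 0 \<Longrightarrow> x / z \<preceq> 1 \<longleftrightarrow> x \<preceq> z"
  by (simp add: divide_vle_iff)

lemma vle_divide_unit: "1 \<approx> u \<Longrightarrow> x / u \<approx> x"
  by (metis divide_vle_iff vle_0_left vle_divide_iff vle_mult_left mult.right_neutral zero_neq_one)

lemma vle_mult_unit: "1 \<approx> u \<Longrightarrow> u * x \<approx> x"
  using vle_mult_right[of 1 u x] vle_mult_right[of u 1 x] by simp

lemma vle_power: "1 \<approx> u \<Longrightarrow> 1 \<approx> u ^ n"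
  by (induction n) (use veq_mult[of 1 u 1] in auto)

lemma vlt_max: "\<exists>z. z \<noteq> 0 \<and> (\<forall>g\<in>G. g \<noteq> 0 \<longrightarrow> g \<preceq> z)" if "finite G"
  using that
proof induction
  case empty then show ?case by (intro exI[of _ 1]) auto
next
  case (insert g G)
  then obtain z where z: "z \<noteq> 0" "\<forall>g\<in>G. g \<noteq> 0 \<longrightarrow> g \<preceq> z" by blast
  show ?case
  proof (cases "g \<preceq> z \<or> g = 0")
    case True then show ?thesis using z by blast
  next
    case False
    then have "\<forall>g'\<in>insert g G. g' \<noteq> 0 \<longrightarrow> g' \<preceq> g"
      using z vle_trans vlt_imp_vle by blast
    then show ?thesis using False by blast
  qed
qed

lemma ex_vgt_1: "\<exists>t. t \<noteq> 0 \<and> 1 \<prec> t"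
proof -
  obtain x where x: "x \<noteq> 0" "\<not> (x \<preceq> 1 \<and> 1 \<preceq> x)" using val_nontrivial by blast
  show ?thesis
  proof (cases "x \<preceq> 1")
    case True
    then have "1 \<prec> inverse x" using x
      by (metis inverse_eq_divide vle_0_left divide_vle_1 vle_mult_cancel_right nonzero_eq_divide_eq inverse_nonzero_iff_nonzero)
    then show ?thesis using x by (intro exI[of _ "inverse x"]) auto
  next
    case False then show ?thesis using x by blast
  qed
qed

definition unif :: 'k where "unif = (SOME t. t \<noteq> 0 \<and> 1 \<prec> t)"

lemma unif: "unif \<noteq> 0" "1 \<prec> unif"
  using someI_ex[OF ex_vgt_1] unfolding unif_def by blast+

lemma vlt_mult_unif: "x \<noteq> 0 \<Longrightarrow> 1 \<prec> t \<Longrightarrow> x \<prec> t * x"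
  using vle_mult_cancel_right[of t x 1] by simp

lemma ex_vgt: "x \<noteq> 0 \<Longrightarrow> \<exists>y. y \<noteq> 0 \<and> x \<prec> y"
  using vlt_mult_unif[of x unif] unif by (intro exI[of _ "unif * x"]) auto

lemma ex_max2: "x \<noteq> 0 \<Longrightarrow> y \<noteq> 0 \<Longrightarrow> \<exists>z. z \<noteq> 0 \<and> x \<preceq> z \<and> y \<preceq> z"
  using vle_total[of x y] vle_refl by blast

text \<open>The value group is 2-divisible because square roots exist: a root of
  \<open>X^2 - x y\<close> has the mean of the two values.\<close>

lemma ex_vbetween:
  assumes "x \<prec> y" shows "\<exists>z. z \<noteq> 0 \<and> x \<prec> z \<and> z \<prec> y"
proof (cases "y = 0")
  case True
  then show ?thesis using assms ex_vgt by auto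
next
  case False
  have "Polynomial.degree [:- (x * y), 0, 1:] > 0" by simp
  then obtain z where "poly [:- (x * y), 0, 1:] z = 0" using root_exists by blast
  then have z: "z * z = x * y" by simp
  have x0: "x \<noteq> 0" using assms by auto
  have z0: "z \<noteq> 0" using z x0 False by auto
  have "x \<prec> z"
  proof
    assume "z \<preceq> x"
    then have "z * z \<preceq> x * x" by (intro vle_mult)
    then have "y \<preceq> x" using z x0 by simp
    then show False using assms by blast
  qed
  moreover have "z \<prec> y"
  proof
    assume "y \<preceq> z"
    then have "y * y \<preceq> z * z" by (intro vle_mult)
    then have "y \<preceq> x" using z False by simp
    then show False using assms by blast
  qed
  ultimately show ?thesis using z0 by blast
qed

section \<open>Balls, boolean combinations of balls, and their traces on values and residues\<close>

definition cb :: "'k \<Rightarrow> 'k \<Rightarrow> 'k set" where "cb a r = {x. r \<preceq> x - a}"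
definition ob :: "'k \<Rightarrow> 'k \<Rightarrow> 'k set" where "ob a r = {x. r \<prec> x - a}"

lemma cb_center: "a \<in> cb a r" and ob_center: "r \<noteq> 0 \<Longrightarrow> a \<in> ob a r"
  by (auto simp: cb_def ob_def)

lemma cb_recenter: "b \<in> cb a r \<Longrightarrow> cb b r = cb a r"
  by (auto simp: cb_def intro: vle_diff_trans dest: vle_diff_commute[THEN iffD1])

lemma ob_recenter: "b \<in> ob a r \<Longrightarrow> ob b r = ob a r"
  unfolding ob_def using vlt_diff_trans vle_diff_commute diff_vle_commute
  by (smt (verit, ccfv_threshold) Collect_cong mem_Collect_eq)

lemma cb_mono: "r \<preceq> s \<Longrightarrow> cb a s \<subseteq> cb a r"
  by (auto simp: cb_def intro: vle_trans)

inductive_set bcomb :: "'k set set" where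
  cball: "r \<noteq> 0 \<Longrightarrow> cb a r \<in> bcomb"
| oball: "r \<noteq> 0 \<Longrightarrow> ob a r \<in> bcomb"
| point: "{a} \<in> bcomb"
| compl: "A \<in> bcomb \<Longrightarrow> - A \<in> bcomb"
| union: "A \<in> bcomb \<Longrightarrow> A' \<in> bcomb \<Longrightarrow> A \<union> A' \<in> bcomb"

text \<open>The elements of \<open>G\<close> represent the values at which membership in \<open>A\<close> may change.\<close>

definition breaks :: "'k set \<Rightarrow> 'k set \<Rightarrow> bool" where
  "breaks G A \<longleftrightarrow> finite G \<and> 0 \<notin> G \<and>
     (\<forall>x y. x \<noteq> 0 \<longrightarrow> y \<noteq> 0 \<longrightarrow> x \<preceq> y \<longrightarrow> (\<forall>g\<in>G. \<not> (x \<preceq> g \<and> g \<preceq> y)) \<longrightarrow> (x \<in> A \<longleftrightarrow> y \<in> A))"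

lemma breaksD:
  "breaks G A \<Longrightarrow> x \<noteq> 0 \<Longrightarrow> y \<noteq> 0 \<Longrightarrow> x \<preceq> y \<Longrightarrow> (\<And>g. g \<in> G \<Longrightarrow> x \<preceq> g \<Longrightarrow> g \<preceq> y \<Longrightarrow> False)
    \<Longrightarrow> x \<in> A \<longleftrightarrow> y \<in> A"
  unfolding breaks_def by blast

text \<open>Unless \<open>x\<close> and \<open>a\<close> have the same value, the value of
  \<open>x - a\<close> is the smaller of the two, so membership depends only on how that compares
  with \<open>r\<close>. For \<open>a = 0\<close> the second entry is replaced by \<open>r\<close>
  because break sets must not contain 0.\<close>

lemma cball_breaks:
  assumes "r \<noteq> 0" shows "breaks {r, if a = 0 then r else a} (cb a r)"
proof -
  have "x \<in> cb a r \<longleftrightarrow> y \<in> cb a r"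
    if asm: "x \<preceq> y" "\<not> (x \<preceq> r \<and> r \<preceq> y)" "a \<noteq> 0 \<longrightarrow> \<not> (x \<preceq> a \<and> a \<preceq> y)" for x y
  proof (cases "a = 0")
    case True
    have "r \<preceq> x \<longleftrightarrow> r \<preceq> y" using that(1,2) vle_trans vle_total by blast
    then show ?thesis using True by (simp add: cb_def)
  next
    case False
    consider "y \<prec> a" | "a \<prec> x" using asm(3) False by blast
    then show ?thesis
    proof cases
      case 1
      then have 2: "x \<prec> a" using that vle_trans by blast
      have "x - a \<approx> x" "y - a \<approx> y"
        using veq_diff[of x "x - a"] veq_diff[of y "y - a"] 1 2 by auto
      moreover have "r \<preceq> x \<longleftrightarrow> r \<preceq> y" using that(1,2) vle_trans vle_total by blast
      ultimately show ?thesis unfolding cb_def mem_Collect_eq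
        using vle_cong_right[of "x - a" x r] vle_cong_right[of "y - a" y r] by blast
    next
      case 2
      then have 1: "a \<prec> y" using that vle_trans by blast
      have "a - x \<approx> a" "a - y \<approx> a"
        using veq_diff[of a "a - x"] veq_diff[of a "a - y"] 1 2 by auto
      then show ?thesis unfolding cb_def mem_Collect_eq
        using vle_cong_right[of "a - x" a r] vle_cong_right[of "a - y" a r] vle_diff_commute by blast
    qed
  qed
  then show ?thesis unfolding breaks_def using assms by auto
qed

lemma oball_breaks:
  assumes "r \<noteq> 0" shows "breaks {r, if a = 0 then r else a} (ob a r)"
proof -
  have "x \<in> ob a r \<longleftrightarrow> y \<in> ob a r"
    if asm: "x \<preceq> y" "\<not> (x \<preceq> r \<and> r \<preceq> y)" "a \<noteq> 0 \<longrightarrow> \<not> (x \<preceq> a \<and> a \<preceq> y)" for x y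
  proof (cases "a = 0")
    case True
    have "x \<preceq> r \<longleftrightarrow> y \<preceq> r" using that(1,2) vle_trans vle_total by blast
    then show ?thesis using True by (simp add: ob_def)
  next
    case False
    consider "y \<prec> a" | "a \<prec> x" using asm(3) False by blast
    then show ?thesis
    proof cases
      case 1
      then have 2: "x \<prec> a" using that vle_trans by blast
      have "x - a \<approx> x" "y - a \<approx> y"
        using veq_diff[of x "x - a"] veq_diff[of y "y - a"] 1 2 by auto
      moreover have "x \<preceq> r \<longleftrightarrow> y \<preceq> r" using that(1,2) vle_trans vle_total by blast
      ultimately show ?thesis unfolding ob_def mem_Collect_eq
        using vle_cong_left[of "x - a" x r] vle_cong_left[of "y - a" y r] by blast
    next
      case 2
      then have 1: "a \<prec> y" using that vle_trans by blast
      have "a - x \<approx> a" "a - y \<approx> a"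
        using veq_diff[of a "a - x"] veq_diff[of a "a - y"] 1 2 by auto
      then show ?thesis unfolding ob_def mem_Collect_eq
        using vle_cong_left[of "a - x" a r] vle_cong_left[of "a - y" a r] diff_vle_commute by blast
    qed
  qed
  then show ?thesis unfolding breaks_def using assms by auto
qed

lemma bcomb_breaks: "A \<in> bcomb \<Longrightarrow> \<exists>G. breaks G A"
proof (induction rule: bcomb.induct)
  case (cball r a) then show ?case using cball_breaks by blast
next
  case (oball r a) then show ?case using oball_breaks by blast
next
  case (point a)
  have "breaks (if a = 0 then {} else {a}) {a}" by (auto simp: breaks_def)
  then show ?case by blast
next
  case (compl A) then show ?case by (auto simp: breaks_def)
next
  case (union A A')
  then obtain G G' where "breaks G A" "breaks G' A'" by blast
  then have "breaks (G \<union> G') (A \<union> A')" unfolding breaks_def by (simp add: Ball_def)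
  then show ?case by blast
qed

definition separated :: "'k \<Rightarrow> 'k set \<Rightarrow> bool" where
  "separated r S \<longleftrightarrow> (\<forall>x\<in>S. \<forall>y\<in>S. x \<noteq> y \<longrightarrow> x - y \<preceq> r)"

lemma separated_subset: "separated r S \<Longrightarrow> Y \<subseteq> S \<Longrightarrow> separated r Y"
  unfolding separated_def by blast

text \<open>This says that \<open>A\<close> meets only finitely many of the open balls of radius \<open>r\<close> in \<open>cb 0 r\<close>.\<close>

definition small :: "'k \<Rightarrow> 'k set \<Rightarrow> bool" where
  "small r A \<longleftrightarrow> (\<forall>S. S \<subseteq> A \<longrightarrow> S \<subseteq> cb 0 r \<longrightarrow> separated r S \<longrightarrow> finite S)"

lemma smallD: "small r A \<Longrightarrow> S \<subseteq> A \<Longrightarrow> S \<subseteq> cb 0 r \<Longrightarrow> separated r S \<Longrightarrow> finite S"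
  unfolding small_def by blast

lemma small_Un: "small r A \<Longrightarrow> small r B \<Longrightarrow> small r (A \<union> B)"
proof (unfold small_def, intro allI impI)
  fix S assume *: "\<forall>S\<subseteq>A. S \<subseteq> cb 0 r \<longrightarrow> separated r S \<longrightarrow> finite S"
    "\<forall>S\<subseteq>B. S \<subseteq> cb 0 r \<longrightarrow> separated r S \<longrightarrow> finite S" "S \<subseteq> A \<union> B" "S \<subseteq> cb 0 r" "separated r S"
  have "finite (S \<inter> A)" "finite (S \<inter> B)"
    using * separated_subset[of r S "S \<inter> A"] separated_subset[of r S "S \<inter> B"] by (auto simp: le_infI1)
  moreover have "S = S \<inter> A \<union> S \<inter> B" using *(3) by blast
  ultimately show "finite S" by (metis finite_UnI)
qed

lemma small_subset: "small r A \<Longrightarrow> B \<subseteq> A \<Longrightarrow> small r B"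
  unfolding small_def by blast

text \<open>Made for balls: a ball that meets two of the classes inside \<open>cb 0 r\<close>
  contains all of them, and otherwise a separated subset has at most one element.\<close>

lemma small_or_superset:
  assumes "\<And>x y. x \<in> A \<Longrightarrow> y \<in> A \<Longrightarrow> x \<in> cb 0 r \<Longrightarrow> x - y \<preceq> r \<Longrightarrow> cb 0 r \<subseteq> A"
  shows "small r A \<or> small r (- A)"
proof (cases "cb 0 r \<subseteq> A")
  case True
  then have "small r (- A)" unfolding small_def
    by (metis disjoint_eq_subset_Compl double_complement finite.emptyI inf.absorb_iff2 inf.orderE inf_bot_right inf_left_commute le_inf_iff subset_empty)
  then show ?thesis by blast
next
  case False
  have "small r A" unfolding small_def
  proof (intro allI impI)
    fix S assume S: "S \<subseteq> A" "S \<subseteq> cb 0 r" "separated r S"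
    have "x = y" if "x \<in> S" "y \<in> S" for x y
      using assms[of x y] S that False unfolding separated_def by blast
    then show "finite S" by (metis finite.simps is_singletonI' is_singleton_the_elem)
  qed
  then show ?thesis by blast
qed

lemma cb_0_subset: "x \<in> cb 0 r \<Longrightarrow> x - y \<preceq> r \<Longrightarrow> s \<preceq> x - y \<Longrightarrow> x \<in> cb a s \<Longrightarrow> cb 0 r \<subseteq> cb a s"
  by (metis cb_mono cb_recenter vle_trans)

text \<open>On the residue field C-minimality becomes strong minimality: only finite and cofinite
  traces occur.\<close>

lemma bcomb_small: "A \<in> bcomb \<Longrightarrow> small r A \<or> small r (- A)"
proof (induction rule: bcomb.induct)
  case (cball s a)
  show ?case
  proof (rule small_or_superset)
    fix x y assume *: "x \<in> cb a s" "y \<in> cb a s" "x \<in> cb 0 r" "x - y \<preceq> r"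
    have "s \<preceq> x - y" using *(1,2) vle_diff_trans[of s x a y] vle_diff_commute[of s y a] by (auto simp: cb_def)
    then show "cb 0 r \<subseteq> cb a s" using * cb_0_subset by blast
  qed
next
  case (oball s a)
  show ?case
  proof (rule small_or_superset)
    fix x y assume *: "x \<in> ob a s" "y \<in> ob a s" "x \<in> cb 0 r" "x - y \<preceq> r"
    have s: "s \<prec> x - y" using *(1,2) vlt_diff_trans[of x a s y] diff_vle_commute[of y a s] by (auto simp: ob_def)
    show "cb 0 r \<subseteq> ob a s"
    proof
      fix z assume "z \<in> cb 0 r"
      then have "r \<preceq> z - x" using *(3) by (auto simp: cb_def intro: vle_diff)
      then have "s \<prec> z - x" using s *(4) vle_trans by blast
      then show "z \<in> ob a s" using *(1) vlt_diff_trans by (auto simp: ob_def)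
    qed
  qed
next
  case (point a)
  have "small r {a}" by (auto simp: small_def intro: finite_subset)
  then show ?case by blast
next
  case (compl A) then show ?case by auto
next
  case (union A A')
  have *: "small r (- (A \<union> A'))" if "small r (-A) \<or> small r (-A')"
    using that small_subset[of r _ "- (A \<union> A')"] by blast
  show ?case using union.IH small_Un * by blast
qed

text \<open>Balls are clopen, so only the points that enter the combination can be boundary
  points.\<close>

lemma bcomb_interior:
  assumes "A \<in> bcomb"
  shows "\<exists>S. finite S \<and> (\<forall>a. a \<notin> S \<longrightarrow> (\<exists>r. r \<noteq> 0 \<and> (cb a r \<subseteq> A \<or> cb a r \<subseteq> - A)))"
  using assms
proof (induction rule: bcomb.induct)
  case (cball s a)
  have "cb b s \<subseteq> cb a s \<or> cb b s \<subseteq> - cb a s" for b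
    by (metis cb_recenter disjoint_eq_subset_Compl disjoint_iff order_refl)
  then show ?case using cball by (intro exI[of _ "{}"]) auto
next
  case (oball s a)
  obtain s' where s': "s' \<noteq> 0" "s \<prec> s'" using ex_vgt oball by blast
  have "cb b s' \<subseteq> ob a s \<or> cb b s' \<subseteq> - ob a s" for b
  proof -
    have "cb b s' \<subseteq> ob b s" using s' by (auto simp: cb_def ob_def intro: vle_trans)
    moreover have "ob b s \<subseteq> ob a s \<or> ob b s \<subseteq> - ob a s"
      by (metis ob_recenter disjoint_eq_subset_Compl disjoint_iff order_refl)
    ultimately show ?thesis by blast
  qed
  then show ?case using s' by (intro exI[of _ "{}"]) auto
next
  case (point a)
  have "cb b ((b - a) * unif) \<subseteq> - {a}" if "b \<noteq> a" for b
    using that vlt_mult_unif[of "b - a" unif] unif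
    by (auto simp: cb_def mult.commute[of _ unif] vle_diff_commute[of _ a b])
  then have "\<exists>r. r \<noteq> 0 \<and> (cb b r \<subseteq> {a} \<or> cb b r \<subseteq> - {a})" if "b \<notin> {a}" for b
    using that unif by (intro exI[of _ "(b - a) * unif"]) auto
  then show ?case by (intro exI[of _ "{a}"]) blast
next
  case (compl A)
  then obtain S where "finite S" "\<forall>a. a \<notin> S \<longrightarrow> (\<exists>r. r \<noteq> 0 \<and> (cb a r \<subseteq> A \<or> cb a r \<subseteq> - A))" by blast
  moreover have "\<exists>r. r \<noteq> 0 \<and> (cb a r \<subseteq> - A \<or> cb a r \<subseteq> - (- A))"
    if "\<exists>r. r \<noteq> 0 \<and> (cb a r \<subseteq> A \<or> cb a r \<subseteq> - A)" for a
    using that unfolding double_complement by fast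
  ultimately show ?case by (intro exI[of _ S]) simp
next
  case (union A A')
  obtain S where S: "finite S" "\<forall>a. a \<notin> S \<longrightarrow> (\<exists>r. r \<noteq> 0 \<and> (cb a r \<subseteq> A \<or> cb a r \<subseteq> - A))"
    using union.IH(1) by blast
  obtain S' where S': "finite S'" "\<forall>a. a \<notin> S' \<longrightarrow> (\<exists>r. r \<noteq> 0 \<and> (cb a r \<subseteq> A' \<or> cb a r \<subseteq> - A'))"
    using union.IH(2) by blast
  show ?case
  proof (intro exI[of _ "S \<union> S'"] conjI allI impI)
    fix a assume a: "a \<notin> S \<union> S'"
    obtain r where r: "r \<noteq> 0" "cb a r \<subseteq> A \<or> cb a r \<subseteq> - A" using S(2) a by auto
    obtain r' where r': "r' \<noteq> 0" "cb a r' \<subseteq> A' \<or> cb a r' \<subseteq> - A'" using S'(2) a by auto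
    obtain r'' where r'': "r'' \<noteq> 0" "r \<preceq> r''" "r' \<preceq> r''" using ex_max2[OF r(1) r'(1)] by blast
    have "cb a r'' \<subseteq> cb a r" "cb a r'' \<subseteq> cb a r'" using cb_mono r'' by auto
    then have "cb a r'' \<subseteq> A \<union> A' \<or> cb a r'' \<subseteq> - (A \<union> A')"
      using r(2) r'(2) by (elim disjE) auto
    then show "\<exists>r. r \<noteq> 0 \<and> (cb a r \<subseteq> A \<union> A' \<or> cb a r \<subseteq> - (A \<union> A'))" using r''(1) by blast
  qed (use S(1) S'(1) in auto)
qed

lemma bcomb_contains_ball:
  assumes "A \<in> bcomb" "infinite A" shows "\<exists>a r. r \<noteq> 0 \<and> cb a r \<subseteq> A"
proof -
  obtain S where S: "finite S" "\<And>a. a \<notin> S \<Longrightarrow> \<exists>r. r \<noteq> 0 \<and> (cb a r \<subseteq> A \<or> cb a r \<subseteq> - A)"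
    using bcomb_interior assms by blast
  obtain a where "a \<in> A" "a \<notin> S" using S assms by (meson finite_subset subsetI)
  then show ?thesis using S(2)[of a] cb_center by blast
qed

section \<open>Behaviour near zero\<close>

definition nb0 :: "'k filter" where
  "nb0 = (INF g\<in>-{0}. principal {d. d \<noteq> 0 \<and> g \<preceq> d})"

lemma eventually_nb0: "eventually P nb0 \<longleftrightarrow> (\<exists>g. g \<noteq> 0 \<and> (\<forall>d. d \<noteq> 0 \<longrightarrow> g \<preceq> d \<longrightarrow> P d))"
  unfolding nb0_def
proof (subst eventually_INF_base)
  show "\<exists>x\<in>-{0}. principal {d. d \<noteq> 0 \<and> x \<preceq> d}
      \<le> inf (principal {d. d \<noteq> 0 \<and> a \<preceq> d}) (principal {d. d \<noteq> 0 \<and> b \<preceq> d})"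
    if ab: "a \<in> -{0}" "b \<in> -{0}" for a b
  proof -
    obtain z where "z \<noteq> 0" "a \<preceq> z" "b \<preceq> z" using ex_max2[of a b] ab by auto
    then show ?thesis by (intro bexI[of _ z]) (auto intro: vle_trans)
  qed
  show "- {0 :: 'k} \<noteq> {}" by (metis ComplI empty_iff singletonD zero_neq_one)
qed (auto simp: eventually_principal)

lemma nb0_nonempty: "\<not> eventually (\<lambda>_. False) nb0"
  by (auto simp: eventually_nb0)

lemma eventually_nb0_obtain: "eventually P nb0 \<Longrightarrow> g \<noteq> 0 \<Longrightarrow> \<exists>d. d \<noteq> 0 \<and> g \<preceq> d \<and> P d"
  unfolding eventually_nb0 by (metis ex_max2)

lemma eventually_nb0_vge: "g \<noteq> 0 \<Longrightarrow> \<forall>\<^sub>F d in nb0. d \<noteq> 0 \<and> g \<preceq> d"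
  unfolding eventually_nb0 by blast

lemma eventually_nb0_scale:
  assumes "eventually P nb0" "b \<noteq> 0" shows "\<forall>\<^sub>F d in nb0. P (b * d)"
proof -
  obtain g where g: "g \<noteq> 0" "\<And>d. d \<noteq> 0 \<Longrightarrow> g \<preceq> d \<Longrightarrow> P d" using assms(1) unfolding eventually_nb0 by blast
  have "P (b * d)" if "d \<noteq> 0" "g / b \<preceq> d" for d
    using g(2)[of "b * d"] that assms(2) by (simp add: divide_vle_iff mult.commute)
  then show ?thesis unfolding eventually_nb0 using g(1) assms(2) by (intro exI[of _ "g / b"]) auto
qed

lemma finite_vmin:
  assumes "finite G" "G \<noteq> {}" shows "\<exists>g\<in>G. \<forall>h\<in>G. g \<preceq> h"
  using assms
proof (induction rule: finite_ne_induct)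
  case (insert g G)
  then obtain m where "m \<in> G" "\<forall>h\<in>G. m \<preceq> h" by blast
  then show ?case using vle_total[of g m] vle_trans vle_refl by (metis insert_iff)
qed auto

lemma finite_vmax:
  assumes "finite G" "G \<noteq> {}" shows "\<exists>g\<in>G. \<forall>h\<in>G. h \<preceq> g"
  using assms
proof (induction rule: finite_ne_induct)
  case (insert g G)
  then obtain m where "m \<in> G" "\<forall>h\<in>G. h \<preceq> m" by blast
  then show ?case using vle_total[of g m] vle_trans vle_refl by (metis insert_iff)
qed auto

text \<open>The residue of \<open>u\<close> is nonzero and not a root of unity.\<close>

definition generic :: "'k \<Rightarrow> bool" where
  "generic u \<longleftrightarrow> 1 \<approx> u \<and> (\<forall>n>0. 1 \<approx> u ^ n - 1)"

lemma generic_nz: "generic u \<Longrightarrow> u \<noteq> 0"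
  unfolding generic_def by (metis vle_0_left zero_neq_one)

lemma generic_power_unit: "generic u \<Longrightarrow> 1 \<approx> u ^ n"
  unfolding generic_def using vle_power by blast

lemma unit_inverse: "1 \<approx> u \<Longrightarrow> 1 \<approx> inverse u"
  by (metis vle_inverse inverse_1 vle_0_left zero_neq_one)

lemma generic_inverse: assumes "generic u" shows "generic (inverse u)"
proof -
  have "1 \<approx> inverse u ^ n - 1" if "n > 0" for n
  proof -
    have "inverse u ^ n - 1 = (1 - u ^ n) / u ^ n"
      using generic_nz[OF assms] by (simp add: field_simps power_inverse)
    moreover have "1 \<approx> 1 - u ^ n"
      using assms that vle_diff_commute[of 1 1 "u^n"] diff_vle_commute[of 1 "u^n" 1] unfolding generic_def by blast
    ultimately show ?thesis
      using vle_divide_unit[of "u ^ n" "1 - u ^ n"] generic_power_unit[OF assms] vle_trans by metis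
  qed
  then show ?thesis using assms unit_inverse unfolding generic_def by blast
qed

lemma generic_power_diff:
  assumes "generic u" "i \<noteq> j" shows "1 \<approx> u ^ i - u ^ j"
proof -
  have *: "1 \<approx> u ^ i - u ^ j" if "i < j" for i j
  proof -
    have "u ^ i - u ^ j = u ^ i * (1 - u ^ (j - i))"
      using that by (simp add: right_diff_distrib flip: power_add)
    moreover have "1 \<approx> 1 - u ^ (j - i)"
      using assms that vle_diff_commute[of 1 1 "u^(j - i)"] diff_vle_commute[of 1 "u^(j - i)" 1]
      unfolding generic_def by simp
    ultimately show ?thesis
      using vle_mult_unit[of "u ^ i" "1 - u ^ (j - i)"] generic_power_unit[OF assms(1), of i] vle_trans by metis
  qed
  show ?thesis using *[of i j] *[of j i] assms(2) vle_diff_commute diff_vle_commute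
    by (metis linorder_neqE_nat)
qed

lemma generic_separated:
  assumes "generic u" "y \<approx> r" "r \<noteq> 0"
  shows "separated r (range (\<lambda>i. u ^ i * y))" "inj (\<lambda>i. u ^ i * y)" "range (\<lambda>i. u ^ i * y) \<subseteq> cb 0 r"
proof -
  have *: "u ^ i * y - u ^ j * y \<preceq> r" if "i \<noteq> j" for i j
  proof -
    have "(u ^ i - u ^ j) * y \<preceq> 1 * y"
      using generic_power_diff[OF assms(1) that] by (intro vle_mult_right) blast
    then show ?thesis using assms(2) vle_trans by (metis left_diff_distrib mult_1)
  qed
  then have "u ^ i * y \<noteq> u ^ j * y \<longrightarrow> u ^ i * y - u ^ j * y \<preceq> r" for i j
    by (cases "i = j") auto
  then show "separated r (range (\<lambda>i. u ^ i * y))" unfolding separated_def by simp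
  show "inj (\<lambda>i. u ^ i * y)"
  proof (rule injI)
    fix i j assume "u ^ i * y = u ^ j * y"
    then show "i = j" using *[of i j] assms(3) by (cases "i = j") auto
  qed
  have "r \<preceq> u ^ i * y" for i
    using vle_mult[of 1 "u ^ i" r y] generic_power_unit[OF assms(1), of i] assms(2) by simp
  then show "range (\<lambda>i. u ^ i * y) \<subseteq> cb 0 r" by (auto simp: cb_def)
qed

text \<open>This is how \<open>small\<close> gets applied: the orbit of \<open>y\<close> under
  \<open>u\<close> visits each class modulo the open ball of radius \<open>r\<close> at most
  once.\<close>

lemma small_generic_finite:
  assumes "generic u" "y \<approx> r" "r \<noteq> 0" "small r A"
  shows "finite {i. u ^ i * y \<in> A}"
proof -
  have "(\<lambda>i. u ^ i * y) ` {i. u ^ i * y \<in> A} \<subseteq> range (\<lambda>i. u ^ i * y)" by blast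
  then have "finite ((\<lambda>i. u ^ i * y) ` {i. u ^ i * y \<in> A})"
    using generic_separated(1,3)[OF assms(1-3)]
    by (intro smallD[OF assms(4)]) (blast, blast, metis separated_subset)
  then show ?thesis
    using finite_imageD inj_on_subset[OF generic_separated(2)[OF assms(1-3)] subset_UNIV] by blast
qed

end

section \<open>Definable sets and functions\<close>

text \<open>\<open>D P\<close> means that the predicate \<open>P\<close> on variable assignments is definable with parameters. In
  \<open>D_ex\<close> the variable \<open>0\<close> is bound, in the manner of de Bruijn indices. The sets \<open>W r\<close> in
  \<open>completeness\<close> form a definable chain of closed balls indexed by their radii.\<close>

locale cmin_field = valued vle for vle :: "'k::field_char_0 \<Rightarrow> 'k \<Rightarrow> bool" (infix "\<preceq>" 50) +
  fixes D :: "((nat \<Rightarrow> 'k) \<Rightarrow> bool) \<Rightarrow> bool"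
  assumes D_not: "D P \<Longrightarrow> D (\<lambda>e. \<not> P e)"
    and D_conj: "D P \<Longrightarrow> D Q \<Longrightarrow> D (\<lambda>e. P e \<and> Q e)"
    and D_ex: "D (\<lambda>e. R (\<lambda>n. e (Suc n)) (e 0)) \<Longrightarrow> D (\<lambda>e. \<exists>x. R e x)"
    and D_rename: "inj g \<Longrightarrow> D P \<Longrightarrow> D (\<lambda>e. P (\<lambda>n. e (g n)))"
    and D_eq_var: "D (\<lambda>e. e i = e j)"
    and D_eq_par: "D (\<lambda>e. e i = c)"
    and D_add_var: "D (\<lambda>e. e i = e j + e k)"
    and D_mult_var: "D (\<lambda>e. e i = e j * e k)"
    and D_vle_var: "D (\<lambda>e. e i \<preceq> e j)"
    and definable_bcomb: "D (\<lambda>e. e 0 \<in> A) \<Longrightarrow> A \<in> bcomb"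
    and saturation: "(\<And>n. D (\<lambda>e. U n (e 0))) \<Longrightarrow> (\<And>n. \<exists>y. \<forall>i<n. U i y) \<Longrightarrow> \<exists>y. \<forall>i::nat. U i y"
    and completeness: "D (\<lambda>e. e 0 \<in> W (e 1)) \<Longrightarrow> (\<And>r. r \<noteq> 0 \<Longrightarrow> \<exists>a. W r = cb a r) \<Longrightarrow>
      (\<And>r s. r \<noteq> 0 \<Longrightarrow> s \<noteq> 0 \<Longrightarrow> r \<preceq> s \<Longrightarrow> W s \<subseteq> W r) \<Longrightarrow> \<exists>x. \<forall>r. r \<noteq> 0 \<longrightarrow> x \<in> W r"
begin

text \<open>A term is definable through its graph, with the value in variable 0 and the arguments
  shifted past it, so that \<open>D_ex\<close> can substitute it into a relation.\<close>

definition dt :: "((nat \<Rightarrow> 'k) \<Rightarrow> 'k) \<Rightarrow> bool" where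
  "dt t \<longleftrightarrow> D (\<lambda>e. e 0 = t (\<lambda>n. e (Suc n)))"

named_theorems D_intros

declare D_not [D_intros] D_conj [D_intros] D_ex [D_intros]

lemma D_disj [D_intros]: "D P \<Longrightarrow> D Q \<Longrightarrow> D (\<lambda>e. P e \<or> Q e)"
proof -
  assume "D P" "D Q"
  then have "D (\<lambda>e. \<not> (\<not> P e \<and> \<not> Q e))" by (intro D_not D_conj)
  then show ?thesis by simp
qed

lemma D_imp [D_intros]: "D P \<Longrightarrow> D Q \<Longrightarrow> D (\<lambda>e. P e \<longrightarrow> Q e)"
  unfolding imp_conv_disj by (intro D_disj D_not)

lemma D_all [D_intros]:
  assumes "D (\<lambda>e. R (\<lambda>n. e (Suc n)) (e 0))" shows "D (\<lambda>e. \<forall>x. R e x)"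
proof -
  have "D (\<lambda>e. \<not> (\<exists>x. \<not> R e x))" by (intro D_not D_ex assms)
  then show ?thesis by simp
qed

lemma D_const [D_intros]: "D (\<lambda>e. b)"
proof (cases b)
  case True
  then show ?thesis using D_eq_var[of 0 0] by simp
next
  case False
  then show ?thesis using D_not[OF D_eq_var[of 0 0]] by simp
qed

text \<open>These renamings insert a variable, on which nothing depends, behind the innermost one or
  two; this is the effect of passing under a further quantifier.\<close>

lemma inj_skip: "inj (\<lambda>n. case n of 0 \<Rightarrow> 0 | Suc m \<Rightarrow> Suc (Suc m))"
  by (auto simp: inj_def split: nat.splits)

lemma inj_skip2:
  "inj (\<lambda>n. case n of 0 \<Rightarrow> 0 | Suc k \<Rightarrow> (case k of 0 \<Rightarrow> Suc 0 | Suc m \<Rightarrow> Suc (Suc (Suc m))))"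
  by (auto simp: inj_def split: nat.splits)

lemma dt_shift: "dt t \<Longrightarrow> dt (\<lambda>e. t (\<lambda>n. e (Suc n)))"
  using D_rename[OF inj_skip, of "\<lambda>e. e 0 = t (\<lambda>n. e (Suc n))"] unfolding dt_def by simp

lemma D_dt_shift: "dt t \<Longrightarrow> D (\<lambda>e. e (Suc 0) = t (\<lambda>n. e (Suc (Suc n))))"
  using D_rename[OF inj_Suc, of "\<lambda>e. e 0 = t (\<lambda>n. e (Suc n))"] unfolding dt_def by simp

lemma D_dt_shift2: "dt t \<Longrightarrow> D (\<lambda>e. e (Suc 0) = t (\<lambda>n. e (Suc (Suc (Suc n)))))"
  using D_rename[OF inj_skip2, of "\<lambda>e. e (Suc 0) = t (\<lambda>n. e (Suc (Suc n)))"] D_dt_shift by simp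

lemma D_dt_shift3: "dt t \<Longrightarrow> D (\<lambda>e. e (Suc (Suc 0)) = t (\<lambda>n. e (Suc (Suc (Suc n)))))"
  using D_rename[OF inj_Suc, of "\<lambda>e. e (Suc 0) = t (\<lambda>n. e (Suc (Suc n)))"] D_dt_shift by simp

lemma D_un:
  assumes "D (\<lambda>e. Q (e 0))" "dt t" shows "D (\<lambda>e. Q (t e))"
proof -
  have "D (\<lambda>e. \<exists>x. x = t e \<and> Q x)"
    using assms unfolding dt_def by (intro D_ex D_conj)
  then show ?thesis by simp
qed

lemma D_bin:
  assumes "D (\<lambda>e. R (e 0) (e (Suc 0)))" "dt t" "dt u" shows "D (\<lambda>e. R (t e) (u e))"
proof -
  \<comment> \<open>The variable quantified last is variable 0, hence \<open>x\<close> comes after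
    \<open>y\<close>.\<close>
  have "D (\<lambda>e. \<exists>y x. x = t e \<and> y = u e \<and> R x y)"
    using assms(1) dt_shift[OF assms(2)] D_dt_shift[OF assms(3)] unfolding dt_def
    by (intro D_ex D_conj)
  then show ?thesis by simp
qed

lemma D_ter:
  assumes "D (\<lambda>e. R (e 0) (e (Suc 0)) (e (Suc (Suc 0))))" "dt t" "dt u" "dt w"
  shows "D (\<lambda>e. R (t e) (u e) (w e))"
proof -
  have "D (\<lambda>e. \<exists>z y x. x = t e \<and> y = u e \<and> z = w e \<and> R x y z)"
    using assms(1) dt_shift[OF dt_shift[OF assms(2)]] D_dt_shift2[OF assms(3)] D_dt_shift3[OF assms(4)]
    unfolding dt_def by (intro D_ex D_conj)
  then show ?thesis by simp
qed

lemma dt_var [D_intros]: "dt (\<lambda>e. e i)"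
  unfolding dt_def by (rule D_eq_var)

lemma dt_const [D_intros]: "dt (\<lambda>e. c)"
  unfolding dt_def by (rule D_eq_par)

lemma dt_fun:
  assumes "D (\<lambda>e. e 0 = F (e (Suc 0)))" "dt t" shows "dt (\<lambda>e. F (t e))"
  unfolding dt_def using D_bin[of "\<lambda>x y. x = F y", OF assms(1) dt_var[of 0] dt_shift[OF assms(2)]] .

lemma dt_fun2:
  assumes "D (\<lambda>e. e 0 = F (e (Suc 0)) (e (Suc (Suc 0))))" "dt t" "dt u" shows "dt (\<lambda>e. F (t e) (u e))"
  unfolding dt_def
  using D_ter[of "\<lambda>x y z. x = F y z", OF assms(1) dt_var[of 0] dt_shift[OF assms(2)] dt_shift[OF assms(3)]] .

lemma D_eq [D_intros]: "dt t \<Longrightarrow> dt u \<Longrightarrow> D (\<lambda>e. t e = u e)"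
  using D_bin[of "(=)"] D_eq_var by blast

lemma D_vle [D_intros]: "dt t \<Longrightarrow> dt u \<Longrightarrow> D (\<lambda>e. t e \<preceq> u e)"
  using D_bin[of "(\<preceq>)"] D_vle_var by blast

lemma dt_add [D_intros]: "dt t \<Longrightarrow> dt u \<Longrightarrow> dt (\<lambda>e. t e + u e)"
  using dt_fun2[of "(+)"] D_add_var by blast

lemma dt_mult [D_intros]: "dt t \<Longrightarrow> dt u \<Longrightarrow> dt (\<lambda>e. t e * u e)"
  using dt_fun2[of "(*)"] D_mult_var by blast

lemma dt_diff [D_intros]:
  assumes "dt t" "dt u" shows "dt (\<lambda>e. t e - u e)"
proof -
  have "D (\<lambda>e. e (Suc 0) = e 0 + e (Suc (Suc 0)))" by (rule D_add_var)
  then have "D (\<lambda>e. e 0 = e (Suc 0) - e (Suc (Suc 0)))" by (simp add: eq_diff_eq eq_commute)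
  then show ?thesis using dt_fun2[of "(-)"] assms by blast
qed

lemma dt_divide [D_intros]:
  assumes "dt t" "dt u" shows "dt (\<lambda>e. t e / u e)"
proof -
  \<comment> \<open>The first disjunct accounts for the convention that division by 0 yields
    0.\<close>
  have "D (\<lambda>e. (e (Suc (Suc 0)) = 0 \<and> e 0 = 0) \<or> (e (Suc (Suc 0)) \<noteq> 0 \<and> e (Suc 0) = e 0 * e (Suc (Suc 0))))"
    by (intro D_intros)
  moreover have "((z = 0 \<and> x = 0) \<or> (z \<noteq> 0 \<and> y = x * z)) = (x = y / z)" for x y z :: 'k
    by (cases "z = 0") (auto simp: eq_divide_eq)
  ultimately have "D (\<lambda>e. e 0 = e (Suc 0) / e (Suc (Suc 0)))" by simp
  then show ?thesis using dt_fun2[of "(/)"] assms by blast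
qed

lemma dt_power [D_intros]: "dt t \<Longrightarrow> dt (\<lambda>e. t e ^ n)"
  by (induction n) (auto intro: D_intros)

lemma D_eventually [D_intros]:
  "D (\<lambda>e. R (\<lambda>n. e (Suc n)) (e 0)) \<Longrightarrow> D (\<lambda>e. eventually (R e) nb0)"
proof -
  assume "D (\<lambda>e. R (\<lambda>n. e (Suc n)) (e 0))"
  then have "D (\<lambda>e. R (\<lambda>n. e (Suc (Suc n))) (e 0))"
    using D_rename[OF inj_skip, of "\<lambda>e. R (\<lambda>n. e (Suc n)) (e 0)"] by simp
  then show ?thesis unfolding eventually_nb0 by (intro D_intros)
qed

section \<open>Consequences of C-minimality and saturation for definable sets\<close>

abbreviation dset :: "'k set \<Rightarrow> bool" where "dset A \<equiv> D (\<lambda>e. e 0 \<in> A)"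

lemma D_mem: "dset A \<Longrightarrow> dt t \<Longrightarrow> D (\<lambda>e. t e \<in> A)"
  by (rule D_un)

lemma dset_cb: "dset (cb a r)"
  unfolding cb_def mem_Collect_eq by (intro D_intros)

lemma D_finite: "finite A \<Longrightarrow> dset A"
  by (induction rule: finite_induct) (auto intro!: D_intros)

lemma eventually_or_not:
  assumes "D (\<lambda>e. Q (e 0))"
  shows "(\<forall>\<^sub>F d in nb0. Q d) \<or> (\<forall>\<^sub>F d in nb0. \<not> Q d)"
proof -
  have "dset {x. Q x}" using assms by simp
  then obtain G where G: "breaks G {x. Q x}" using definable_bcomb bcomb_breaks by blast
  obtain z where z: "z \<noteq> 0" "\<And>g. g \<in> G \<Longrightarrow> g \<preceq> z"
    using vlt_max[of G] G unfolding breaks_def by metis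
  \<comment> \<open>All break values are at most that of \<open>z\<close>; the factor
    \<open>unif\<close> puts \<open>h\<close> strictly past them.\<close>
  define h where "h = unif * z"
  have h: "h \<noteq> 0" "z \<prec> h" using z unif vlt_mult_unif unfolding h_def by auto
  have "Q d \<longleftrightarrow> Q h" if "d \<noteq> 0" "h \<preceq> d" for d
    using breaksD[OF G h(1) that] z(2) h(2) vle_trans by blast
  then show ?thesis unfolding eventually_nb0 using h(1) by blast
qed

lemma not_eventually:
  assumes "D (\<lambda>e. Q (e 0))" "\<not> eventually Q nb0" shows "\<forall>\<^sub>F d in nb0. \<not> Q d"
  using eventually_or_not assms by blast

text \<open>Saturation in the index \<open>g\<close>: finitely many of the conditions are met at the
  largest of their indices, so a single index serves the whole sequence.\<close>

lemma increasing_union: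
  assumes S: "D (\<lambda>e. S (e 0) (e (Suc 0)))"
    and mono: "\<And>g h x. g \<noteq> 0 \<Longrightarrow> h \<noteq> 0 \<Longrightarrow> g \<preceq> h \<Longrightarrow> S g x \<Longrightarrow> S h x"
    and ex: "\<And>i::nat. \<exists>g. g \<noteq> 0 \<and> S g (s i)"
  shows "\<exists>g. g \<noteq> 0 \<and> (\<forall>i. S g (s i))"
proof -
  have "\<exists>g. \<forall>i. g \<noteq> 0 \<and> S g (s i)"
  proof (rule saturation)
    show "D (\<lambda>e. e 0 \<noteq> 0 \<and> S (e 0) (s n))" for n
      by (intro D_intros D_bin[OF S])
    show "\<exists>y. \<forall>i<n. y \<noteq> 0 \<and> S y (s i)" for n
    proof -
      obtain g where g: "\<And>i. g i \<noteq> 0 \<and> S (g i) (s i)" using ex by metis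
      obtain z where "z \<noteq> 0" "\<forall>h\<in>g ` {..<n}. h \<noteq> 0 \<longrightarrow> h \<preceq> z"
        using vlt_max[of "g ` {..<n}"] by auto
      then show ?thesis using g mono by blast
    qed
  qed
  then show ?thesis by blast
qed

text \<open>It turns a modulus that varies from point to point into one that works at infinitely
  many points, and for definable sets then on a whole ball.\<close>

lemma increasing_union_infinite:
  assumes S: "D (\<lambda>e. S (e 0) (e (Suc 0)))"
    and mono: "\<And>g h x. g \<noteq> 0 \<Longrightarrow> h \<noteq> 0 \<Longrightarrow> g \<preceq> h \<Longrightarrow> S g x \<Longrightarrow> S h x"
    and inf: "infinite {x. \<exists>g. g \<noteq> 0 \<and> S g x}"
  shows "\<exists>g. g \<noteq> 0 \<and> infinite {x. S g x}"
proof -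
  obtain s :: "nat \<Rightarrow> 'k" where s: "inj s" "range s \<subseteq> {x. \<exists>g. g \<noteq> 0 \<and> S g x}"
    using infinite_countable_subset[OF inf] by blast
  have "\<exists>g. g \<noteq> 0 \<and> (\<forall>i. S g (s i))"
  proof (rule increasing_union[OF S])
    show "S h x" if "g \<noteq> 0" "h \<noteq> 0" "g \<preceq> h" "S g x" for g h x using mono that by blast
    show "\<exists>g. g \<noteq> 0 \<and> S g (s i)" for i using s(2) by auto
  qed
  then obtain g where g: "g \<noteq> 0" "range s \<subseteq> {x. S g x}" by auto
  then have "infinite {x. S g x}" using range_inj_infinite[OF s(1)] finite_subset by blast
  then show ?thesis using g(1) by blast
qed

lemma definable_contains_ball:
  "dset A \<Longrightarrow> infinite A \<Longrightarrow> \<exists>a r. r \<noteq> 0 \<and> cb a r \<subseteq> A"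
  using definable_bcomb bcomb_contains_ball by blast

text \<open>A bounded definable set of values would have a supremum (up to \<open>breaks\<close>), which the shift by
  \<open>v b\<close> would exceed.\<close>

lemma no_periodic:
  assumes Z: "dset Z" and b: "b \<noteq> 0" "1 \<prec> b"
    and step: "\<And>d. d \<in> Z \<Longrightarrow> d \<noteq> 0 \<Longrightarrow> b * d \<in> Z"
    and ev: "\<forall>\<^sub>F d in nb0. d \<notin> Z"
  shows "Z \<subseteq> {0}"
proof (rule ccontr)
  assume "\<not> Z \<subseteq> {0}"
  then have ex: "\<exists>z. z \<in> Z \<and> z \<noteq> 0" by blast
  obtain G where G: "breaks G Z" using Z definable_bcomb bcomb_breaks by blast
  then have fin: "finite G" and G0: "0 \<notin> G" unfolding breaks_def by auto
  define c where "c z = {g\<in>G. z \<preceq> g}" for z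
  have fin_c: "finite (c z)" for z using fin unfolding c_def by simp
  \<comment> \<open>A point of \<open>Z\<close> with the fewest break values at or above it; by
    minimality \<open>c\<close> is constant on the part of \<open>Z\<close> beyond it.\<close>
  obtain z where z: "z \<in> Z" "z \<noteq> 0" and least: "\<And>y. y \<in> Z \<Longrightarrow> y \<noteq> 0 \<Longrightarrow> card (c z) \<le> card (c y)"
    using ex_has_least_nat[of "\<lambda>z. z \<in> Z \<and> z \<noteq> 0" _ "\<lambda>z. card (c z)"] ex by metis
  have same: "c y = c z" if "y \<in> Z" "y \<noteq> 0" "z \<preceq> y" for y
    using that least[of y] by (intro card_seteq fin_c) (auto simp: c_def intro: vle_trans)
  have bpos: "y \<noteq> 0 \<Longrightarrow> y \<prec> b * y" for y using vlt_mult_unif b by blast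
  have "c z \<noteq> {}"
  proof
    assume empty: "c z = {}"
    obtain y where y: "y \<noteq> 0" "z \<preceq> y" "y \<notin> Z" using eventually_nb0_obtain[OF ev z(2)] by blast
    have "z \<in> Z \<longleftrightarrow> y \<in> Z" using breaksD[OF G z(2) y(1,2)] empty unfolding c_def by blast
    then show False using z y by blast
  qed
  then obtain g where g: "g \<in> c z" "\<And>h. h \<in> c z \<Longrightarrow> g \<preceq> h" using finite_vmin[OF fin_c] by blast
  then have g0: "g \<noteq> 0" using G0 unfolding c_def by auto
  have "b * z \<in> Z" "b * z \<noteq> 0" using step z b by auto
  then have "c (b * z) = c z" using same bpos[OF z(2)] vlt_imp_vle by blast
  then have "b * z \<preceq> g" using g(1) unfolding c_def by blast
  then have zy: "z \<preceq> g / b" using b(1) by (simp add: vle_divide_iff mult.commute)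
  \<comment> \<open>As \<open>g\<close> is the first break value from \<open>z\<close> on, none lies
    between \<open>z\<close> and \<open>g / b\<close>. So \<open>g / b\<close>, \<open>g\<close> and
    \<open>b * g\<close> are in \<open>Z\<close>; but \<open>b * g\<close> is past the break value
    \<open>g\<close>, which \<open>c\<close> should still count there.\<close>
  have "z \<in> Z \<longleftrightarrow> g / b \<in> Z"
  proof (rule breaksD[OF G z(2) _ zy])
    fix h assume "h \<in> G" "z \<preceq> h" "h \<preceq> g / b"
    then have "g \<preceq> g / b" using g(2)[of h] vle_trans unfolding c_def by blast
    then show False using bpos[of "g / b"] b(1) g0 by simp
  qed (use g0 b in auto)
  then have "g / b \<in> Z" using z by blast
  then have "g \<in> Z" using step[of "g / b"] b(1) g0 by simp
  then have "b * g \<in> Z" "b * g \<noteq> 0" using step g0 b by auto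
  moreover have "z \<preceq> b * g" using g(1) bpos[OF g0] vle_trans vlt_imp_vle unfolding c_def by blast
  ultimately have "g \<in> c (b * g)" using same g(1) by blast
  then show False using bpos[OF g0] unfolding c_def by blast
qed

text \<open>A root of \<open>X * (X - 1) * ... * (X ^ n - 1) = 1\<close> will do. If it had negative
  value, each further factor would have value at most 0, and the product could not have value 0. So
  all factors are integral with product 1, hence units.\<close>

lemma generic_approx: "\<exists>y. 1 \<approx> y \<and> (\<forall>i<n::nat. 1 \<approx> y ^ Suc i - 1)"
proof -
  let ?Q = "\<Prod>i<n. Polynomial.monom 1 (Suc i) - 1 :: 'k poly"
  have "?Q \<noteq> 0"
  proof -
    have "Polynomial.monom 1 (Suc i) \<noteq> (1 :: 'k poly)" for i
      by (metis Zero_not_Suc degree_1 degree_monom_eq zero_neq_one)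
    then show ?thesis by (simp add: prod_zero_iff)
  qed
  \<comment> \<open>The polynomial is \<open>X * ?Q - 1\<close>.\<close>
  then have "Polynomial.degree (pCons (-1) ?Q) > 0" by (simp add: degree_pCons_eq)
  then obtain y where "poly (pCons (-1) ?Q) y = 0" using root_exists by blast
  then have y: "y * (\<Prod>i<n. y ^ Suc i - 1) = 1" by (simp add: poly_prod poly_monom)
  have int: "1 \<preceq> y"
  proof (rule ccontr)
    assume a: "\<not> 1 \<preceq> y"
    have pow: "y ^ Suc i \<prec> 1" for i
    proof (induction i)
      case (Suc i)
      have "y * y ^ Suc i \<prec> 1"
      proof
        assume "1 \<preceq> y * y ^ Suc i"
        moreover have "y * y ^ Suc i \<preceq> y * 1" using Suc vlt_imp_vle by (intro vle_mult_left) blast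
        ultimately show False using a vle_trans by (metis mult_1_right)
      qed
      then show ?case by simp
    qed (use a in simp)
    have "y ^ Suc i - 1 \<preceq> 1" for i
      using pow[of i] vle_add[of 1 "y ^ Suc i - 1" 1] vlt_imp_vle[of "y ^ Suc i - 1" 1] by auto
    then have "(\<Prod>i<n. y ^ Suc i - 1) \<preceq> 1"
      by (induction n) (auto dest: vle_mult simp: vle_mult[of _ 1 _ 1, simplified])
    then have "y * (\<Prod>i<n. y ^ Suc i - 1) \<preceq> y * 1" by (intro vle_mult_left)
    then show False using y a by simp
  qed
  have fac: "1 \<preceq> y ^ Suc i - 1" for i
  proof -
    have "1 \<preceq> y ^ m" for m using int by (induction m) (auto intro: vle_1_mult)
    from this[of "Suc i"] show ?thesis by (intro vle_diff) auto
  qed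
  have prod: "1 \<preceq> (\<Prod>i\<in>I. y ^ Suc i - 1)" if "finite I" for I
    using that by (induction rule: finite_induct) (simp_all add: vle_1_mult[OF fac, simplified])
  have unit: "x \<preceq> 1" if "1 \<preceq> w" "x * w = 1" for x w
    using vle_mult_left[OF that(1), of x] that(2) by simp
  have "y ^ Suc i - 1 \<preceq> 1" if "i < n" for i
  proof (rule unit)
    show "1 \<preceq> y * (\<Prod>j\<in>{..<n}-{i}. y ^ Suc j - 1)" using int prod by (intro vle_1_mult) auto
    have "(\<Prod>j<n. y ^ Suc j - 1) = (y ^ Suc i - 1) * (\<Prod>j\<in>{..<n}-{i}. y ^ Suc j - 1)"
      using that by (subst prod.remove[of _ i]) auto
    then show "(y ^ Suc i - 1) * (y * (\<Prod>j\<in>{..<n}-{i}. y ^ Suc j - 1)) = 1"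
      using y by (simp add: mult.left_commute)
  qed
  moreover have "y \<preceq> 1" using unit[OF prod[of "{..<n}"] y] by simp
  ultimately show ?thesis using int fac by blast
qed

lemma ex_generic: "\<exists>u. generic u"
proof -
  have "\<exists>y. \<forall>i::nat. 1 \<approx> y \<and> 1 \<approx> y ^ Suc i - 1"
  proof (rule saturation)
    show "D (\<lambda>e. 1 \<approx> e 0 \<and> 1 \<approx> e 0 ^ Suc n - 1)" for n by (intro D_intros)
    show "\<exists>y. \<forall>i<n. 1 \<approx> y \<and> 1 \<approx> y ^ Suc i - 1" for n using generic_approx by blast
  qed
  then show ?thesis unfolding generic_def by (metis gr0_conv_Suc)
qed

definition gen :: 'k where "gen = (SOME u. generic u)"

lemma generic_gen: "generic gen"
  unfolding gen_def using ex_generic by (rule someI_ex)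

lemma small_cases: "dset A \<Longrightarrow> small r A \<or> small r (- A)"
  using definable_bcomb bcomb_small by blast

end

section \<open>Limits of definable functions\<close>

lemma ex_sequence:
  assumes "\<And>S. finite S \<Longrightarrow> \<exists>x. P x \<and> (\<forall>y\<in>S. R y x)"
  shows "\<exists>s::nat \<Rightarrow> 'a. \<forall>n. P (s n) \<and> (\<forall>i<n. R (s i) (s n))"
proof -
  have "\<exists>s. \<forall>n::nat. P (s n) \<and> (\<forall>i<n. R (s i) (s n))"
  proof (rule dependent_wf_choice[where R = less_than and P = "\<lambda>s n x. P x \<and> (\<forall>i<n. R (s i) x)"])
    fix n :: nat and s :: "nat \<Rightarrow> 'a"
    show "\<exists>x. P x \<and> (\<forall>i<n. R (s i) x)" using assms[of "s ` {..<n}"] by auto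
  qed auto
  then show ?thesis .
qed

context cmin_field begin

section \<open>Residues and values of definable functions near 0\<close>

abbreviation dfun :: "('k \<Rightarrow> 'k) \<Rightarrow> bool" where "dfun F \<equiv> D (\<lambda>e. e 0 = F (e (Suc 0)))"

text \<open>The forward orbit puts infinitely many residue classes into \<open>A\<close> and the
  backward orbit infinitely many into its complement, contrary to
  \<open>small_cases\<close>.\<close>

lemma generic_two_sided:
  assumes "dset A" "generic u" "y \<approx> r" "r \<noteq> 0"
    and in_A: "\<And>i. i > 0 \<Longrightarrow> u ^ i * y \<in> A" and not_in_A: "\<And>i. inverse u ^ i * y \<notin> A"
  shows False
proof -
  consider "small r A" | "small r (- A)" using small_cases[OF assms(1)] by blast
  then show False
  proof cases
    case 1
    have "{0<..} \<subseteq> {i. u ^ i * y \<in> A}" using in_A by auto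
    then show False using small_generic_finite[OF assms(2-4) 1] finite_subset infinite_Ioi by blast
  next
    case 2
    have "{i. inverse u ^ i * y \<in> - A} = UNIV" using not_in_A by auto
    then show False
      using small_generic_finite[OF generic_inverse[OF assms(2)] assms(3,4) 2] by simp
  qed
qed

text \<open>If the residue of \<open>r\<close> did not stabilize, then infinitely many disjoint shells around \<open>0\<close>
  would have cofinite images in the residue field, and by saturation some residue would be
  attained on all of them.\<close>

theorem residue_eventually_constant:
  assumes r: "dfun r" and ev: "\<forall>\<^sub>F d in nb0. 1 \<preceq> r d"
  shows "\<exists>c. \<forall>\<^sub>F d in nb0. 1 \<prec> r d - c"
proof (rule ccontr)
  note dr = D_intros dt_fun[OF r]
  assume "\<nexists>c. \<forall>\<^sub>F d in nb0. 1 \<prec> r d - c"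
  then have "\<forall>\<^sub>F d in nb0. \<not> 1 \<prec> r d - c" for c
    by (intro not_eventually) (intro dr, blast)
  then have avoid: "\<forall>\<^sub>F d in nb0. r d - c \<preceq> 1" for c by simp
  obtain g0 where g0: "g0 \<noteq> 0" "\<And>d. d \<noteq> 0 \<Longrightarrow> g0 \<preceq> d \<Longrightarrow> 1 \<preceq> r d"
    using ev unfolding eventually_nb0 by blast
  \<comment> \<open>A set of residues, namely those attained on a shell; the end \<open>h\<close> is
    excluded so that consecutive shells are disjoint.\<close>
  define Im where "Im g h = {y. 1 \<preceq> y \<and> (\<exists>d. d \<noteq> 0 \<and> g \<preceq> d \<and> d \<prec> h \<and> 1 \<prec> y - r d)}" for g h
  have D_Im: "dset (Im g h)" for g h unfolding Im_def mem_Collect_eq by (intro dr)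
  \<comment> \<open>Beyond \<open>g\<close> infinitely many residues occur, since each single one is
    eventually avoided. \<open>increasing_union\<close> gathers a sequence of them in one shell,
    whose image is therefore not small and hence cofinite.\<close>
  have shell: "\<exists>h. h \<noteq> 0 \<and> g \<prec> h \<and> small 1 (- Im g h)" if g: "g \<noteq> 0" "g0 \<preceq> g" for g
  proof -
    let ?P = "\<lambda>y. \<exists>d. d \<noteq> 0 \<and> g \<preceq> d \<and> y = r d"
    have "\<exists>s::nat \<Rightarrow> 'k. \<forall>n. ?P (s n) \<and> (\<forall>i<n. s n - s i \<preceq> 1)"
    proof (rule ex_sequence)
      fix S :: "'k set" assume "finite S"
      then have "\<forall>\<^sub>F d in nb0. \<forall>y\<in>S. r d - y \<preceq> 1" using avoid by (intro eventually_ball_finite) auto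
      from eventually_nb0_obtain[OF this g(1)]
      obtain d where "d \<noteq> 0" "g \<preceq> d" "\<forall>y\<in>S. r d - y \<preceq> 1" by blast
      then show "\<exists>x. ?P x \<and> (\<forall>y\<in>S. x - y \<preceq> 1)" by (intro exI[of _ "r d"]) blast
    qed
    then obtain s :: "nat \<Rightarrow> 'k" where s: "\<And>n. ?P (s n)" "\<And>i n. i < n \<Longrightarrow> s n - s i \<preceq> 1" by blast
    have s': "s i - s j \<preceq> 1" if "i \<noteq> j" for i j
      using s(2)[of i j] s(2)[of j i] that diff_vle_commute by (metis linorder_neqE_nat)
    have "\<exists>h. h \<noteq> 0 \<and> (\<forall>i. s i \<in> Im g h)"
    proof (rule increasing_union)
      show "D (\<lambda>e. e (Suc 0) \<in> Im g (e 0))" unfolding Im_def mem_Collect_eq by (intro dr)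
      show "x \<in> Im g h'" if "h \<preceq> h'" "x \<in> Im g h" for h h' x
        using that vle_trans unfolding Im_def by blast
      fix i
      obtain d where d: "d \<noteq> 0" "g \<preceq> d" "s i = r d" using s(1) by blast
      have "d \<prec> unif * d" using vlt_mult_unif d unif by blast
      moreover have "1 \<preceq> s i" using d g0 g vle_trans by metis
      ultimately have "s i \<in> Im g (unif * d)" unfolding Im_def using d by auto
      then show "\<exists>h. h \<noteq> 0 \<and> s i \<in> Im g h" using d unif by (intro exI[of _ "unif * d"]) simp
    qed
    then obtain h where h: "h \<noteq> 0" "\<And>i. s i \<in> Im g h" by blast
    have "g \<prec> h" using h(2)[of 0] vle_trans unfolding Im_def by blast
    moreover have "\<not> small 1 (Im g h)"
    proof
      assume "small 1 (Im g h)"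
      moreover have "range s \<subseteq> Im g h" using h(2) by blast
      moreover have "range s \<subseteq> cb 0 1" using h(2) by (auto simp: Im_def cb_def)
      moreover have "s i \<noteq> s j \<longrightarrow> s i - s j \<preceq> 1" for i j using s'[of i j] by (cases "i = j") auto
      then have "separated 1 (range s)" unfolding separated_def by simp
      ultimately have "finite (range s)" by (rule smallD)
      moreover have "inj s"
      proof (rule injI)
        fix i j assume "s i = s j" then show "i = j" using s'[of i j] by (cases "i = j") auto
      qed
      ultimately show False using range_inj_infinite by blast
    qed
    ultimately show ?thesis using h(1) small_cases[OF D_Im] by blast
  qed
  have "\<exists>G. \<forall>n. (G n \<noteq> 0 \<and> g0 \<preceq> G n) \<and> (G n \<prec> G (Suc n) \<and> small 1 (- Im (G n) (G (Suc n))))"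
  proof (rule dependent_nat_choice)
    show "\<exists>x. x \<noteq> 0 \<and> g0 \<preceq> x" using g0(1) by (intro exI[of _ g0]) simp
    fix x assume "x \<noteq> 0 \<and> g0 \<preceq> x"
    then show "\<exists>y. (y \<noteq> 0 \<and> g0 \<preceq> y) \<and> x \<prec> y \<and> small 1 (- Im x y)"
      using shell[of x] vle_trans vlt_imp_vle by metis
  qed
  then obtain G :: "nat \<Rightarrow> 'k" where G: "\<And>n. G n \<noteq> 0" "\<And>n. g0 \<preceq> G n" "\<And>n. G n \<prec> G (Suc n)"
    "\<And>n. small 1 (- Im (G n) (G (Suc n)))" by blast
  have G_mono: "G i \<preceq> G j" if "i \<le> j" for i j
    using that
  proof (induction rule: dec_induct)
    case (step j)
    then show ?case using vle_trans[OF step.IH vlt_imp_vle[OF G(3)]] by blast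
  qed simp
  have fin: "finite {j. gen ^ j \<notin> Im (G i) (G (Suc i))}" for i
    using small_generic_finite[OF generic_gen, of 1 1 "- Im (G i) (G (Suc i))"] G(4)[of i] by simp
  have "\<exists>y. \<forall>i. y \<in> Im (G i) (G (Suc i))"
  proof (rule saturation)
    show "dset (Im (G n) (G (Suc n)))" for n by (rule D_Im)
    fix n
    have "finite (\<Union>i<n. {j. gen ^ j \<notin> Im (G i) (G (Suc i))})" using fin by blast
    then obtain j where "j \<notin> (\<Union>i<n. {j. gen ^ j \<notin> Im (G i) (G (Suc i))})"
      using ex_new_if_finite infinite_UNIV_nat by blast
    then show "\<exists>y. \<forall>i<n. y \<in> Im (G i) (G (Suc i))" by blast
  qed
  then obtain \<xi> where \<xi>: "\<And>i. \<xi> \<in> Im (G i) (G (Suc i))" by blast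
  \<comment> \<open>The places where \<open>r\<close> has the residue of \<open>\<xi>\<close>. Every
    shell contains one, and some shell contains no break of \<open>Y\<close>; there \<open>r\<close>
    has constant residue although its image is cofinite.\<close>
  define Y where "Y = {d. 1 \<prec> \<xi> - r d}"
  have "dset Y" unfolding Y_def mem_Collect_eq by (intro dr)
  then obtain N where N: "breaks N Y" using definable_bcomb bcomb_breaks by blast
  have "\<exists>i. \<forall>x\<in>N. \<not> (G i \<preceq> x \<and> x \<prec> G (Suc i))"
  proof (rule ccontr)
    assume "\<not> ?thesis"
    then obtain x where x: "\<And>i. x i \<in> N" "\<And>i. G i \<preceq> x i" "\<And>i. x i \<prec> G (Suc i)" by metis
    have "x i \<noteq> x j" if "i < j" for i j
      using x(3)[of i] x(2)[of j] G_mono[of "Suc i" j] that vle_trans by (metis Suc_leI)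
    then have "inj x" by (metis injI linorder_neqE_nat)
    moreover have "finite (range x)" using x(1) N unfolding breaks_def by (meson finite_subset image_subsetI)
    ultimately show False using range_inj_infinite by blast
  qed
  then obtain i where i: "\<And>x. x \<in> N \<Longrightarrow> G i \<preceq> x \<Longrightarrow> x \<prec> G (Suc i) \<Longrightarrow> False" by blast
  obtain d0 where d0: "d0 \<noteq> 0" "G i \<preceq> d0" "d0 \<prec> G (Suc i)" "d0 \<in> Y"
    using \<xi>[of i] unfolding Im_def Y_def by blast
  have Y: "d \<in> Y" if d: "d \<noteq> 0" "G i \<preceq> d" "d \<prec> G (Suc i)" for d
  proof (cases "d \<preceq> d0")
    case True
    then have "d \<in> Y \<longleftrightarrow> d0 \<in> Y"
      using i d d0(3) vle_trans by (intro breaksD[OF N d(1) d0(1)]) blast+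
    then show ?thesis using d0 by blast
  next
    case False
    then have "d0 \<in> Y \<longleftrightarrow> d \<in> Y"
      using i d0(2) d(3) vle_trans vlt_imp_vle by (intro breaksD[OF N d0(1) d(1)]) blast+
    then show ?thesis using d0 by blast
  qed
  have close: "1 \<prec> gen ^ j - \<xi>" if gj: "gen ^ j \<in> Im (G i) (G (Suc i))" for j
  proof -
    obtain d where d: "d \<noteq> 0" "G i \<preceq> d" "d \<prec> G (Suc i)" "1 \<prec> gen ^ j - r d"
      using gj unfolding Im_def by blast
    then have "1 \<prec> r d - \<xi>" using Y[OF d(1-3)] diff_vle_commute unfolding Y_def by blast
    then show ?thesis using d(4) vlt_diff_trans by blast
  qed
  have inf: "infinite {j. gen ^ j \<in> Im (G i) (G (Suc i))}"
  proof
    assume "finite {j. gen ^ j \<in> Im (G i) (G (Suc i))}"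
    then have "finite ({j. gen ^ j \<in> Im (G i) (G (Suc i))} \<union> {j. gen ^ j \<notin> Im (G i) (G (Suc i))})"
      using fin by blast
    moreover have "{j. gen ^ j \<in> Im (G i) (G (Suc i))} \<union> {j. gen ^ j \<notin> Im (G i) (G (Suc i))} = UNIV" by blast
    ultimately show False by simp
  qed
  obtain j1 where j1: "gen ^ j1 \<in> Im (G i) (G (Suc i))" using inf not_finite_existsD by blast
  obtain j2 where j2: "gen ^ j2 \<in> Im (G i) (G (Suc i))" "j2 > j1"
    using inf unfolding infinite_nat_iff_unbounded by blast
  have "1 \<prec> gen ^ j1 - gen ^ j2"
    using close[OF j1] close[OF j2(1)] vlt_diff_trans diff_vle_commute by blast
  then show False using generic_power_diff[OF generic_gen, of j1 j2] j2(2) by simp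
qed

text \<open>By saturation there is a \<open>y\<close> whose full two-sided orbit consists of points
  that \<open>gen\<close> moves up. The orbit is then an increasing chain, and the set of points
  above \<open>y\<close> contradicts \<open>generic_two_sided\<close>.\<close>

lemma no_order_chain:
  assumes lt: "D (\<lambda>e. lt (e 0) (e (Suc 0)))"
    and trans: "\<And>x y z. lt x y \<Longrightarrow> lt y z \<Longrightarrow> lt x z" and irrefl: "\<And>x. \<not> lt x x"
    and r: "r \<noteq> 0" and small: "small r (- {y. y \<approx> r \<and> lt y (gen * y)})"
  shows False
proof -
  let ?C = "{y. y \<approx> r \<and> lt y (gen * y)}"
  have C: "dset ?C" unfolding mem_Collect_eq by (intro D_intros D_bin[OF lt])
  note inv = generic_inverse[OF generic_gen]
  have unit: "gen ^ i * r \<approx> r" "inverse gen ^ i * r \<approx> r" for i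
    using vle_mult_unit generic_power_unit[OF generic_gen] generic_power_unit[OF inv] by blast+
  have fin: "finite {j. gen ^ j * y \<notin> ?C}" if "y \<approx> r" for y
    using small_generic_finite[OF generic_gen that r small] by simp
  have "\<exists>y. \<forall>i. y \<approx> r \<and> gen ^ i * y \<in> ?C \<and> inverse gen ^ i * y \<in> ?C"
  proof (rule saturation)
    show "D (\<lambda>e. e 0 \<approx> r \<and> gen ^ n * e 0 \<in> ?C \<and> inverse gen ^ n * e 0 \<in> ?C)" for n
      by (intro D_conj D_mem[OF C] D_intros)
    fix n
    \<comment> \<open>The candidates are the elements \<open>gen ^ j * r\<close>; each of the
      finitely many conditions excludes only finitely many \<open>j\<close>.\<close>
    let ?B = "\<Union>i<n. {j. gen ^ j * (gen ^ i * r) \<notin> ?C} \<union> {j. gen ^ j * (inverse gen ^ i * r) \<notin> ?C}"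
    have "finite ?B" using fin[OF unit(1)] fin[OF unit(2)] by blast
    then obtain j where j: "j \<notin> ?B" using ex_new_if_finite infinite_UNIV_nat by blast
    show "\<exists>y. \<forall>i<n. y \<approx> r \<and> gen ^ i * y \<in> ?C \<and> inverse gen ^ i * y \<in> ?C"
    proof (intro exI[of _ "gen ^ j * r"] allI impI conjI)
      fix i assume "i < n"
      then show "gen ^ i * (gen ^ j * r) \<in> ?C" "inverse gen ^ i * (gen ^ j * r) \<in> ?C"
        using j by (auto simp only: mult.left_commute[of _ "gen ^ j"])
    qed (use unit in blast)+
  qed
  then obtain y where y: "y \<approx> r" "\<And>i. lt (gen ^ i * y) (gen * (gen ^ i * y))"
    "\<And>i. lt (inverse gen ^ i * y) (gen * (inverse gen ^ i * y))" by auto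
  have up: "lt y (gen ^ Suc i * y)" for i
  proof (induction i)
    case 0 then show ?case using y(2)[of 0] by simp
  next
    case (Suc i)
    have "gen * (gen ^ Suc i * y) = gen ^ Suc (Suc i) * y" by (simp add: mult.assoc)
    then show ?case using trans[OF Suc y(2)[of "Suc i"]] by metis
  qed
  have down: "inverse gen ^ i * y = y \<or> lt (inverse gen ^ i * y) y" for i
  proof (induction i)
    case (Suc i)
    have "gen * (inverse gen ^ Suc i * y) = inverse gen ^ i * y"
      using generic_nz[OF generic_gen] by simp
    then have "lt (inverse gen ^ Suc i * y) (inverse gen ^ i * y)" using y(3)[of "Suc i"] by metis
    then show ?case using Suc trans by metis
  qed simp
  show False
  proof (rule generic_two_sided[OF _ generic_gen y(1) r])
    show "dset {z. lt y z}" unfolding mem_Collect_eq by (intro D_intros D_bin[OF lt])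
    show "gen ^ i * y \<in> {z. lt y z}" if "i > 0" for i using up[of "i - 1"] that by simp
    show "inverse gen ^ i * y \<notin> {z. lt y z}" for i using down[of i] trans irrefl by auto
  qed
qed

text \<open>Every \<open>y\<close> in the orbit of \<open>r\<close> is comparable with
  \<open>gen * y\<close>, so \<open>?C\<close> and \<open>?C'\<close> are not both small. One of
  them contains almost all of the class, and \<open>no_order_chain\<close> excludes this for the
  order and for its reverse.\<close>

lemma no_order_on_class:
  assumes lt: "D (\<lambda>e. lt (e 0) (e (Suc 0)))"
    and trans: "\<And>x y z. lt x y \<Longrightarrow> lt y z \<Longrightarrow> lt x z" and irrefl: "\<And>x. \<not> lt x x"
    and r: "r \<noteq> 0"
    and total: "\<And>x y. x \<approx> r \<Longrightarrow> y \<approx> r \<Longrightarrow> x - y \<preceq> r \<Longrightarrow> lt x y \<or> lt y x"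
  shows False
proof -
  let ?C = "{y. y \<approx> r \<and> lt y (gen * y)}" and ?C' = "{y. y \<approx> r \<and> lt (gen * y) y}"
  have lt': "D (\<lambda>e. lt (e (Suc 0)) (e 0))" by (intro D_intros D_bin[OF lt])
  have D: "dset ?C" "dset ?C'" unfolding mem_Collect_eq by (intro D_intros D_bin[OF lt])+
  have "\<not> small r (- ?C)" using no_order_chain[OF lt] trans irrefl r by blast
  moreover have "\<not> small r (- ?C')"
    using no_order_chain[of "\<lambda>x y. lt y x", OF lt'] trans irrefl r by blast
  ultimately have "small r (?C \<union> ?C')" using small_cases[OF D(1)] small_cases[OF D(2)] small_Un by blast
  then have fin: "finite {i. gen ^ i * r \<in> ?C \<union> ?C'}" by (intro small_generic_finite[OF generic_gen _ r]) auto
  have "gen ^ i * r \<in> ?C \<union> ?C'" for i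
  proof -
    have unit: "gen ^ i * r \<approx> r" for i using vle_mult_unit generic_power_unit[OF generic_gen] by blast
    have "(gen ^ i - gen ^ Suc i) * r \<preceq> 1 * r"
      using generic_power_diff[OF generic_gen, of i "Suc i"] by (intro vle_mult_right) simp
    then have "gen ^ i * r - gen ^ Suc i * r \<preceq> r" by (simp only: left_diff_distrib mult_1)
    then show ?thesis using total[OF unit unit, of i "Suc i"] unit[of i] by (auto simp: mult.assoc)
  qed
  then have "{i. gen ^ i * r \<in> ?C \<union> ?C'} = UNIV" by blast
  then show False using fin infinite_UNIV_nat by metis
qed

text \<open>A function into the leading terms that depends only on the valuation has eventually constant
  valuation: otherwise its image would meet infinitely many annuli in a set of leading terms that is
  linearly ordered by the supremum of the fibre.\<close>

lemma section_val_constant: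
  assumes r: "dfun r" and g: "g \<noteq> 0"
    and nz: "\<And>d. d \<noteq> 0 \<Longrightarrow> g \<preceq> d \<Longrightarrow> r d \<noteq> 0"
    and sec: "\<And>d d'. d \<noteq> 0 \<Longrightarrow> d' \<noteq> 0 \<Longrightarrow> g \<preceq> d \<Longrightarrow> d \<approx> d' \<Longrightarrow> r d \<prec> r d' - r d"
  shows "\<exists>c. c \<noteq> 0 \<and> (\<forall>\<^sub>F d in nb0. c \<approx> r d)"
proof (rule ccontr)
  note dr = D_intros dt_fun[OF r]
  assume contra: "\<not> ?thesis"
  have avoid: "\<forall>\<^sub>F d in nb0. \<not> c \<approx> r d" if "c \<noteq> 0" for c
    using contra that by (intro not_eventually) (intro dr, blast)
  \<comment> \<open>\<open>Dy y\<close> is the fibre over the leading term of \<open>y\<close>; by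
    \<open>sec\<close> it consists of full annuli. The relation \<open>lt\<close> compares the
    suprema of fibres without presupposing that these exist.\<close>
  define Dy where "Dy y = {d. d \<noteq> 0 \<and> g \<preceq> d \<and> y \<prec> y - r d}" for y
  define lt where "lt y y' \<longleftrightarrow> (\<exists>d'. d' \<in> Dy y' \<and> (\<forall>d. d \<in> Dy y \<longrightarrow> d \<prec> d'))" for y y'
  define Dom where "Dom = {y. y \<noteq> 0 \<and> (\<exists>d. d \<in> Dy y)}"
  have D_Dy: "dset (Dy y)" for y unfolding Dy_def mem_Collect_eq by (intro dr)
  have D_Dom: "dset Dom" unfolding Dom_def Dy_def mem_Collect_eq by (intro dr)
  have D_lt: "D (\<lambda>e. lt (e 0) (e (Suc 0)))" unfolding lt_def Dy_def mem_Collect_eq by (intro dr)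
  have Dy_val: "y \<approx> r d" if "d \<in> Dy y" for d y using that veq_diff unfolding Dy_def by blast
  have Dy_annulus: "d' \<in> Dy y" if d: "d \<in> Dy y" "d \<approx> d'" "d' \<noteq> 0" for d d' y
  proof -
    have "r d \<prec> r d' - r d" using d sec unfolding Dy_def by blast
    then have "y \<prec> r d' - r d" using Dy_val[OF d(1)] vle_trans[of "r d' - r d" y "r d"] by blast
    moreover have "y \<prec> y - r d" using d(1) unfolding Dy_def by blast
    ultimately have "y \<prec> (y - r d) - (r d' - r d)" by (rule vlt_diff[rotated])
    then show ?thesis using d vle_trans unfolding Dy_def by auto
  qed
  have Dy_disjoint: "y \<prec> y - y'" if "d \<in> Dy y" "d \<in> Dy y'" for d y y'
  proof -
    have "y \<approx> y'" using Dy_val[OF that(1)] Dy_val[OF that(2)] vle_trans by blast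
    then have "y \<prec> y' - r d" using that(2) vle_trans[of "y' - r d" y y'] unfolding Dy_def by blast
    moreover have "y \<prec> y - r d" using that(1) unfolding Dy_def by blast
    ultimately have "y \<prec> (y - r d) - (y' - r d)" by (rule vlt_diff[rotated])
    then show ?thesis by simp
  qed
  \<comment> \<open>Otherwise the two fibres are cofinal in each other. Take \<open>d\<close>,
    \<open>d'\<close>, \<open>d2\<close> in increasing order and alternately from the two, with the
    same break values above all three; then \<open>d'\<close> lies in both fibres, which are
    disjoint since the leading terms differ.\<close>
  have total: "lt y y' \<or> lt y' y" if y: "y \<in> Dom" "y' \<in> Dom" "y - y' \<preceq> y" for y y'
  proof (rule ccontr)
    assume "\<not> ?thesis"
    then have cofinal: "\<And>d'. d' \<in> Dy y' \<Longrightarrow> \<exists>d. d \<in> Dy y \<and> d' \<preceq> d"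
      "\<And>d. d \<in> Dy y \<Longrightarrow> \<exists>d'. d' \<in> Dy y' \<and> d \<preceq> d'" unfolding lt_def by blast+
    obtain G G' where G: "breaks G (Dy y)" "breaks G' (Dy y')" 
      using D_Dy definable_bcomb bcomb_breaks by blast
    define c where "c d = {h \<in> G \<union> G'. d \<preceq> h}" for d
    have fin: "finite (c d)" for d using G unfolding c_def breaks_def by auto
    have anti: "c d' \<subseteq> c d" if "d \<preceq> d'" for d d' using that vle_trans unfolding c_def by blast
    obtain d where d: "d \<in> Dy y" and least: "\<And>d'. d' \<in> Dy y \<Longrightarrow> card (c d) \<le> card (c d')"
      using ex_has_least_nat[of "\<lambda>d. d \<in> Dy y" _ "\<lambda>d. card (c d)"] y(1) unfolding Dom_def by blast
    obtain d' where d': "d' \<in> Dy y'" "d \<preceq> d'" using cofinal(2) d by blast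
    obtain d2 where d2: "d2 \<in> Dy y" "d' \<preceq> d2" using cofinal(1) d' by blast
    have "c d2 = c d"
      using least[OF d2(1)] anti[of d d2] d'(2) d2(2) vle_trans by (intro card_seteq fin) blast+
    then have c_eq: "c d = c d'" "c d2 = c d'" using anti d' d2 by blast+
    have nzd: "d \<noteq> 0" "d' \<noteq> 0" "d2 \<noteq> 0" using d d' d2 unfolding Dy_def by auto
    have "d' \<in> Dy y"
    proof (cases "\<exists>h\<in>G \<union> G'. h \<approx> d'")
      case True
      then obtain h where h: "h \<in> c d'" "h \<approx> d'" unfolding c_def by blast
      then have "d2 \<approx> d'" using c_eq(2) d2(2) vle_trans unfolding c_def by blast
      then show ?thesis using Dy_annulus[OF d2(1)] nzd by blast
    next
      case False
      have "d \<in> Dy y \<longleftrightarrow> d' \<in> Dy y"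
        using False c_eq(1) by (intro breaksD[OF G(1) nzd(1,2) d'(2)]) (auto simp: c_def)
      then show ?thesis using d by blast
    qed
    then show False using Dy_disjoint d'(1) y(3) by blast
  qed
  obtain G where G: "breaks G Dom" using D_Dom definable_bcomb bcomb_breaks by blast
  \<comment> \<open>As the value of \<open>r\<close> is assumed not to stabilize, \<open>r d\<close>
    can avoid the break values of \<open>Dom\<close>. Then the whole class of \<open>r d\<close>
    lies in \<open>Dom\<close>, and \<open>lt\<close> orders its leading terms totally.\<close>
  have "\<forall>\<^sub>F d in nb0. \<forall>h\<in>G. \<not> h \<approx> r d"
  proof (rule eventually_ball_finite)
    show "finite G" using G unfolding breaks_def by blast
    show "\<forall>h\<in>G. \<forall>\<^sub>F d in nb0. \<not> h \<approx> r d"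
    proof
      fix h assume "h \<in> G"
      then have "h \<noteq> 0" using G unfolding breaks_def by blast
      then show "\<forall>\<^sub>F d in nb0. \<not> h \<approx> r d" by (rule avoid)
    qed
  qed
  then obtain d where d: "d \<noteq> 0" "g \<preceq> d" "\<And>h. h \<in> G \<Longrightarrow> \<not> h \<approx> r d"
    using eventually_nb0_obtain[OF _ g] by blast
  have rd: "r d \<noteq> 0" using nz d by blast
  have "d \<in> Dy (r d)" using d rd unfolding Dy_def by simp
  then have "r d \<in> Dom" using rd unfolding Dom_def by blast
  then have Dom: "y \<in> Dom" if "y \<approx> r d" for y
    using breaksD[OF G _ rd, of y] d(3) that vle_trans rd by (metis vle_0_left)
  show False
  proof (rule no_order_on_class[OF D_lt _ _ rd])
    show "lt x z" if "lt x y" "lt y z" for x y z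
      using that vlt_trans unfolding lt_def by blast
    show "\<not> lt x x" for x unfolding lt_def using vle_refl by blast
    show "lt x y \<or> lt y x" if "x \<approx> r d" "y \<approx> r d" "x - y \<preceq> r d" for x y
      using total[of x y] Dom that vle_trans by blast
  qed
qed

text \<open>If the value of \<open>F\<close> eventually increased under \<open>u\<close>, it would
  increase along the two-sided orbit of a point, and the set of points with larger value would
  contradict \<open>generic_two_sided\<close>. A decrease is an increase under the inverse of
  \<open>u\<close>.\<close>

lemma generic_val_invariant:
  assumes F: "dfun F" and u: "generic u" shows "\<forall>\<^sub>F d in nb0. F (u * d) \<approx> F d"
proof -
  note dr = D_intros dt_fun[OF F]
  have no_increase: False if u: "generic u" and ev: "\<forall>\<^sub>F d in nb0. F d \<prec> F (u * d)" for u
  proof -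
    obtain g where g: "g \<noteq> 0" "\<And>d. d \<noteq> 0 \<Longrightarrow> g \<preceq> d \<Longrightarrow> F d \<prec> F (u * d)"
      using ev unfolding eventually_nb0 by blast
    note inv = generic_inverse[OF u]
    have unit: "u ^ i * g \<approx> g" "inverse u ^ i * g \<approx> g" for i
      using vle_mult_unit generic_power_unit[OF u] generic_power_unit[OF inv] by blast+
    have u0: "u \<noteq> 0" by (rule generic_nz[OF u])
    have up: "F g \<prec> F (u ^ Suc i * g)" for i
    proof (induction i)
      case (Suc i)
      have "F (u ^ Suc i * g) \<prec> F (u * (u ^ Suc i * g))" using g unit(1)[of "Suc i"] u0 by simp
      then show ?case using Suc vlt_trans by (metis mult.assoc power_Suc)
    qed (use g in simp)
    have down: "F (inverse u ^ i * g) \<preceq> F g" for i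
    proof (induction i)
      case (Suc i)
      have "F (inverse u ^ Suc i * g) \<prec> F (u * (inverse u ^ Suc i * g))"
        using g unit(2)[of "Suc i"] u0 by simp
      moreover have "u * (inverse u ^ Suc i * g) = inverse u ^ i * g" using u0 by simp
      ultimately have "F (inverse u ^ Suc i * g) \<preceq> F (inverse u ^ i * g)" by (metis vlt_imp_vle)
      then show ?case using Suc vle_trans by blast
    qed simp
    show False
    proof (rule generic_two_sided[OF _ u _ g(1)])
      show "dset {y. F g \<prec> F y}" unfolding mem_Collect_eq by (intro dr)
      show "u ^ i * g \<in> {y. F g \<prec> F y}" if "i > 0" for i using up[of "i - 1"] that by simp
      show "inverse u ^ i * g \<notin> {y. F g \<prec> F y}" for i using down by simp
    qed auto
  qed
  have "\<forall>\<^sub>F d in nb0. F (u * d) \<preceq> F d"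
  proof (rule ccontr)
    assume "\<not> ?thesis"
    then have "\<forall>\<^sub>F d in nb0. F d \<prec> F (u * d)" by (intro not_eventually) (intro dr, blast)
    then show False using no_increase u by blast
  qed
  moreover have "\<forall>\<^sub>F d in nb0. F d \<preceq> F (u * d)"
  proof (rule ccontr)
    assume "\<not> ?thesis"
    then have "\<forall>\<^sub>F d in nb0. F (u * d) \<prec> F d" by (intro not_eventually) (intro dr, blast)
    then have "\<forall>\<^sub>F d in nb0. F (u * (inverse u * d)) \<prec> F (inverse u * d)"
      by (rule eventually_nb0_scale) (use generic_nz[OF u] in simp)
    then have "\<forall>\<^sub>F d in nb0. F d \<prec> F (inverse u * d)"
      using generic_nz[OF u] by (simp flip: mult.assoc)
    then show False using no_increase generic_inverse[OF u] by blast
  qed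
  ultimately show ?thesis by (rule eventually_conj)
qed

lemma vlt_mult_int: "1 \<preceq> a \<Longrightarrow> 1 \<prec> x \<Longrightarrow> 1 \<prec> a * x"
  using vle_mult_right[of 1 a x] vle_trans[of x "a * x" 1] by auto

text \<open>The key is that for a unit \<open>s\<close> the residue of
  \<open>F (s * d) / F d\<close> does not depend on \<open>d\<close> near 0. Passing from
  \<open>d\<close> to \<open>s * d\<close> then multiplies the ratio for \<open>b\<close> by
  \<open>\<rho> s (b * d) / \<rho> s d\<close>, of residue 1, so its leading term depends only on
  the value of \<open>d\<close> and \<open>section_val_constant\<close> applies.\<close>

theorem ratio_val_constant:
  assumes F: "dfun F" and nz: "\<forall>\<^sub>F d in nb0. F d \<noteq> 0" and b: "b \<noteq> 0"
  shows "\<exists>c. c \<noteq> 0 \<and> (\<forall>\<^sub>F d in nb0. c \<approx> F (b * d) / F d)"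
proof -
  note dr = D_intros dt_fun[OF F]
  define \<rho> where "\<rho> s d = F (s * d) / F d" for s d
  have inv: "\<forall>\<^sub>F d in nb0. F (gen * d) \<approx> F d" by (rule generic_val_invariant[OF F generic_gen])
  have "\<forall>\<^sub>F d in nb0. 1 \<preceq> \<rho> gen d"
    using inv nz by eventually_elim (auto simp: vle_1_divide \<rho>_def)
  moreover have "dfun (\<rho> gen)" unfolding \<rho>_def by (intro dr)
  ultimately obtain c where "\<forall>\<^sub>F d in nb0. 1 \<prec> \<rho> gen d - c"
    using residue_eventually_constant by blast
  then have "\<forall>\<^sub>F d in nb0. F d \<noteq> 0 \<and> F (gen * d) \<approx> F d \<and> 1 \<prec> \<rho> gen d - c"
    using inv nz by eventually_elim blast
  then obtain g where g: "g \<noteq> 0" "\<And>d. d \<noteq> 0 \<Longrightarrow> g \<preceq> d \<Longrightarrow> F d \<noteq> 0"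
    "\<And>d. d \<noteq> 0 \<Longrightarrow> g \<preceq> d \<Longrightarrow> F (gen * d) \<approx> F d" "\<And>d. d \<noteq> 0 \<Longrightarrow> g \<preceq> d \<Longrightarrow> 1 \<prec> \<rho> gen d - c"
    unfolding eventually_nb0 by blast
  \<comment> \<open>One \<open>g\<close>, found for \<open>gen\<close>, serves all \<open>s\<close>.
    This makes \<open>N\<close> definable and, as units preserve the bound
    \<open>g \<preceq> d\<close>, closed under multiplication.\<close>
  define N where "N = {s. 1 \<approx> s \<and> (\<forall>d. d \<noteq> 0 \<longrightarrow> g \<preceq> d \<longrightarrow> F (s * d) \<approx> F d) \<and>
    (\<forall>d d'. d \<noteq> 0 \<longrightarrow> d' \<noteq> 0 \<longrightarrow> g \<preceq> d \<longrightarrow> g \<preceq> d' \<longrightarrow> 1 \<prec> \<rho> s d - \<rho> s d')}"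
  have N_D: "dset N" unfolding N_def mem_Collect_eq \<rho>_def by (intro dr)
  have NI: "s \<in> N" if "1 \<approx> s" "\<And>d. d \<noteq> 0 \<Longrightarrow> g \<preceq> d \<Longrightarrow> F (s * d) \<approx> F d"
    "\<And>d d'. d \<noteq> 0 \<Longrightarrow> d' \<noteq> 0 \<Longrightarrow> g \<preceq> d \<Longrightarrow> g \<preceq> d' \<Longrightarrow> 1 \<prec> \<rho> s d - \<rho> s d'" for s
    using that unfolding N_def by simp
  have ND: "1 \<approx> s" "\<And>d. d \<noteq> 0 \<Longrightarrow> g \<preceq> d \<Longrightarrow> F (s * d) \<approx> F d"
    "\<And>d d'. d \<noteq> 0 \<Longrightarrow> d' \<noteq> 0 \<Longrightarrow> g \<preceq> d \<Longrightarrow> g \<preceq> d' \<Longrightarrow> 1 \<prec> \<rho> s d - \<rho> s d'" if "s \<in> N" for s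
    using that unfolding N_def by auto
  have unit_nz: "s \<noteq> 0" if "1 \<approx> s" for s using that by auto
  have scale: "s * d \<noteq> 0" "g \<preceq> s * d" if "1 \<approx> s" "d \<noteq> 0" "g \<preceq> d" for s d
    using that unit_nz[OF that(1)] vle_mult_unit[OF that(1), of d] vle_trans by auto
  have rho_unit: "1 \<approx> \<rho> s d" if "s \<in> N" "d \<noteq> 0" "g \<preceq> d" for s d
    using ND(2)[OF that] g(2)[OF that(2,3)] unfolding \<rho>_def by (simp add: vle_1_divide divide_vle_1)
  have N_mult: "s * s' \<in> N" if s: "s \<in> N" "s' \<in> N" for s s'
  proof (rule NI)
    show "1 \<approx> s * s'" using ND(1)[OF s(1)] ND(1)[OF s(2)] veq_mult[of 1 s 1 s'] by simp
    fix d assume d: "d \<noteq> 0" "g \<preceq> d"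
    note sd = scale[OF ND(1)[OF s(2)] d]
    have "F (s * (s' * d)) \<approx> F d" using ND(2)[OF s(1) sd] ND(2)[OF s(2) d] vle_trans by blast
    then show "F (s * s' * d) \<approx> F d" by (simp add: mult.assoc)
    fix d' assume d': "d' \<noteq> 0" "g \<preceq> d'"
    note sd' = scale[OF ND(1)[OF s(2)] d']
    have split: "\<rho> (s * s') x = \<rho> s (s' * x) * \<rho> s' x" if "x \<noteq> 0" "g \<preceq> x" for x
      using g(2)[OF scale[OF ND(1)[OF s(2)] that]] unfolding \<rho>_def by (simp add: mult.assoc)
    have "1 \<prec> \<rho> s (s' * d) * (\<rho> s' d - \<rho> s' d')"
      using rho_unit[OF s(1) sd] ND(3)[OF s(2) d(1) d'(1) d(2) d'(2)] by (intro vlt_mult_int) blast+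
    moreover have "1 \<prec> \<rho> s' d' * (\<rho> s (s' * d) - \<rho> s (s' * d'))"
      using rho_unit[OF s(2) d'] ND(3)[OF s(1) sd(1) sd'(1) sd(2) sd'(2)] by (intro vlt_mult_int) blast+
    ultimately have "1 \<prec> \<rho> s (s' * d) * (\<rho> s' d - \<rho> s' d') + \<rho> s' d' * (\<rho> s (s' * d) - \<rho> s (s' * d'))"
      by (rule vlt_add)
    then show "1 \<prec> \<rho> (s * s') d - \<rho> (s * s') d'"
      unfolding split[OF d] split[OF d'] by (simp add: algebra_simps)
  qed
  have "gen \<in> N"
  proof (rule NI)
    show "1 \<approx> gen" using generic_gen unfolding generic_def by blast
    show "1 \<prec> \<rho> gen d - \<rho> gen d'" if "d \<noteq> 0" "d' \<noteq> 0" "g \<preceq> d" "g \<preceq> d'" for d d'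
      using vlt_diff[OF g(4)[OF that(1,3)] g(4)[OF that(2,4)]] by simp
  qed (rule g(3))
  moreover have "1 \<in> N"
  proof (rule NI)
    fix d d' assume "d \<noteq> 0" "d' \<noteq> 0" "g \<preceq> d" "g \<preceq> d'"
    then show "1 \<prec> \<rho> 1 d - \<rho> 1 d'" using g(2) unfolding \<rho>_def by simp
  qed auto
  ultimately have pow: "gen ^ i \<in> N" for i by (induction i) (auto intro: N_mult)
  have "\<not> small 1 N"
  proof
    assume "small 1 N"
    then have "finite {i. gen ^ i * 1 \<in> N}" by (intro small_generic_finite[OF generic_gen]) auto
    then show False using pow by simp
  qed
  then have small: "small 1 (- N)" using small_cases[OF N_D] by blast
  \<comment> \<open>As \<open>N\<close> misses only finitely many residues, it contains some
    \<open>inverse gen ^ i * s\<close>; multiply back by \<open>gen ^ i\<close>, which is also in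
    \<open>N\<close>.\<close>
  have units: "s \<in> N" if s: "1 \<approx> s" for s
  proof -
    have "finite {i. inverse gen ^ i * s \<in> - N}"
      using s small by (intro small_generic_finite[OF generic_inverse[OF generic_gen], of s 1]) auto
    then obtain i where "inverse gen ^ i * s \<in> N"
      by (metis (mono_tags, lifting) Compl_iff ex_new_if_finite infinite_UNIV_nat mem_Collect_eq)
    then have "gen ^ i * (inverse gen ^ i * s) \<in> N" using pow N_mult by blast
    moreover have "gen ^ i * (inverse gen ^ i * s) = s"
      using generic_nz[OF generic_gen] by (simp add: power_inverse)
    ultimately show ?thesis by simp
  qed
  obtain h where h: "h \<noteq> 0" "g \<preceq> h" "g / b \<preceq> h" using ex_max2[of g "g / b"] g(1) b by auto
  have hd: "g \<preceq> d" "g \<preceq> b * d" "b * d \<noteq> 0" if "d \<noteq> 0" "h \<preceq> d" for d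
  proof -
    show "g \<preceq> d" by (rule vle_trans[OF h(2) that(2)])
    show "g \<preceq> b * d"
      using vle_trans[OF h(3) that(2)] divide_vle_iff[OF b, of g d] by (simp add: mult.commute)
    show "b * d \<noteq> 0" using b that by simp
  qed
  have "\<exists>c. c \<noteq> 0 \<and> (\<forall>\<^sub>F d in nb0. c \<approx> \<rho> b d)"
  proof (rule section_val_constant[OF _ h(1)])
    show "dfun (\<rho> b)" unfolding \<rho>_def by (intro dr)
    show nzr: "\<rho> b d \<noteq> 0" if "d \<noteq> 0" "h \<preceq> d" for d
      using g(2)[of d] g(2)[of "b * d"] hd[OF that] that unfolding \<rho>_def by simp
    fix d d' assume d: "d \<noteq> 0" "d' \<noteq> 0" "h \<preceq> d" "d \<approx> d'"
    define s where "s = d' / d"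
    have d': "d' = s * d" using d unfolding s_def by simp
    have s: "1 \<approx> s" using d unfolding s_def by (simp add: vle_1_divide divide_vle_1)
    note N = units[OF s]
    have gd: "g \<preceq> d" "g \<preceq> b * d" "b * d \<noteq> 0" using hd d by auto
    have "F (b * d') = \<rho> s (b * d) * F (b * d)"
      using g(2)[OF gd(3,2)] unfolding \<rho>_def d' by (simp add: mult.left_commute)
    moreover have "F d' = \<rho> s d * F d" using g(2)[OF d(1) gd(1)] unfolding \<rho>_def d' by simp
    ultimately have "\<rho> b d' = \<rho> b d * (\<rho> s (b * d) / \<rho> s d)"
      unfolding \<rho>_def[of b] by (simp add: mult.commute)
    moreover have rs: "\<rho> s d \<noteq> 0" using rho_unit[OF N d(1) gd(1)] unit_nz by blast
    ultimately have eq: "\<rho> b d' - \<rho> b d = ((\<rho> s (b * d) - \<rho> s d) / \<rho> s d) * \<rho> b d"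
      by (simp add: field_simps)
    have "1 \<prec> (\<rho> s (b * d) - \<rho> s d) / \<rho> s d"
      using ND(3)[OF N gd(3) d(1) gd(2,1)] vle_divide_unit[OF rho_unit[OF N d(1) gd(1)]] vle_trans by blast
    then show "\<rho> b d \<prec> \<rho> b d' - \<rho> b d"
      unfolding eq using vlt_mult_unif nzr[OF d(1,3)] by blast
  qed
  then show ?thesis unfolding \<rho>_def .
qed

text \<open>From \<open>d\<close> to \<open>unif * d\<close> the value of \<open>F\<close>
  eventually changes by a constant. A positive one would keep the values away from that of
  \<open>r0\<close>, a negative one would carry them down to it or below. If it is 0, the points
  beyond \<open>g\<close> with \<open>F g \<preceq> F d\<close> contradict
  \<open>no_periodic\<close>.\<close>

lemma no_bounded_approach:
  assumes F: "dfun F" and r0: "r0 \<noteq> 0" and above: "\<forall>\<^sub>F d in nb0. F d \<noteq> 0 \<and> r0 \<prec> F d"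
    and approach: "\<And>r. r \<noteq> 0 \<Longrightarrow> r0 \<prec> r \<Longrightarrow> \<forall>\<^sub>F d in nb0. F d \<preceq> r"
  shows False
proof -
  note dr = D_intros dt_fun[OF F]
  have "\<forall>\<^sub>F d in nb0. F d \<noteq> 0" using above by eventually_elim blast
  from ratio_val_constant[OF F this unif(1)]
  obtain c where c: "c \<noteq> 0" "\<forall>\<^sub>F d in nb0. c \<approx> F (unif * d) / F d" by blast
  have ratio: "\<forall>\<^sub>F d in nb0. F d * c \<approx> F (unif * d)"
    using c(2) above by eventually_elim (auto simp: vle_divide_iff divide_vle_iff mult.commute)
  have above': "\<forall>\<^sub>F d in nb0. r0 \<prec> F (unif * d)"
    using eventually_nb0_scale[OF above unif(1)] by eventually_elim blast
  have c1: "c \<approx> 1"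
  proof (rule ccontr)
    assume "\<not> c \<approx> 1"
    then consider "1 \<prec> c" | "c \<prec> 1" by blast
    then show False
    proof cases
      case 1
      have "\<forall>\<^sub>F d in nb0. F d \<preceq> c * r0" using approach[of "c * r0"] c(1) r0 vlt_mult_unif[OF r0 1] by auto
      then have "\<forall>\<^sub>F d in nb0. F (unif * d) \<preceq> c * r0" by (rule eventually_nb0_scale[OF _ unif(1)])
      then have "\<forall>\<^sub>F d in nb0. False"
        using ratio above
      proof eventually_elim
        case (elim d)
        then have "F d * c \<preceq> r0 * c" using vle_trans by (metis mult.commute)
        then show False using elim c(1) by simp
      qed
      then show False using nb0_nonempty by blast
    next
      case 2
      have "r0 \<prec> r0 / c" using 2 c(1) r0 vle_mult_cancel_left[of r0 1 c] by (simp add: divide_vle_iff)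
      then have "\<forall>\<^sub>F d in nb0. F d \<preceq> r0 / c" using approach[of "r0 / c"] c(1) r0 by auto
      then have "\<forall>\<^sub>F d in nb0. False"
        using ratio above'
      proof eventually_elim
        case (elim d)
        then have "F d * c \<preceq> r0" using c(1) by (simp add: vle_divide_iff)
        then show False using elim vle_trans by blast
      qed
      then show False using nb0_nonempty by blast
    qed
  qed
  have "\<forall>\<^sub>F d in nb0. F (unif * d) \<approx> F d"
    using ratio
  proof eventually_elim
    case (elim d)
    have "F d * c \<approx> F d * 1" using c1 vle_mult_left by blast
    then show ?case using elim vle_trans by (metis mult.right_neutral)
  qed
  then have "\<forall>\<^sub>F d in nb0. F (unif * d) \<approx> F d \<and> F d \<noteq> 0 \<and> r0 \<prec> F d"
    using above by eventually_elim blast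
  then obtain g where g: "g \<noteq> 0" "\<And>d. d \<noteq> 0 \<Longrightarrow> g \<preceq> d \<Longrightarrow> F (unif * d) \<approx> F d"
    "\<And>d. d \<noteq> 0 \<Longrightarrow> g \<preceq> d \<Longrightarrow> r0 \<prec> F d" unfolding eventually_nb0 by blast
  define Z where "Z = {d. g \<preceq> d \<and> F g \<preceq> F d}"
  have "Z \<subseteq> {0}"
  proof (rule no_periodic[OF _ unif])
    show "dset Z" unfolding Z_def mem_Collect_eq by (intro dr)
    show "unif * d \<in> Z" if "d \<in> Z" "d \<noteq> 0" for d
      using that g(2)[of d] vlt_mult_unif[OF that(2) unif(2)] vlt_imp_vle vle_trans unfolding Z_def by blast
    obtain r where r: "r \<noteq> 0" "r0 \<prec> r" "r \<prec> F g" using ex_vbetween g(3)[OF g(1) vle_refl] by blast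
    show "\<forall>\<^sub>F d in nb0. d \<notin> Z"
      using approach[OF r(1,2)] by eventually_elim (use r(3) vle_trans Z_def in blast)
  qed
  moreover have "g \<in> Z" unfolding Z_def by simp
  ultimately show False using g(1) by blast
qed

text \<open>There are only finitely many breaks: if the cut had no endpoint, some \<open>x\<close>
  inside would lie past all breaks inside and some \<open>y\<close> outside before all breaks
  outside, so that no break separates \<open>x\<close> from \<open>y\<close>.\<close>

lemma definable_cut:
  assumes R: "dset R" and nz: "0 \<notin> R" and down: "\<And>r s. s \<in> R \<Longrightarrow> r \<noteq> 0 \<Longrightarrow> r \<preceq> s \<Longrightarrow> r \<in> R"
    and r0: "r0 \<in> R" and r1: "r1 \<noteq> 0" "r1 \<notin> R"
  shows "\<exists>r. r \<noteq> 0 \<and> ((r \<in> R \<and> (\<forall>s. r \<prec> s \<longrightarrow> s \<notin> R)) \<or> (r \<notin> R \<and> (\<forall>s. s \<noteq> 0 \<longrightarrow> s \<prec> r \<longrightarrow> s \<in> R)))"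
proof (rule ccontr)
  assume contra: "\<not> ?thesis"
  have no_sup: "(h \<in> R \<longrightarrow> (\<exists>s. h \<prec> s \<and> s \<in> R)) \<and> (h \<notin> R \<longrightarrow> (\<exists>s. s \<noteq> 0 \<and> s \<prec> h \<and> s \<notin> R))"
    if "h \<noteq> 0" for h
  proof -
    have "\<not> (h \<noteq> 0 \<and> ((h \<in> R \<and> (\<forall>s. h \<prec> s \<longrightarrow> s \<notin> R)) \<or> (h \<notin> R \<and> (\<forall>s. s \<noteq> 0 \<longrightarrow> s \<prec> h \<longrightarrow> s \<in> R))))"
      using contra by (rule contrapos_nn) (rule exI)
    then show ?thesis using that by auto
  qed
  obtain G where G: "breaks G R" using R definable_bcomb bcomb_breaks by blast
  then have fin: "finite G" and G0: "0 \<notin> G" unfolding breaks_def by auto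
  obtain x where x: "x \<in> R" "\<And>h. h \<in> G \<inter> R \<Longrightarrow> h \<prec> x"
  proof (cases "G \<inter> R = {}")
    case False
    then obtain h where h: "h \<in> G \<inter> R" "\<forall>h'\<in>G \<inter> R. h' \<preceq> h"
      using finite_vmax[of "G \<inter> R"] fin by blast
    have "h \<noteq> 0" "h \<in> R" using h(1) G0 by auto
    then have "\<exists>x. h \<prec> x \<and> x \<in> R" using no_sup[of h] by simp
    then obtain x where x: "x \<in> R" "h \<prec> x" by blast
    show ?thesis
    proof (rule that[OF x(1)])
      fix h' assume "h' \<in> G \<inter> R"
      then show "h' \<prec> x" using h(2) x(2) vle_trans by blast
    qed
  qed (use r0 in blast)
  obtain y where y: "y \<notin> R" "y \<noteq> 0" "\<And>h. h \<in> G - R \<Longrightarrow> y \<prec> h"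
  proof (cases "G - R = {}")
    case False
    then obtain h where h: "h \<in> G - R" "\<forall>h'\<in>G - R. h \<preceq> h'"
      using finite_vmin[of "G - R"] fin by blast
    have "h \<noteq> 0" "h \<notin> R" using h(1) G0 by auto
    then have "\<exists>y. y \<noteq> 0 \<and> y \<prec> h \<and> y \<notin> R" using no_sup[of h] by simp
    then obtain y where y: "y \<notin> R" "y \<noteq> 0" "y \<prec> h" by blast
    show ?thesis
    proof (rule that[OF y(1,2)])
      fix h' assume "h' \<in> G - R"
      then show "y \<prec> h'" using h(2) y(3) vle_trans by blast
    qed
  qed (use r1 in blast)
  have "x \<preceq> y" using down x y vle_total by blast
  moreover have "x \<noteq> 0" using x nz by blast
  ultimately have "x \<in> R \<longleftrightarrow> y \<in> R"
    using x(2) y(3) by (intro breaksD[OF G _ y(2)]) blast+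
  then show False using x y by blast
qed

section \<open>Existence and arithmetic of limits at 0\<close>

definition lim0 :: "('k \<Rightarrow> 'k) \<Rightarrow> 'k \<Rightarrow> bool" where
  "lim0 q l \<longleftrightarrow> (\<forall>r. r \<noteq> 0 \<longrightarrow> (\<forall>\<^sub>F d in nb0. r \<preceq> q d - l))"

text \<open>Suppose that the values \<open>r\<close> of radii of balls that contain \<open>q d\<close> for all \<open>d\<close> near \<open>0\<close> have a
  supremum. If it is attained, then the residue of \<open>(q d - c) / r\<close> gives a contradiction, otherwise
  the variation \<open>q (t d) - q d\<close> does.\<close>

theorem limit_exists:
  assumes q: "dfun q"
  shows "(\<exists>l. lim0 q l) \<or> (\<forall>r. r \<noteq> 0 \<longrightarrow> (\<forall>\<^sub>F d in nb0. q d \<prec> r))"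
proof (rule disjCI)
  note dr = D_intros dt_fun[OF q]
  assume "\<not> (\<forall>r. r \<noteq> 0 \<longrightarrow> (\<forall>\<^sub>F d in nb0. q d \<prec> r))"
  then obtain r0 where r0: "r0 \<noteq> 0" "\<not> (\<forall>\<^sub>F d in nb0. q d \<prec> r0)" by blast
  then have "\<forall>\<^sub>F d in nb0. \<not> q d \<prec> r0" by (intro not_eventually) (intro dr, blast)
  then have ev0: "\<forall>\<^sub>F d in nb0. r0 \<preceq> q d - 0" by simp
  define R where "R = {r. r \<noteq> 0 \<and> (\<exists>c. \<forall>\<^sub>F d in nb0. r \<preceq> q d - c)}"
  have D_R: "dset R" unfolding R_def mem_Collect_eq by (intro dr)
  have R0: "r0 \<in> R" using ev0 r0(1) unfolding R_def by blast
  have down: "r \<in> R" if s: "s \<in> R" "r \<noteq> 0" "r \<preceq> s" for r s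
  proof -
    obtain c where "\<forall>\<^sub>F d in nb0. s \<preceq> q d - c" using s(1) unfolding R_def by blast
    then have "\<forall>\<^sub>F d in nb0. r \<preceq> q d - c" by eventually_elim (use s(3) vle_trans in blast)
    then show ?thesis using s(2) unfolding R_def by blast
  qed
  have "0 \<notin> R" unfolding R_def by simp
  have all: "r1 \<in> R" if r1: "r1 \<noteq> 0" for r1
  proof (rule ccontr)
    assume "r1 \<notin> R"
    then have "\<exists>r. r \<noteq> 0 \<and> ((r \<in> R \<and> (\<forall>s. r \<prec> s \<longrightarrow> s \<notin> R)) \<or>
        (r \<notin> R \<and> (\<forall>s. s \<noteq> 0 \<longrightarrow> s \<prec> r \<longrightarrow> s \<in> R)))"
      using down by (intro definable_cut[OF D_R \<open>0 \<notin> R\<close> _ R0 r1])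
    then obtain r where r: "r \<noteq> 0"
      "(r \<in> R \<and> (\<forall>s. r \<prec> s \<longrightarrow> s \<notin> R)) \<or> (r \<notin> R \<and> (\<forall>s. s \<noteq> 0 \<longrightarrow> s \<prec> r \<longrightarrow> s \<in> R))"
      by (elim exE conjE)
    from r(2) show False
    proof (elim disjE conjE)
      assume rR: "r \<in> R" and max: "\<forall>s. r \<prec> s \<longrightarrow> s \<notin> R"
      obtain c where c: "\<forall>\<^sub>F d in nb0. r \<preceq> q d - c" using rR unfolding R_def by blast
      have "\<forall>\<^sub>F d in nb0. 1 \<preceq> (q d - c) / r" using c by eventually_elim (simp add: vle_1_divide r(1))
      moreover have "dfun (\<lambda>d. (q d - c) / r)" by (intro dr)
      ultimately obtain c1 where c1: "\<forall>\<^sub>F d in nb0. 1 \<prec> (q d - c) / r - c1"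
        using residue_eventually_constant[of "\<lambda>d. (q d - c) / r"] by blast
      \<comment> \<open>The new centre absorbs the constant residue, so the value of
        \<open>q d - c2\<close> exceeds that of \<open>r\<close>; by maximality of \<open>r\<close>
        it eventually drops below every larger value.\<close>
      define c2 where "c2 = c + c1 * r"
      have eq: "(q d - c) / r - c1 = (q d - c2) / r" for d unfolding c2_def using r(1) by (simp add: field_simps)
      have gt: "\<forall>\<^sub>F d in nb0. r \<prec> q d - c2"
        using c1 by eventually_elim (use r(1) eq in \<open>simp add: divide_vle_1\<close>)
      have le: "\<forall>\<^sub>F d in nb0. q d - c2 \<prec> s" if s: "s \<noteq> 0" "r \<prec> s" for s
      proof -
        have "\<not> (\<forall>\<^sub>F d in nb0. s \<preceq> q d - c2)" using max s unfolding R_def by blast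
        then show ?thesis by (intro not_eventually) (intro dr)
      qed
      show False
      proof (rule no_bounded_approach[of "\<lambda>d. q d - c2", OF _ r(1)])
        show "dfun (\<lambda>d. q d - c2)" by (intro dr)
        obtain s where s: "s \<noteq> 0" "r \<prec> s" using ex_vgt r(1) by blast
        show "\<forall>\<^sub>F d in nb0. q d - c2 \<noteq> 0 \<and> r \<prec> q d - c2"
          using gt le[OF s] by eventually_elim auto
        show "\<forall>\<^sub>F d in nb0. q d - c2 \<preceq> s" if "s \<noteq> 0" "r \<prec> s" for s
          using le[OF that] by eventually_elim (rule vlt_imp_vle)
      qed
    next
      assume rR: "r \<notin> R" and below: "\<forall>s. s \<noteq> 0 \<longrightarrow> s \<prec> r \<longrightarrow> s \<in> R"
      \<comment> \<open>By \<open>below\<close>, the value of this variation eventually reaches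
        every value under that of \<open>r\<close>. It does not reach that of \<open>r\<close>,
        since otherwise \<open>q d\<close> would stay within \<open>r\<close> of some
        \<open>q g\<close> by \<open>no_periodic\<close>. So the value of \<open>1 / F d\<close>
        approaches that of \<open>1 / r\<close> from above.\<close>
      define F where "F d = q (unif * d) - q d" for d
      have D_F: "dfun F" unfolding F_def by (intro dr)
      have F_ge: "\<forall>\<^sub>F d in nb0. s \<preceq> F d" if s: "s \<noteq> 0" "s \<prec> r" for s
      proof -
        obtain c where c: "\<forall>\<^sub>F d in nb0. s \<preceq> q d - c" using below s unfolding R_def by blast
        then have "\<forall>\<^sub>F d in nb0. s \<preceq> q (unif * d) - c" by (rule eventually_nb0_scale[OF _ unif(1)])
        then show ?thesis using c unfolding F_def by eventually_elim (metis vle_diff_commute vle_diff_trans)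
      qed
      have not_ge: "\<not> (\<forall>\<^sub>F d in nb0. r \<preceq> F d)"
      proof
        assume "\<forall>\<^sub>F d in nb0. r \<preceq> F d"
        then obtain g where g: "g \<noteq> 0" "\<And>d. d \<noteq> 0 \<Longrightarrow> g \<preceq> d \<Longrightarrow> r \<preceq> F d"
          unfolding eventually_nb0 by blast
        define Z where "Z = {d. g \<preceq> d \<and> r \<preceq> q d - q g}"
        have "Z \<subseteq> {0}"
        proof (rule no_periodic[OF _ unif])
          show "dset Z" unfolding Z_def mem_Collect_eq by (intro dr)
          fix d assume d: "d \<in> Z" "d \<noteq> 0"
          then have "r \<preceq> q (unif * d) - q g"
            using g(2)[of d] vle_diff_trans[of r "q (unif * d)" "q d" "q g"] unfolding Z_def F_def by blast
          then show "unif * d \<in> Z"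
            using d vlt_mult_unif[OF d(2) unif(2)] vlt_imp_vle vle_trans unfolding Z_def by blast
        next
          have "\<not> (\<forall>\<^sub>F d in nb0. r \<preceq> q d - q g)" using rR r(1) unfolding R_def by blast
          then have "\<forall>\<^sub>F d in nb0. \<not> r \<preceq> q d - q g" by (intro not_eventually) (intro dr)
          then show "\<forall>\<^sub>F d in nb0. d \<notin> Z" by eventually_elim (simp add: Z_def)
        qed
        moreover have "g \<in> Z" unfolding Z_def by simp
        ultimately show False using g(1) by blast
      qed
      have F_lt: "\<forall>\<^sub>F d in nb0. F d \<prec> r"
        using not_ge by (intro not_eventually) (intro D_intros dt_fun[OF D_F])
      have nzF: "\<forall>\<^sub>F d in nb0. F d \<noteq> 0" using F_lt by eventually_elim auto
      show False
      proof (rule no_bounded_approach[of "\<lambda>d. 1 / F d" "1 / r"])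
        show "dfun (\<lambda>d. 1 / F d)" by (intro D_intros dt_fun[OF D_F])
        show "1 / r \<noteq> 0" using r(1) by simp
        show "\<forall>\<^sub>F d in nb0. 1 / F d \<noteq> 0 \<and> 1 / r \<prec> 1 / F d"
          using F_lt nzF by eventually_elim (use r(1) vle_inverse in \<open>simp flip: inverse_eq_divide\<close>)
        fix s assume s: "s \<noteq> 0" "1 / r \<prec> s"
        then have "1 / s \<prec> r" using vle_inverse[of "1 / s" "r"] r(1) by (simp add: inverse_eq_divide)
        then have "\<forall>\<^sub>F d in nb0. 1 / s \<preceq> F d" using F_ge[of "1 / s"] s(1) by simp
        then show "\<forall>\<^sub>F d in nb0. 1 / F d \<preceq> s"
          using nzF
        proof eventually_elim
          case (elim d)
          then show ?case using vle_inverse[of "F d" "1 / s"] s(1) by (simp add: inverse_eq_divide)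
        qed
      qed
    qed
  qed
  \<comment> \<open>\<open>W r\<close> consists of the admissible centres for the radius
    \<open>r\<close>; a centre common to all radii is a limit.\<close>
  define W where "W r = {x. \<forall>\<^sub>F d in nb0. r \<preceq> q d - x}" for r
  have "\<exists>x. \<forall>r. r \<noteq> 0 \<longrightarrow> x \<in> W r"
  proof (rule completeness)
    show "D (\<lambda>e. e 0 \<in> W (e 1))" unfolding W_def mem_Collect_eq by (intro dr)
    fix r :: 'k assume r: "r \<noteq> 0"
    then obtain c where c: "\<forall>\<^sub>F d in nb0. r \<preceq> q d - c" using all unfolding R_def by blast
    have "W r = cb c r"
    proof (intro equalityI subsetI)
      fix x assume "x \<in> W r"
      then have "\<forall>\<^sub>F d in nb0. r \<preceq> x - c" using c unfolding W_def mem_Collect_eq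
        by eventually_elim (metis vle_diff_commute vle_diff_trans)
      then have "r \<preceq> x - c" using eventually_nb0_obtain[OF _ r] by blast
      then show "x \<in> cb c r" unfolding cb_def by simp
    next
      fix x assume "x \<in> cb c r"
      then have cx: "r \<preceq> c - x" unfolding cb_def using vle_diff_commute by blast
      have "\<forall>\<^sub>F d in nb0. r \<preceq> q d - x" using c by eventually_elim (rule vle_diff_trans[OF _ cx])
      then show "x \<in> W r" unfolding W_def by simp
    qed
    then show "\<exists>a. W r = cb a r" by blast
  next
    fix r s :: 'k assume "r \<preceq> s"
    then show "W s \<subseteq> W r" unfolding W_def by (auto elim!: eventually_mono intro: vle_trans)
  qed
  then show "\<exists>l. lim0 q l" unfolding lim0_def W_def by blast
qed

lemma lim0_unique:
  assumes "lim0 q l" "lim0 q l'" shows "l = l'"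
proof (rule ccontr)
  assume ne: "l \<noteq> l'"
  define r where "r = unif * (l - l')"
  have r: "r \<noteq> 0" "l - l' \<prec> r" using ne unif vlt_mult_unif[of "l - l'" unif] unfolding r_def by auto
  have "\<forall>\<^sub>F d in nb0. r \<preceq> q d - l" "\<forall>\<^sub>F d in nb0. r \<preceq> q d - l'"
    using assms r(1) unfolding lim0_def by auto
  then have "\<forall>\<^sub>F d in nb0. r \<preceq> l - l'"
    by eventually_elim (metis vle_diff_commute vle_diff_trans)
  then have "\<forall>\<^sub>F d in nb0. False" by eventually_elim (use r in blast)
  then show False using nb0_nonempty by blast
qed

lemma lim0_cong: "\<forall>\<^sub>F d in nb0. p d = q d \<Longrightarrow> lim0 p l \<Longrightarrow> lim0 q l"
  unfolding lim0_def by (auto elim: eventually_elim2)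

lemma lim0_const: "lim0 (\<lambda>d. c) c"
  unfolding lim0_def by simp

lemma lim0_add: "lim0 p l \<Longrightarrow> lim0 q m \<Longrightarrow> lim0 (\<lambda>d. p d + q d) (l + m)"
  unfolding lim0_def
proof (intro allI impI)
  fix r :: 'k
  assume "\<forall>r. r \<noteq> 0 \<longrightarrow> (\<forall>\<^sub>F d in nb0. r \<preceq> p d - l)" "\<forall>r. r \<noteq> 0 \<longrightarrow> (\<forall>\<^sub>F d in nb0. r \<preceq> q d - m)" "r \<noteq> 0"
  then have "\<forall>\<^sub>F d in nb0. r \<preceq> p d - l" "\<forall>\<^sub>F d in nb0. r \<preceq> q d - m" by auto
  then show "\<forall>\<^sub>F d in nb0. r \<preceq> p d + q d - (l + m)"
  proof eventually_elim
    case (elim d)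
    then have "r \<preceq> (p d - l) + (q d - m)" by (intro vle_add)
    then show ?case by (simp add: algebra_simps)
  qed
qed

lemma lim0_mult:
  assumes p: "lim0 p l" and q: "lim0 q m" shows "lim0 (\<lambda>d. p d * q d) (l * m)"
  unfolding lim0_def
proof (intro allI impI)
  fix r :: 'k assume r: "r \<noteq> 0"
  \<comment> \<open>A quotient by \<open>l = 0\<close> or \<open>m = 0\<close> is 0 by convention
    and imposes no condition on \<open>s\<close>; the entries 1 and \<open>r\<close> take care of
    the product of the two errors.\<close>
  obtain s where s: "s \<noteq> 0" "\<forall>g\<in>{1, r, r / l, r / m}. g \<noteq> 0 \<longrightarrow> g \<preceq> s" using vlt_max[of "{1, r, r / l, r / m}"] by auto
  have ls: "r \<preceq> l * x" if "s \<preceq> x" for x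
  proof (cases "l = 0")
    case False
    then have "r / l \<preceq> x" using s(2) r that vle_trans by auto
    then show ?thesis using False by (simp add: divide_vle_iff mult.commute)
  qed simp
  have ms: "r \<preceq> m * x" if "s \<preceq> x" for x
  proof (cases "m = 0")
    case False
    then have "r / m \<preceq> x" using s(2) r that vle_trans by auto
    then show ?thesis using False by (simp add: divide_vle_iff mult.commute)
  qed simp
  have ss: "r \<preceq> x * y" if "s \<preceq> x" "s \<preceq> y" for x y
    using vle_mult[of r x 1 y] s(2) r that vle_trans by auto
  have "\<forall>\<^sub>F d in nb0. s \<preceq> p d - l" "\<forall>\<^sub>F d in nb0. s \<preceq> q d - m" using p q s(1) unfolding lim0_def by auto
  then show "\<forall>\<^sub>F d in nb0. r \<preceq> p d * q d - l * m"
  proof eventually_elim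
    case (elim d)
    then have "r \<preceq> ((p d - l) * (q d - m) + l * (q d - m)) + m * (p d - l)"
      by (intro vle_add ls ms ss)
    then show ?case by (simp add: algebra_simps)
  qed
qed

lemma lim0_scale: "lim0 q l \<Longrightarrow> b \<noteq> 0 \<Longrightarrow> lim0 (\<lambda>d. q (b * d)) l"
  unfolding lim0_def using eventually_nb0_scale by blast

lemma lim0_val:
  assumes "lim0 q l" "l \<noteq> 0" shows "\<forall>\<^sub>F d in nb0. l \<approx> q d"
proof -
  have "\<forall>\<^sub>F d in nb0. unif * l \<preceq> q d - l" using assms unif unfolding lim0_def by simp
  then show ?thesis
  proof eventually_elim
    case (elim d)
    then have "l \<prec> l - q d" using vlt_mult_unif[OF assms(2) unif(2)] vle_trans vle_diff_commute by blast
    then show ?case by (rule veq_diff)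
  qed
qed

lemma infinite_cb: "r \<noteq> 0 \<Longrightarrow> infinite (cb a r)"
proof -
  assume r: "r \<noteq> 0"
  note sep = generic_separated(2,3)[OF generic_gen, of r r, simplified, OF r]
  have "inj (\<lambda>i. a + gen ^ i * r)" using sep(1) by (simp add: inj_def)
  then have "infinite (range (\<lambda>i. a + gen ^ i * r))" by (rule range_inj_infinite)
  moreover have "range (\<lambda>i. a + gen ^ i * r) \<subseteq> cb a r" using sep(2) by (auto simp: cb_def)
  ultimately show ?thesis using finite_subset by blast
qed

text \<open>It suffices that some \<open>A y\<close> is infinite, for then it contains a ball. If
  all were finite, the image of \<open>g\<close> would be infinite and contain a ball; a smaller
  ball around its centre \<open>y\<close>, within \<open>lam\<close>, would be covered by the image
  of the finite set \<open>A y\<close>.\<close>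

lemma small_variation:
  assumes g: "dfun g" and r: "r \<noteq> 0" and lam: "lam \<noteq> 0"
  shows "\<exists>b s. s \<noteq> 0 \<and> cb b s \<subseteq> cb a r \<and> (\<forall>x\<in>cb b s. \<forall>y\<in>cb b s. lam \<preceq> g x - g y)"
proof -
  note dg = D_intros dt_fun[OF g] D_mem[OF dset_cb]
  define A where "A y = {x. x \<in> cb a r \<and> lam \<preceq> g x - y}" for y
  have D_A: "dset (A y)" for y unfolding A_def mem_Collect_eq by (intro dg)
  have "\<exists>y. infinite (A y)"
  proof (rule ccontr)
    assume "\<not> ?thesis"
    then have fin: "finite (A y)" for y by blast
    define S where "S = {z. \<exists>x. x \<in> cb a r \<and> z = g x}"
    have D_S: "dset S" unfolding S_def mem_Collect_eq by (intro dg)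
    have "cb a r \<subseteq> (\<Union>y\<in>S. A y)" unfolding S_def A_def by auto
    moreover have "finite (\<Union>y\<in>S. A y)" if "finite S" using fin that by blast
    ultimately have "infinite S" using infinite_cb[OF r] finite_subset by blast
    then obtain y t where t: "t \<noteq> 0" "cb y t \<subseteq> S" using definable_contains_ball[OF D_S] by blast
    obtain t' where t': "t' \<noteq> 0" "t \<preceq> t'" "lam \<preceq> t'" using ex_max2[OF t(1) lam] by blast
    have "cb y t' \<subseteq> g ` A y"
    proof
      fix z assume z: "z \<in> cb y t'"
      then have "z \<in> S" using cb_mono[OF t'(2)] t(2) by blast
      then obtain x where x: "x \<in> cb a r" "z = g x" unfolding S_def by blast
      then have "x \<in> A y" using z t'(3) vle_trans unfolding A_def cb_def by blast
      then show "z \<in> g ` A y" using x by blast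
    qed
    then show False using infinite_cb[OF t'(1)] fin finite_subset by blast
  qed
  then obtain y where "infinite (A y)" by blast
  then obtain b s where s: "s \<noteq> 0" "cb b s \<subseteq> A y" using definable_contains_ball[OF D_A] by blast
  have "lam \<preceq> g x - g x'" if "x \<in> cb b s" "x' \<in> cb b s" for x x'
  proof -
    have "lam \<preceq> g x - y" "lam \<preceq> g x' - y" using that s(2) unfolding A_def by auto
    then show ?thesis using vle_diff_commute vle_diff_trans by blast
  qed
  then show ?thesis using s unfolding A_def by (intro exI[of _ b] exI[of _ s]) auto
qed

end

section \<open>Existence of a point of differentiability\<close>

locale nowhere_differentiable = cmin_field vle D
  for vle :: "'k::field_char_0 \<Rightarrow> 'k \<Rightarrow> bool" (infix "\<preceq>" 50) and D +
  fixes f :: "'k \<Rightarrow> 'k" and b0 r0 :: 'k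
  assumes f: "dfun f" and r0: "r0 \<noteq> 0"
    and nondiff: "a \<in> cb b0 r0 \<Longrightarrow> \<not> lim0 (\<lambda>d. (f (a + d) - f a) / d) l"
begin

definition F :: "'k \<Rightarrow> 'k \<Rightarrow> 'k" where "F a d = f (a + d) - f a"

lemma dt_F [D_intros]: "dt t \<Longrightarrow> dt u \<Longrightarrow> dt (\<lambda>e. F (t e) (u e))"
  unfolding F_def by (intro D_intros dt_fun[OF f])

lemmas D_mem_cb [D_intros] = D_mem[OF dset_cb]

abbreviation "B0 \<equiv> cb b0 r0"

lemma quotient_infinite:
  assumes a: "a \<in> B0" and r: "r \<noteq> 0" shows "\<forall>\<^sub>F d in nb0. F a d / d \<prec> r"
proof -
  have "dfun (\<lambda>d. F a d / d)" by (intro D_intros)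
  from limit_exists[OF this] nondiff[OF a] r show ?thesis unfolding F_def by blast
qed

lemma F_nonzero:
  assumes a: "a \<in> B0" shows "\<forall>\<^sub>F d in nb0. F a d \<noteq> 0"
proof -
  have "\<forall>\<^sub>F d in nb0. F a d / d \<prec> 1" by (rule quotient_infinite[OF a]) simp
  then show ?thesis by eventually_elim auto
qed

text \<open>The value 0 elsewhere makes \<open>chi\<close> a total definable term in both
  arguments.\<close>

definition chi :: "'k \<Rightarrow> 'k \<Rightarrow> 'k" where
  "chi a s = (if a \<in> B0 \<and> s \<noteq> 0 then THE l. lim0 (\<lambda>d. F a (s * d) / F a d) l else 0)"

text \<open>By \<open>ratio_val_constant\<close> the quotient keeps the value of some
  \<open>c \<noteq> 0\<close>, so it cannot tend to infinity, and of the two outcomes of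
  \<open>limit_exists\<close> only the limit remains.\<close>

lemma chi_lim:
  assumes a: "a \<in> B0" and s: "s \<noteq> 0" shows "lim0 (\<lambda>d. F a (s * d) / F a d) (chi a s)"
proof -
  let ?q = "\<lambda>d. F a (s * d) / F a d"
  have Fa: "dfun (F a)" by (intro D_intros)
  obtain c where c: "c \<noteq> 0" "\<forall>\<^sub>F d in nb0. c \<approx> ?q d"
    using ratio_val_constant[OF Fa F_nonzero[OF a] s] by blast
  have "\<not> (\<forall>\<^sub>F d in nb0. ?q d \<prec> c)"
  proof
    assume "\<forall>\<^sub>F d in nb0. ?q d \<prec> c"
    then have "\<forall>\<^sub>F d in nb0. False" using c(2) by eventually_elim blast
    then show False using nb0_nonempty by blast
  qed
  moreover have "dfun ?q" by (intro D_intros)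
  ultimately obtain l where l: "lim0 ?q l" using limit_exists[of ?q] c(1) by blast
  then have "(THE l. lim0 ?q l) = l" using lim0_unique by blast
  then show ?thesis using l a s unfolding chi_def by simp
qed

lemma chi_eqI: "a \<in> B0 \<Longrightarrow> s \<noteq> 0 \<Longrightarrow> lim0 (\<lambda>d. F a (s * d) / F a d) l \<Longrightarrow> chi a s = l"
  using chi_lim lim0_unique by blast

lemma dt_chi [D_intros]: "dt t \<Longrightarrow> dt u \<Longrightarrow> dt (\<lambda>e. chi (t e) (u e))"
proof -
  have "(l = chi a s) = ((a \<in> B0 \<and> s \<noteq> 0 \<and> (\<forall>r. r \<noteq> 0 \<longrightarrow> (\<forall>\<^sub>F d in nb0. r \<preceq> F a (s * d) / F a d - l))) \<or>
      (\<not> (a \<in> B0 \<and> s \<noteq> 0) \<and> l = 0))" for l a s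
    using chi_lim[of a s] chi_eqI[of a s l] unfolding lim0_def[symmetric] by (auto simp: chi_def)
  then have "D (\<lambda>e. e 0 = chi (e (Suc 0)) (e (Suc (Suc 0))))" by (simp only:) (intro D_intros)
  then show "dt t \<Longrightarrow> dt u \<Longrightarrow> dt (\<lambda>e. chi (t e) (u e))" using dt_fun2[of chi] by blast
qed

lemma chi_1: "a \<in> B0 \<Longrightarrow> chi a 1 = 1"
proof (rule chi_eqI)
  assume a: "a \<in> B0"
  have "\<forall>\<^sub>F d in nb0. 1 = F a (1 * d) / F a d" using F_nonzero[OF a] by eventually_elim simp
  then show "lim0 (\<lambda>d. F a (1 * d) / F a d) 1" by (rule lim0_cong[OF _ lim0_const])
qed auto

lemma chi_mult:
  assumes a: "a \<in> B0" and s: "s \<noteq> 0" "s' \<noteq> 0" shows "chi a (s * s') = chi a s * chi a s'"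
proof (rule chi_eqI[OF a])
  have "lim0 (\<lambda>d. F a (s * (s' * d)) / F a (s' * d) * (F a (s' * d) / F a d)) (chi a s * chi a s')"
    by (rule lim0_mult[OF lim0_scale[OF chi_lim[OF a s(1)] s(2)] chi_lim[OF a s(2)]])
  moreover have "\<forall>\<^sub>F d in nb0. F a (s * (s' * d)) / F a (s' * d) * (F a (s' * d) / F a d) = F a (s * s' * d) / F a d"
    using eventually_nb0_scale[OF F_nonzero[OF a] s(2)] by eventually_elim (simp add: mult.assoc)
  ultimately show "lim0 (\<lambda>d. F a (s * s' * d) / F a d) (chi a s * chi a s')" by (rule lim0_cong[rotated])
qed (use s in simp)

text \<open>The points of continuity of \<open>f\<close> in \<open>B0\<close>.\<close>

definition B1 :: "'k set" where "B1 = {a \<in> B0. \<forall>r. r \<noteq> 0 \<longrightarrow> (\<forall>\<^sub>F d in nb0. r \<preceq> F a d)}"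

text \<open>Otherwise one radius \<open>r\<close> would witness discontinuity at all points of some
  ball, inside which \<open>small_variation\<close> finds a ball where \<open>f\<close> varies only
  within \<open>r\<close>.\<close>

lemma continuous_cofinite: "finite (B0 - B1)"
proof (rule ccontr)
  assume inf: "infinite (B0 - B1)"
  define S where "S r a \<longleftrightarrow> a \<in> B0 \<and> \<not> (\<forall>\<^sub>F d in nb0. r \<preceq> F a d)" for r a
  have D_S: "D (\<lambda>e. S (e 0) (e (Suc 0)))" unfolding S_def by (intro D_intros)
  have "B0 - B1 = {a. \<exists>r. r \<noteq> 0 \<and> S r a}" unfolding S_def B1_def by auto
  then have "\<exists>r. r \<noteq> 0 \<and> infinite {a. S r a}"
    using inf
  proof (intro increasing_union_infinite[OF D_S])
    fix g h a assume gh: "g \<preceq> h" and "S g a"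
    moreover have "\<forall>\<^sub>F d in nb0. g \<preceq> F a d" if "\<forall>\<^sub>F d in nb0. h \<preceq> F a d"
      using that by eventually_elim (rule vle_trans[OF gh])
    ultimately show "S h a" unfolding S_def by blast
  qed simp
  then obtain r where r: "r \<noteq> 0" "infinite {a. S r a}" by blast
  have "dset {a. S r a}" unfolding mem_Collect_eq by (intro D_bin[OF D_S] D_intros)
  then obtain b s where s: "s \<noteq> 0" "cb b s \<subseteq> {a. S r a}" using definable_contains_ball r(2) by blast
  obtain b' s' where s': "s' \<noteq> 0" "cb b' s' \<subseteq> cb b s" "\<forall>x\<in>cb b' s'. \<forall>y\<in>cb b' s'. r \<preceq> f x - f y"
    using small_variation[OF f s(1) r(1)] by blast
  have "\<forall>\<^sub>F d in nb0. r \<preceq> F b' d"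
    using eventually_nb0_vge[OF s'(1)]
  proof eventually_elim
    case (elim d)
    then have "b' + d \<in> cb b' s'" by (simp add: cb_def)
    then show ?case using s'(3) cb_center unfolding F_def by blast
  qed
  moreover have "S r b'" using s(2) s'(2) cb_center by blast
  ultimately show False unfolding S_def by blast
qed

text \<open>Outside of \<open>E s\<close> the limit \<open>chi a s\<close> may be taken along the moving base point \<open>a + d\<close>.\<close>

definition E :: "'k \<Rightarrow> 'k set" where
  "E s = {a \<in> B0. \<exists>r. r \<noteq> 0 \<and>
     \<not> (\<forall>\<^sub>F d in nb0. F (a + d) d \<noteq> 0 \<and> r \<preceq> F (a + d) (s * d) / F (a + d) d - chi a s)}"

text \<open>A ball is shrunk until it has a common failure radius \<open>r\<close>, then a common
  \<open>g\<close> beyond which the quotient at each \<open>x\<close> is within \<open>r\<close> of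
  \<open>chi x s\<close>, then variation of \<open>chi x s\<close> within \<open>r\<close>. Near its
  centre the moving base points stay in this ball, which refutes the failure there.\<close>

lemma finite_E:
  assumes s: "s \<noteq> 0" shows "finite (E s)"
proof (rule ccontr)
  assume inf: "infinite (E s)"
  let ?P = "\<lambda>r a x d. F x d \<noteq> 0 \<and> r \<preceq> F x (s * d) / F x d - chi a s"
  define S where "S r a \<longleftrightarrow> a \<in> B0 \<and> \<not> (\<forall>\<^sub>F d in nb0. ?P r a (a + d) d)" for r a
  have D_S: "D (\<lambda>e. S (e 0) (e (Suc 0)))" unfolding S_def by (intro D_intros)
  have "E s = {a. \<exists>r. r \<noteq> 0 \<and> S r a}" unfolding S_def E_def by auto
  then have "\<exists>r. r \<noteq> 0 \<and> infinite {a. S r a}"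
    using inf
  proof (intro increasing_union_infinite[OF D_S])
    fix g h a assume gh: "g \<preceq> h" and "S g a"
    moreover have "\<forall>\<^sub>F d in nb0. ?P g a (a + d) d" if "\<forall>\<^sub>F d in nb0. ?P h a (a + d) d"
      using that by eventually_elim (use vle_trans[OF gh] in blast)
    ultimately show "S h a" unfolding S_def by blast
  qed simp
  then obtain r where r: "r \<noteq> 0" "infinite {a. S r a}" by blast
  have "dset {a. S r a}" unfolding mem_Collect_eq by (intro D_bin[OF D_S] D_intros)
  then obtain a1 r1 where 1: "r1 \<noteq> 0" "cb a1 r1 \<subseteq> {a. S r a}" using definable_contains_ball r(2) by blast
  define T where "T g x \<longleftrightarrow> x \<in> cb a1 r1 \<and> (\<forall>d. d \<noteq> 0 \<longrightarrow> g \<preceq> d \<longrightarrow> ?P r x x d)" for g x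
  have D_T: "D (\<lambda>e. T (e 0) (e (Suc 0)))" unfolding T_def by (intro D_intros)
  have "\<exists>g. g \<noteq> 0 \<and> T g x" if x: "x \<in> cb a1 r1" for x
  proof -
    have xB: "x \<in> B0" using x 1(2) unfolding S_def by blast
    have "\<forall>\<^sub>F d in nb0. r \<preceq> F x (s * d) / F x d - chi x s"
      using chi_lim[OF xB s] r(1) unfolding lim0_def by blast
    then have "\<forall>\<^sub>F d in nb0. ?P r x x d" using F_nonzero[OF xB] by eventually_elim blast
    then show ?thesis using x unfolding T_def eventually_nb0 by blast
  qed
  then have "cb a1 r1 \<subseteq> {x. \<exists>g. g \<noteq> 0 \<and> T g x}" by blast
  then have infT: "infinite {x. \<exists>g. g \<noteq> 0 \<and> T g x}" using infinite_cb[OF 1(1)] finite_subset by blast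
  have "\<exists>g. g \<noteq> 0 \<and> infinite {x. T g x}"
  proof (rule increasing_union_infinite[OF D_T _ infT])
    show "T h x" if "g \<preceq> h" "T g x" for g h x using that vle_trans unfolding T_def by blast
  qed
  then obtain g where g: "g \<noteq> 0" "infinite {x. T g x}" by blast
  have "dset {x. T g x}" unfolding mem_Collect_eq by (intro D_bin[OF D_T] D_intros)
  then obtain a2 r2 where 2: "r2 \<noteq> 0" "cb a2 r2 \<subseteq> {x. T g x}" using definable_contains_ball g(2) by blast
  have "dfun (\<lambda>x. chi x s)" by (intro D_intros)
  then obtain a3 r3 where 3: "r3 \<noteq> 0" "cb a3 r3 \<subseteq> cb a2 r2" "\<forall>x\<in>cb a3 r3. \<forall>y\<in>cb a3 r3. r \<preceq> chi x s - chi y s"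
    using small_variation[of "\<lambda>x. chi x s", OF _ 2(1) r(1)] by blast
  have "\<forall>\<^sub>F d in nb0. ?P r a3 (a3 + d) d"
    using eventually_nb0_vge[OF 3(1)] eventually_nb0_vge[OF g(1)]
  proof eventually_elim
    case (elim d)
    then have ad: "a3 + d \<in> cb a3 r3" by (simp add: cb_def)
    then have T: "T g (a3 + d)" using 2(2) 3(2) by blast
    have P: "?P r (a3 + d) (a3 + d) d" using T elim unfolding T_def by blast
    have "r \<preceq> chi (a3 + d) s - chi a3 s" using 3(3) ad cb_center by blast
    then show ?case using P vle_diff_trans by blast
  qed
  moreover have "T g a3" using 2(2) 3(2) cb_center by blast
  then have "S r a3" using 1(2) unfolding T_def by blast
  ultimately show False unfolding S_def by blast
qed

text \<open>Divide \<open>F a ((1 + s) * d) = F a d + F (a + d) (s * d)\<close> by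
  \<open>F a d\<close>. The second summand is \<open>F (a + d) (s * d) / F (a + d) d\<close>,
  convergent off \<open>E s\<close>, times \<open>F (a + d) d / F a d\<close>, which equals
  \<open>F a (2 * d) / F a d - 1\<close>.\<close>

lemma chi_add:
  assumes a: "a \<in> B0" "a \<notin> E s" and s: "s \<noteq> 0" "1 + s \<noteq> 0"
  shows "chi a (1 + s) = 1 + (chi a 2 - 1) * chi a s"
proof (rule chi_eqI[OF a(1) s(2)])
  have ev: "\<forall>\<^sub>F d in nb0. F (a + d) d \<noteq> 0 \<and> r \<preceq> F (a + d) (s * d) / F (a + d) d - chi a s"
    if "r \<noteq> 0" for r using a that unfolding E_def by blast
  have lim: "lim0 (\<lambda>d. F (a + d) (s * d) / F (a + d) d) (chi a s)"
    unfolding lim0_def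
  proof (intro allI impI)
    fix r :: 'k assume "r \<noteq> 0"
    from ev[OF this] show "\<forall>\<^sub>F d in nb0. r \<preceq> F (a + d) (s * d) / F (a + d) d - chi a s"
      by eventually_elim blast
  qed
  from ev[OF zero_neq_one[symmetric]] have nz: "\<forall>\<^sub>F d in nb0. F (a + d) d \<noteq> 0" by eventually_elim blast
  have "lim0 (\<lambda>d. F a (2 * d) / F a d + (- 1)) (chi a 2 + (- 1))"
    by (intro lim0_add chi_lim lim0_const a(1)) simp
  from lim0_add[OF lim0_const lim0_mult[OF this lim]] have "lim0 (\<lambda>d. 1 + (F a (2 * d) / F a d + (- 1)) * (F (a + d) (s * d) / F (a + d) d))
      (1 + (chi a 2 + (- 1)) * chi a s)" .
  moreover have "\<forall>\<^sub>F d in nb0. 1 + (F a (2 * d) / F a d + (- 1)) * (F (a + d) (s * d) / F (a + d) d)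
      = F a ((1 + s) * d) / F a d"
    using nz F_nonzero[OF a(1)]
  proof eventually_elim
    case (elim d)
    have eq: "a + 2 * d = a + d + d" "a + (1 + s) * d = a + d + s * d" by (simp_all add: algebra_simps)
    have 2: "F a (2 * d) = F a d + F (a + d) d" and s: "F a ((1 + s) * d) = F a d + F (a + d) (s * d)"
      unfolding F_def eq by simp_all
    show ?case unfolding 2 s using elim by (simp add: add_divide_distrib)
  qed
  ultimately have "lim0 (\<lambda>d. F a ((1 + s) * d) / F a d) (1 + (chi a 2 + (- 1)) * chi a s)"
    by (rule lim0_cong[rotated])
  then show "lim0 (\<lambda>d. F a ((1 + s) * d) / F a d) (1 + (chi a 2 - 1) * chi a s)" by simp
qed

text \<open>If \<open>chi a t = 1\<close>, the value of \<open>F a\<close> is eventually the same at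
  \<open>d\<close> and \<open>t * d\<close>. By \<open>no_periodic\<close> it then cannot grow
  beyond all bounds, as continuity at \<open>a\<close> demands.\<close>

lemma chi_neq_1:
  assumes a: "a \<in> B1" and t: "t \<noteq> 0" "1 \<prec> t" shows "chi a t \<noteq> 1"
proof
  assume "chi a t = 1"
  have aB: "a \<in> B0" using a unfolding B1_def by blast
  have "\<forall>\<^sub>F d in nb0. 1 \<approx> F a (t * d) / F a d"
    using lim0_val[OF chi_lim[OF aB t(1)]] \<open>chi a t = 1\<close> by simp
  then have "\<forall>\<^sub>F d in nb0. F a d \<noteq> 0 \<and> F a (t * d) \<preceq> F a d"
    using F_nonzero[OF aB] by eventually_elim (simp add: divide_vle_1)
  then obtain g where g: "g \<noteq> 0" "\<And>d. d \<noteq> 0 \<Longrightarrow> g \<preceq> d \<Longrightarrow> F a d \<noteq> 0 \<and> F a (t * d) \<preceq> F a d"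
    unfolding eventually_nb0 by blast
  define Z where "Z = {d. g \<preceq> d \<and> F a d \<preceq> F a g}"
  have "Z \<subseteq> {0}"
  proof (rule no_periodic[OF _ t])
    show "dset Z" unfolding Z_def mem_Collect_eq by (intro D_intros)
    show "t * d \<in> Z" if "d \<in> Z" "d \<noteq> 0" for d
      using that g(2)[of d] vlt_mult_unif[OF that(2) t(2)] vlt_imp_vle vle_trans unfolding Z_def by blast
    have nz: "F a g \<noteq> 0" using g(2)[OF g(1)] by simp
    then have "\<forall>\<^sub>F d in nb0. unif * F a g \<preceq> F a d" using a unif unfolding B1_def by simp
    then show "\<forall>\<^sub>F d in nb0. d \<notin> Z"
      by eventually_elim (use vlt_mult_unif[OF nz unif(2)] vle_trans Z_def in blast)
  qed
  moreover have "g \<in> Z" unfolding Z_def by simp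
  ultimately show False using g(1) by blast
qed

lemma chi_neq_t:
  assumes a: "a \<in> B0" and t: "t \<noteq> 0" "1 \<prec> t" shows "chi a t \<noteq> t"
proof
  assume "chi a t = t"
  define q where "q d = F a d / d" for d
  have "\<forall>\<^sub>F d in nb0. t \<approx> F a (t * d) / F a d"
    using lim0_val[OF chi_lim[OF a t(1)]] \<open>chi a t = t\<close> t(1) by simp
  then have "\<forall>\<^sub>F d in nb0. q d \<noteq> 0 \<and> q d \<preceq> q (t * d)"
    using F_nonzero[OF a] eventually_nb0_vge[OF t(1)]
  proof eventually_elim
    case (elim d)
    then have "t * F a d \<preceq> F a (t * d)" by (simp add: vle_divide_iff)
    then have "F a d / d \<preceq> F a (t * d) / (t * d)"
      using elim t(1) by (simp add: vle_divide_iff divide_vle_iff mult.commute)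
    then show ?case using elim unfolding q_def by simp
  qed
  then obtain g where g: "g \<noteq> 0" "\<And>d. d \<noteq> 0 \<Longrightarrow> g \<preceq> d \<Longrightarrow> q d \<noteq> 0 \<and> q d \<preceq> q (t * d)"
    unfolding eventually_nb0 by blast
  define Z where "Z = {d. g \<preceq> d \<and> q g \<preceq> q d}"
  have "Z \<subseteq> {0}"
  proof (rule no_periodic[OF _ t])
    show "dset Z" unfolding Z_def q_def mem_Collect_eq by (intro D_intros)
    show "t * d \<in> Z" if "d \<in> Z" "d \<noteq> 0" for d
      using that g(2)[of d] vlt_mult_unif[OF that(2) t(2)] vlt_imp_vle vle_trans unfolding Z_def by blast
    have "q g \<noteq> 0" using g(2)[OF g(1)] by simp
    from quotient_infinite[OF a this] show "\<forall>\<^sub>F d in nb0. d \<notin> Z"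
      by eventually_elim (simp add: Z_def q_def)
  qed
  moreover have "g \<in> Z" unfolding Z_def by simp
  ultimately show False using g(1) by blast
qed

text \<open>Multiplicativity is compared with \<open>chi_add\<close> at
  \<open>1 + t = t * (1 + 1 / t)\<close>, which is why \<open>a\<close> must avoid the exceptional
  set of \<open>1 / t\<close> as well.\<close>

lemma kappa_1:
  assumes a: "a \<in> B1" "a \<notin> E t" "a \<notin> E (1 / t)" and t: "t \<noteq> 0" "1 \<prec> t" shows "chi a 2 = 2"
proof -
  have aB: "a \<in> B0" using a unfolding B1_def by blast
  have nz: "1 + t \<noteq> 0"
  proof
    assume "1 + t = 0"
    then have "t = -1" by (simp add: eq_neg_iff_add_eq_0 add.commute)
    then show False using t(2) vle_minus_one by simp
  qed
  then have nz': "1 + 1 / t \<noteq> 0" using t(1) by (simp add: field_simps)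
  have "chi a t * chi a (1 + 1 / t) = chi a (1 + t)"
    using chi_mult[OF aB t(1) nz'] t(1) by (simp add: distrib_left add.commute)
  moreover have "chi a t * chi a (1 / t) = 1" using chi_mult[OF aB t(1), of "1 / t"] t(1) chi_1[OF aB] by simp
  moreover have "chi a (1 + 1 / t) = 1 + (chi a 2 - 1) * chi a (1 / t)" using chi_add[OF aB a(3) _ nz'] t(1) by simp
  moreover have "chi a (1 + t) = 1 + (chi a 2 - 1) * chi a t" by (rule chi_add[OF aB a(2) t(1) nz])
  ultimately have "chi a t * (1 + (chi a 2 - 1) * chi a (1 / t)) = 1 + (chi a 2 - 1) * chi a t"
    and inv: "chi a t * chi a (1 / t) = 1" by simp_all
  moreover have "p * (1 + (k - 1) * i) = p + (k - 1) * (p * i)" for p k i :: 'k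
    by (simp add: algebra_simps)
  ultimately have "chi a t + (chi a 2 - 1) = 1 + (chi a 2 - 1) * chi a t" by (simp only: mult_1_right)
  then have "(chi a t - 1) * (2 - chi a 2) = 0" by (simp add: algebra_simps)
  then show ?thesis using chi_neq_1[OF a(1) t] by simp
qed

lemma contradiction: False
proof -
  have inf: "infinite B1"
  proof
    assume "finite B1"
    then have "finite (B1 \<union> (B0 - B1))" using continuous_cofinite by blast
    moreover have "B0 \<subseteq> B1 \<union> (B0 - B1)" by blast
    ultimately have "finite B0" by (rule finite_subset[rotated])
    then show False using infinite_cb[OF r0] by blast
  qed
  have D_B1: "dset B1" unfolding B1_def mem_Collect_eq by (intro D_intros)
  define S where "S r a \<longleftrightarrow> a \<in> B1 \<and> (\<forall>u. r \<preceq> u \<longrightarrow> chi a (1 + u) = 1 + u)" for r a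
  have D_S: "D (\<lambda>e. S (e 0) (e (Suc 0)))" unfolding S_def by (intro D_intros D_mem[OF D_B1])
  have "infinite {a. \<exists>r. r \<noteq> 0 \<and> S r a}"
  proof
    assume fin: "finite {a. \<exists>r. r \<noteq> 0 \<and> S r a}"
    \<comment> \<open>The parameters at which additivity is used: \<open>unif\<close> and its
      inverse for \<open>kappa_1\<close>, then the positive integers for the induction. As all sets
      \<open>E (s n)\<close> are finite, saturation provides a point outside all of them.\<close>
    define s where "s n = (case n of 0 \<Rightarrow> unif | Suc m \<Rightarrow> (case m of 0 \<Rightarrow> 1 / unif | Suc k \<Rightarrow> of_nat (Suc k)))" for n
    have s_nz: "s n \<noteq> 0" for n using unif unfolding s_def by (auto split: nat.splits simp del: of_nat_Suc)
    have "\<exists>a. \<forall>n. a \<in> B1 \<and> a \<notin> {a. \<exists>r. r \<noteq> 0 \<and> S r a} \<and> a \<notin> E (s n)"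
    proof (rule saturation)
      show "D (\<lambda>e. e 0 \<in> B1 \<and> e 0 \<notin> {a. \<exists>r. r \<noteq> 0 \<and> S r a} \<and> e 0 \<notin> E (s n))" for n
        using D_finite[OF finite_E[OF s_nz, of n]] D_finite[OF fin] D_B1 by (intro D_conj D_not)
      fix n
      have "finite ({a. \<exists>r. r \<noteq> 0 \<and> S r a} \<union> (\<Union>i<n. E (s i)))" using fin finite_E[OF s_nz] by blast
      then obtain a where "a \<in> B1" "a \<notin> {a. \<exists>r. r \<noteq> 0 \<and> S r a} \<union> (\<Union>i<n. E (s i))"
        using inf by (meson finite_subset subsetI)
      then show "\<exists>a. \<forall>i<n. a \<in> B1 \<and> a \<notin> {a. \<exists>r. r \<noteq> 0 \<and> S r a} \<and> a \<notin> E (s i)"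
        by (intro exI[of _ a]) simp
    qed
    then obtain a where a: "a \<in> B1" "\<And>r. r \<noteq> 0 \<Longrightarrow> \<not> S r a" "\<And>n. a \<notin> E (s n)" by blast
    have aB: "a \<in> B0" using a(1) unfolding B1_def by blast
    have kap: "chi a 2 = 2" using kappa_1[OF a(1) _ _ unif] a(3)[of 0] a(3)[of 1] by (simp add: s_def)
    have int: "chi a (of_nat (Suc n)) = of_nat (Suc n)" for n
    proof (induction n)
      case (Suc n)
      have "chi a (1 + of_nat (Suc n)) = 1 + (chi a 2 - 1) * chi a (of_nat (Suc n))"
      proof (rule chi_add[OF aB])
        show "a \<notin> E (of_nat (Suc n))" using a(3)[of "Suc (Suc n)"] by (simp add: s_def)
        show "of_nat (Suc n) \<noteq> (0 :: 'k)" by (rule of_nat_neq_0)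
        show "1 + of_nat (Suc n) \<noteq> (0 :: 'k)" using of_nat_neq_0[of "Suc n", where 'a = 'k] unfolding of_nat_Suc .
      qed
      then show ?case using Suc kap by simp
    qed (simp add: chi_1[OF aB])
    define Fix where "Fix = {s. s \<noteq> 0 \<and> chi a s = s}"
    have D_Fix: "dset Fix" unfolding Fix_def mem_Collect_eq by (intro D_intros)
    have "of_nat (Suc n) \<in> Fix" for n unfolding Fix_def using int[of n] of_nat_neq_0[of n, where 'a = 'k] by simp
    then have "range (\<lambda>n. of_nat (Suc n)) \<subseteq> Fix" by blast
    moreover have "infinite (range (\<lambda>n. of_nat (Suc n) :: 'k))" by (rule range_inj_infinite) (auto simp: inj_def)
    ultimately have "infinite Fix" using finite_subset by blast
    then obtain c r where r: "r \<noteq> 0" "cb c r \<subseteq> Fix" using definable_contains_ball[OF D_Fix] by blast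
    have c: "c \<noteq> 0" "chi a c = c" using r(2) cb_center unfolding Fix_def by blast+
    \<comment> \<open>Dividing the ball of fixed points by its centre moves it to 1, since
      \<open>chi a\<close> is multiplicative and fixes \<open>c\<close>.\<close>
    have "chi a (1 + u) = 1 + u" if u: "r / c \<preceq> u" for u
    proof -
      have "r \<preceq> c * u" using u c(1) by (simp add: divide_vle_iff mult.commute)
      then have "c * (1 + u) \<in> cb c r" by (simp add: cb_def algebra_simps)
      then have fixu: "c * (1 + u) \<noteq> 0" "chi a (c * (1 + u)) = c * (1 + u)" using r(2) unfolding Fix_def by auto
      then have "chi a c * chi a (1 + u) = c * (1 + u)" using chi_mult[OF aB c(1), of "1 + u"] by simp
      then show ?thesis using c by simp
    qed
    then have "S (r / c) a" using a(1) unfolding S_def by blast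
    then show False using a(2)[of "r / c"] r(1) c(1) by simp
  qed
  \<comment> \<open>The radius has to be independent of \<open>a\<close> because \<open>t\<close>
    must be fixed first: the point is then chosen outside \<open>E t\<close> and
    \<open>E (1 / t)\<close>.\<close>
  then have "\<exists>r. r \<noteq> 0 \<and> infinite {a. S r a}"
  proof (rule increasing_union_infinite[OF D_S, rotated])
    show "S h x" if "g \<preceq> h" "S g x" for g h x using that vle_trans unfolding S_def by blast
  qed
  then obtain r where r: "r \<noteq> 0" "infinite {a. S r a}" by blast
  obtain t where t: "t \<noteq> 0" "r \<preceq> t" "unif \<preceq> t" using ex_max2[OF r(1) unif(1)] by blast
  have t1: "1 \<prec> t" using t(3) unif(2) vle_trans by blast
  have "finite (E t \<union> E (1 / t))" using finite_E t(1) by simp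
  then obtain a where a: "S r a" "a \<notin> E t" "a \<notin> E (1 / t)"
    using r(2) by (metis (mono_tags, lifting) UnCI finite_subset mem_Collect_eq subsetI)
  have a1: "a \<in> B1" "chi a (1 + t) = 1 + t" using a(1) t(2) unfolding S_def by auto
  then have aB: "a \<in> B0" unfolding B1_def by blast
  have "1 + t \<noteq> 0"
  proof
    assume "1 + t = 0"
    then have "t = -1" by (simp add: eq_neg_iff_add_eq_0 add.commute)
    then show False using t1 vle_minus_one by simp
  qed
  then have "chi a (1 + t) = 1 + chi a t"
    using chi_add[OF aB a(2) t(1)] kappa_1[OF a1(1) a(2,3) t(1) t1] by simp
  then have "chi a t = t" using a1(2) by simp
  then show False using chi_neq_t[OF aB t(1) t1] by simp
qed

end

theorem (in cmin_field) differentiable_somewhere: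
  assumes f: "dfun f" and r: "r \<noteq> 0"
  shows "\<exists>a\<in>cb b r. \<exists>l. lim0 (\<lambda>d. (f (a + d) - f a) / d) l"
proof (rule ccontr)
  assume "\<not> ?thesis"
  then interpret nowhere_differentiable vle D f b r
    using f r by unfold_locales auto
  show False by (rule contradiction)
qed

section \<open>Presenting a model as a field in the sense of type classes\<close>

fun rename_tm :: "(nat \<Rightarrow> nat) \<Rightarrow> 'f tm \<Rightarrow> 'f tm" where
  "rename_tm \<pi> (Var i) = Var (\<pi> i)"
| "rename_tm \<pi> (App f ts) = App f (map (rename_tm \<pi>) ts)"

fun rename_fm :: "(nat \<Rightarrow> nat) \<Rightarrow> ('f, 'r) fm \<Rightarrow> ('f, 'r) fm" where
  "rename_fm \<pi> (Equal s t) = Equal (rename_tm \<pi> s) (rename_tm \<pi> t)"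
| "rename_fm \<pi> (Atom R ts) = Atom R (map (rename_tm \<pi>) ts)"
| "rename_fm \<pi> (Not \<phi>) = Not (rename_fm \<pi> \<phi>)"
| "rename_fm \<pi> (And \<phi> \<psi>) = And (rename_fm \<pi> \<phi>) (rename_fm \<pi> \<psi>)"
| "rename_fm \<pi> (Exists i \<phi>) = Exists (\<pi> i) (rename_fm \<pi> \<phi>)"

lemma tm_val_rename: "tm_val N e (rename_tm \<pi> t) = tm_val N (e \<circ> \<pi>) t"
  by (induction t) (simp_all add: o_def cong: map_cong)

lemma wf_rename_tm: "wf_tm L t \<Longrightarrow> wf_tm L (rename_tm \<pi> t)"
  by (induction t) auto

lemma wf_rename_fm: "wf_fm L \<phi> \<Longrightarrow> wf_fm L (rename_fm \<pi> \<phi>)"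
  by (induction \<phi>) (auto simp: wf_rename_tm)

text \<open>Bound variables are renamed along with the free ones, so injectivity is what prevents
  capture.\<close>

lemma sat_rename: "inj \<pi> \<Longrightarrow> sat N e (rename_fm \<pi> \<phi>) = sat N (e \<circ> \<pi>) \<phi>"
proof (induction \<phi> arbitrary: e)
  case (Atom R ts)
  then show ?case by (simp add: tm_val_rename o_def cong: map_cong)
next
  case (Exists i \<phi>)
  have "(e(\<pi> i := x)) \<circ> \<pi> = (e \<circ> \<pi>)(i := x)" for x
    using Exists.prems by (auto simp: fun_eq_iff inj_eq)
  then show ?case by (simp only: rename_fm.simps sat.simps Exists.IH[OF Exists.prems])
qed (simp_all add: tm_val_rename)

text \<open>The even variables are the object variables, the odd ones carry the parameters.\<close>

definition mix :: "(nat \<Rightarrow> 'a) \<Rightarrow> (nat \<Rightarrow> 'a) \<Rightarrow> nat \<Rightarrow> 'a" where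
  "mix e \<rho> n = (if even n then e (n div 2) else \<rho> (n div 2))"

lemma mix_simps [simp]: "mix e \<rho> (2 * i) = e i" "mix e \<rho> (Suc (2 * i)) = \<rho> i"
  by (simp_all add: mix_def)

locale coded =
  fixes L :: "('f vf_fun, 'r vf_rel) lang" and M :: "('a, 'f vf_fun, 'r vf_rel) struct"
    and j :: "'k::field_char_0 \<Rightarrow> 'a"
  assumes lang: "expands_vf_language L"
    and bij: "bij_betw j UNIV (univ M)"
    and j_add: "j (x + y) = Fn M Add [j x, j y]"
    and j_mult: "j (x * y) = Fn M Mult [j x, j y]"
    and j_zero: "j 0 = Fn M Zero []" and j_one: "j 1 = Fn M One []"
    and acvf: "acvf M"
    and c_minimal: "definable_set L M A \<Longrightarrow> A \<in> ball_combinations M"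
    and countably_saturated: "(\<And>n. definable_set L M (P n)) \<Longrightarrow>
      (\<And>n. \<exists>x\<in>univ M. \<forall>i<n. x \<in> P i) \<Longrightarrow> \<exists>x\<in>univ M. \<forall>i::nat. x \<in> P i"
    and complete: "definably_complete L M"
begin

lemma j_inj: "j x = j y \<longleftrightarrow> x = y"
  using bij by (auto simp: bij_betw_def inj_eq)

lemma j_univ [simp]: "j x \<in> univ M"
  using bij by (auto simp: bij_betw_def)

lemma univ_eq: "univ M = range j"
  using bij by (simp add: bij_betw_def)

definition dec :: "'a \<Rightarrow> 'k" where "dec = inv_into UNIV j"

lemma dec_j [simp]: "dec (j x) = x"
  unfolding dec_def using bij by (simp add: bij_betw_def)

lemma j_dec: "a \<in> univ M \<Longrightarrow> j (dec a) = a"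
  unfolding univ_eq by auto

abbreviation "R \<equiv> ring_of M"

lemma alg_closed: "algebraically_closed R" and valuation: "is_valuation M" and nontrivial: "nontrivial_valuation M"
  using acvf unfolding acvf_def by auto

sublocale R: algebraically_closed R
  by (rule alg_closed)

lemma R_carrier [simp]: "carrier R = univ M"
  and R_zero [simp]: "\<zero>\<^bsub>R\<^esub> = j 0" and R_one [simp]: "\<one>\<^bsub>R\<^esub> = j 1"
  and R_add [simp]: "j x \<oplus>\<^bsub>R\<^esub> j y = j (x + y)" and R_mult [simp]: "j x \<otimes>\<^bsub>R\<^esub> j y = j (x * y)"
  by (simp_all add: ring_of_def j_zero j_one j_add j_mult)

lemma R_minus [simp]: "j x \<ominus>\<^bsub>R\<^esub> j y = j (x - y)"
proof -
  have "\<ominus>\<^bsub>R\<^esub> j y = j (- y)" by (rule R.minus_equality) auto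
  then show ?thesis by (simp add: a_minus_def)
qed

lemma R_inv: "x \<noteq> 0 \<Longrightarrow> inv\<^bsub>R\<^esub> j x = j (inverse x)"
  by (rule R.comm_inv_char) auto

definition vle :: "'k \<Rightarrow> 'k \<Rightarrow> bool" where "vle x y \<longleftrightarrow> val_le M (j x) (j y)"

lemma root:
  assumes "Polynomial.degree (p :: 'k poly) > 0" shows "\<exists>x. poly p x = 0"
proof -
  \<comment> \<open>Polynomials of HOL-Algebra list the leading coefficient first, hence the
    reversal.\<close>
  define P where "P = rev (map j (Polynomial.coeffs p))"
  have p0: "p \<noteq> 0" using assms by auto
  have deg: "Polynomials.degree P = Polynomial.degree p"
    by (simp add: P_def degree_eq_length_coeffs)
  have "P \<in> carrier (poly_ring R)"
    using p0 by (auto simp: univ_poly_def polynomial_def P_def hd_map hd_rev last_map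
        last_coeffs_eq_coeff_degree j_inj)
  then have "R.splitted P" "P \<in> carrier (poly_ring R)" using R.roots_over_carrier by auto
  moreover from this have "R.roots P \<noteq> {#}"
    unfolding R.splitted_def using deg assms by auto
  ultimately obtain x where "R.is_root P x" using R.roots_mem_iff_is_root[of P] by fastforce
  then have x: "x \<in> univ M" "R.eval P x = j 0" by (auto simp: R.is_root_def)
  have pow: "j y [^]\<^bsub>R\<^esub> (n::nat) = j (y ^ n)" for y n
    by (induction n) (auto simp: mult.commute)
  have "R.eval (map j xs) (j y) = j (poly (Poly (rev xs)) y)" for xs y
    by (induction xs) (auto simp: pow Poly_append poly_monom algebra_simps)
  from this[of "rev (coeffs p)" "dec x"] show ?thesis
    using x by (auto simp: P_def rev_map j_dec j_inj)
qed

sublocale valued vle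
proof unfold_locales
  have v: "(\<forall>x\<in>univ M. \<forall>y\<in>univ M. val_le M x y \<or> val_le M y x)"
     "(\<forall>x\<in>univ M. \<forall>y\<in>univ M. \<forall>z\<in>univ M. val_le M x y \<and> val_le M y z \<longrightarrow> val_le M x z)"
     "(\<forall>x\<in>univ M. val_le M (j 0) x \<longleftrightarrow> x = j 0)"
     "(\<forall>x\<in>univ M. \<forall>y\<in>univ M. \<forall>z\<in>univ M. val_le M x y \<longrightarrow> val_le M (x \<otimes>\<^bsub>R\<^esub> z) (y \<otimes>\<^bsub>R\<^esub> z))"
     "(\<forall>x\<in>univ M. \<forall>y\<in>univ M. \<forall>z\<in>univ M. val_le M z x \<and> val_le M z y \<longrightarrow> val_le M z (x \<oplus>\<^bsub>R\<^esub> y))"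
    using valuation unfolding is_valuation_def Let_def R_zero by blast+
  fix x y z :: 'k
  show "vle x y \<or> vle y x" using v(1) unfolding vle_def by simp
  show "vle x y \<Longrightarrow> vle y z \<Longrightarrow> vle x z" using v(2) j_univ unfolding vle_def by blast
  show "vle 0 x \<longleftrightarrow> x = 0" using v(3) unfolding vle_def by (simp add: j_inj)
  show "vle (x * z) (y * z)" if "vle x y" 
  proof -
    have "val_le M (j x \<otimes>\<^bsub>R\<^esub> j z) (j y \<otimes>\<^bsub>R\<^esub> j z)" using v(4) j_univ that unfolding vle_def by blast
    then show ?thesis unfolding vle_def by simp
  qed
  show "vle z (x + y)" if "vle z x" "vle z y"
  proof -
    have "val_le M (j z) (j x \<oplus>\<^bsub>R\<^esub> j y)" using v(5) j_univ that unfolding vle_def by blast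
    then show ?thesis unfolding vle_def by simp
  qed
  show "\<exists>x. poly p x = 0" if "0 < Polynomial.degree p" for p :: "'k poly" using root that by blast
next
  obtain x where "j x \<noteq> j 0" "val_less M (j x) (j 1) \<or> val_less M (j 1) (j x)"
    using nontrivial unfolding nontrivial_valuation_def univ_eq by auto
  then show "\<exists>x. x \<noteq> 0 \<and> \<not> (vle x 1 \<and> vle 1 x)"
    unfolding vle_def val_less_def by (intro exI[of _ x]) auto
qed

lemma closed_ball_j: "closed_ball M (j a) (j r) = j ` cb a r"
  unfolding closed_ball_def cb_def univ_eq by (auto simp: vle_def)

lemma val_less_j: "val_less M (j x) (j y) \<longleftrightarrow> \<not> vle y x"
  using vle_total[of x y] unfolding val_less_def vle_def by blast

lemma open_ball_j: "open_ball M (j a) (j r) = j ` ob a r"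
  unfolding open_ball_def ob_def univ_eq by (auto simp: val_less_j)

lemma is_ball_iff: "is_ball M B \<longleftrightarrow> (\<exists>a r. r \<noteq> 0 \<and> (B = j ` cb a r \<or> B = j ` ob a r))"
  unfolding is_ball_def ball_of_radius_def univ_eq
  by (auto simp: closed_ball_j open_ball_j j_inj; metis)

lemma j_vimage_image [simp]: "j -` j ` A = A"
  by (auto simp: j_inj)

lemma bcomb_vimage: "A \<in> ball_combinations M \<Longrightarrow> j -` A \<in> bcomb"
proof (induction rule: ball_combinations.induct)
  case (ball B)
  then show ?case unfolding is_ball_iff by (auto intro: bcomb.intros)
next
  case (point a)
  then have "j -` {a} = {dec a}" by (auto simp: j_dec)
  then show ?case by (simp add: bcomb.point)
next
  case (complement A)
  have "j -` (univ M - A) = - (j -` A)" by auto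
  then show ?case using complement.IH by (simp add: bcomb.compl)
next
  case (union A A')
  then show ?case by (simp add: vimage_Un bcomb.union)
qed

section \<open>Definability in the model, in terms of assignments\<close>

definition Dp :: "((nat \<Rightarrow> 'k) \<Rightarrow> bool) \<Rightarrow> bool" where
  "Dp P \<longleftrightarrow> (\<exists>\<phi> \<rho>. wf_fm L \<phi> \<and> (\<forall>e. P e \<longleftrightarrow> sat M (mix (j \<circ> e) (j \<circ> \<rho>)) \<phi>))"

lemma DpI: "wf_fm L \<phi> \<Longrightarrow> (\<And>e. P e \<longleftrightarrow> sat M (mix (j \<circ> e) (j \<circ> \<rho>)) \<phi>) \<Longrightarrow> Dp P"
  unfolding Dp_def by blast

lemma Dp_not: "Dp P \<Longrightarrow> Dp (\<lambda>e. \<not> P e)"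
proof -
  assume "Dp P"
  then obtain \<phi> \<rho> where "wf_fm L \<phi>" "\<And>e. P e \<longleftrightarrow> sat M (mix (j \<circ> e) (j \<circ> \<rho>)) \<phi>" unfolding Dp_def by blast
  then show ?thesis by (intro DpI[of "fm.Not \<phi>" _ \<rho>]) auto
qed

lemma Dp_conj:
  assumes "Dp P" "Dp Q" shows "Dp (\<lambda>e. P e \<and> Q e)"
proof -
  obtain \<phi> \<rho> where 1: "wf_fm L \<phi>" "\<And>e. P e \<longleftrightarrow> sat M (mix (j \<circ> e) (j \<circ> \<rho>)) \<phi>"
    using assms unfolding Dp_def by blast
  obtain \<psi> \<sigma> where 2: "wf_fm L \<psi>" "\<And>e. Q e \<longleftrightarrow> sat M (mix (j \<circ> e) (j \<circ> \<sigma>)) \<psi>"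
    using assms unfolding Dp_def by blast
  \<comment> \<open>The parameters of the two formulas are interleaved: the \<open>m\<close>-th one
    of \<open>\<phi>\<close> gets index \<open>2 * m\<close> and that of \<open>\<psi>\<close> index
    \<open>2 * m + 1\<close>, which sit at the variables \<open>2 * (2 * m) + 1\<close> and
    \<open>2 * (2 * m + 1) + 1\<close>.\<close>
  define \<pi>1 where "\<pi>1 n = (if even n then n else 2 * n - 1)" for n :: nat
  define \<pi>2 where "\<pi>2 n = (if even n then n else 2 * n + 1)" for n :: nat
  have inj: "inj \<pi>1" "inj \<pi>2"
    unfolding inj_def \<pi>1_def \<pi>2_def by (auto split: if_splits elim!: oddE)
  have "mix (j \<circ> e) (j \<circ> mix \<rho> \<sigma>) \<circ> \<pi>1 = mix (j \<circ> e) (j \<circ> \<rho>)" for e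
  proof
    fix n show "(mix (j \<circ> e) (j \<circ> mix \<rho> \<sigma>) \<circ> \<pi>1) n = mix (j \<circ> e) (j \<circ> \<rho>) n"
    proof (cases "even n")
      case False
      then obtain m where n: "n = Suc (2 * m)" by (auto elim: oddE)
      then have "\<pi>1 n = Suc (2 * (2 * m))" by (simp add: \<pi>1_def)
      then show ?thesis by (simp only: o_apply mix_simps n)
    qed (simp add: \<pi>1_def mix_def)
  qed
  moreover have "mix (j \<circ> e) (j \<circ> mix \<rho> \<sigma>) \<circ> \<pi>2 = mix (j \<circ> e) (j \<circ> \<sigma>)" for e
  proof
    fix n show "(mix (j \<circ> e) (j \<circ> mix \<rho> \<sigma>) \<circ> \<pi>2) n = mix (j \<circ> e) (j \<circ> \<sigma>) n"
    proof (cases "even n")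
      case False
      then obtain m where n: "n = Suc (2 * m)" by (auto elim: oddE)
      then have "\<pi>2 n = Suc (2 * (Suc (2 * m)))" by (simp add: \<pi>2_def)
      then show ?thesis by (simp only: o_apply mix_simps n)
    qed (simp add: \<pi>2_def mix_def)
  qed
  ultimately show ?thesis
    using 1 2 inj
    by (intro DpI[of "And (rename_fm \<pi>1 \<phi>) (rename_fm \<pi>2 \<psi>)" _ "mix \<rho> \<sigma>"])
      (auto simp: wf_rename_fm sat_rename)
qed

lemma Dp_ex:
  assumes "Dp (\<lambda>e. Q (\<lambda>n. e (Suc n)) (e 0))" shows "Dp (\<lambda>e. \<exists>x. Q e x)"
proof -
  obtain \<phi> \<rho> where 1: "wf_fm L \<phi>" "\<And>e. Q (\<lambda>n. e (Suc n)) (e 0) \<longleftrightarrow> sat M (mix (j \<circ> e) (j \<circ> \<rho>)) \<phi>"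
    using assms unfolding Dp_def by blast
  \<comment> \<open>The object variable to be bound moves to variable 1, the place of a dummy
    parameter. The other objects move down by one place, and the parameters move up by one to make
    room.\<close>
  define \<pi> where "\<pi> n = (if n = 0 then 1 else if even n then n - 2 else n + 2)" for n :: nat
  define \<sigma> where "\<sigma> n = \<rho> (n - 1)" for n
  have inj: "inj \<pi>"
    by (rule inj_on_inverseI[where g = "\<lambda>n. if n = 1 then 0 else if even n then n + 2 else n - 2"])
      (auto simp: \<pi>_def, presburger)
  have eq: "(mix (j \<circ> e) (j \<circ> \<sigma>))(Suc 0 := j x) \<circ> \<pi> = mix (j \<circ> case_nat x e) (j \<circ> \<rho>)" for e x
    by (auto simp: fun_eq_iff mix_def \<pi>_def \<sigma>_def elim!: oddE split: nat.splits)
  have "(\<exists>x. Q e x) \<longleftrightarrow> (\<exists>x. sat M (mix (j \<circ> case_nat x e) (j \<circ> \<rho>)) \<phi>)" for e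
    using 1(2)[of "case_nat _ e"] by simp
  then show ?thesis
    using 1(1) by (intro DpI[of "Exists (Suc 0) (rename_fm \<pi> \<phi>)" _ \<sigma>])
      (auto simp: wf_rename_fm sat_rename[OF inj] eq univ_eq)
qed

lemma Dp_rename:
  assumes g: "inj g" and P: "Dp P" shows "Dp (\<lambda>e. P (\<lambda>n. e (g n)))"
proof -
  obtain \<phi> \<rho> where 1: "wf_fm L \<phi>" "\<And>e. P e \<longleftrightarrow> sat M (mix (j \<circ> e) (j \<circ> \<rho>)) \<phi>"
    using P unfolding Dp_def by blast
  define \<pi> where "\<pi> n = (if even n then 2 * g (n div 2) else n)" for n :: nat
  have parity: "even (\<pi> n) \<longleftrightarrow> even n" for n by (simp add: \<pi>_def)
  have inj: "inj \<pi>"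
  proof (rule injI)
    fix x y assume eq: "\<pi> x = \<pi> y"
    then have "even x \<longleftrightarrow> even y" using parity by metis
    then show "x = y" using eq g by (auto simp: \<pi>_def inj_eq elim!: evenE)
  qed
  have "mix (j \<circ> e) (j \<circ> \<rho>) \<circ> \<pi> = mix (j \<circ> (\<lambda>n. e (g n))) (j \<circ> \<rho>)" for e
    by (auto simp: fun_eq_iff mix_def \<pi>_def)
  then show ?thesis
    using 1 by (intro DpI[of "rename_fm \<pi> \<phi>" _ \<rho>]) (auto simp: wf_rename_fm sat_rename[OF inj])
qed

lemma Dp_atoms:
  "Dp (\<lambda>e. e k = e l)" "Dp (\<lambda>e. e k = c)" "Dp (\<lambda>e. e k = e l + e m)" "Dp (\<lambda>e. e k = e l * e m)"
  "Dp (\<lambda>e. vle (e k) (e l))"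
proof -
  show "Dp (\<lambda>e. e k = e l)"
    by (rule DpI[of "Equal (Var (2 * k)) (Var (2 * l))"]) (auto simp: j_inj)
  show "Dp (\<lambda>e. e k = c)"
    by (rule DpI[of "Equal (Var (2 * k)) (Var 1)" _ "\<lambda>_. c"]) (auto simp: j_inj mix_def)
  show "Dp (\<lambda>e. e k = e l + e m)"
    using lang unfolding expands_vf_language_def
    by (intro DpI[of "Equal (Var (2 * k)) (App Add [Var (2 * l), Var (2 * m)])"])
      (auto simp: j_inj simp flip: j_add)
  show "Dp (\<lambda>e. e k = e l * e m)"
    using lang unfolding expands_vf_language_def
    by (intro DpI[of "Equal (Var (2 * k)) (App Mult [Var (2 * l), Var (2 * m)])"])
      (auto simp: j_inj simp flip: j_mult)
  show "Dp (\<lambda>e. vle (e k) (e l))"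
    using lang unfolding expands_vf_language_def
    by (intro DpI[of "Atom Div [Var (2 * k), Var (2 * l)]"]) (auto simp: vle_def val_le_def)
qed

lemma Dp_of_definable:
  assumes "definable L M n A" shows "Dp (\<lambda>e. map (j \<circ> e) [0..<n] \<in> A)"
proof -
  obtain \<phi> \<epsilon> where 1: "wf_fm L \<phi>" "range \<epsilon> \<subseteq> univ M"
    "A = {xs. length xs = n \<and> set xs \<subseteq> univ M \<and> sat M (\<lambda>i. if i < n then xs ! i else \<epsilon> i) \<phi>}"
    using assms unfolding definable_def by blast
  define \<pi> where "\<pi> m = (if m < n then 2 * m else 2 * m + 1)" for m
  have inj: "inj \<pi>"
    unfolding inj_def \<pi>_def by (auto split: if_splits)
  have "mix (j \<circ> e) (j \<circ> (dec \<circ> \<epsilon>)) \<circ> \<pi> = (\<lambda>m. if m < n then map (j \<circ> e) [0..<n] ! m else \<epsilon> m)" for e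
  proof -
    have "j (dec (\<epsilon> m)) = \<epsilon> m" for m using 1(2) by (intro j_dec) auto
    then show ?thesis by (auto simp: fun_eq_iff \<pi>_def)
  qed
  then show ?thesis
    using 1(1,3) by (intro DpI[of "rename_fm \<pi> \<phi>" _ "dec \<circ> \<epsilon>"]) (auto simp: wf_rename_fm sat_rename[OF inj])
qed

lemma definable_of_Dp:
  assumes "Dp P"
  shows "definable L M n {xs. length xs = n \<and> set xs \<subseteq> univ M \<and> P (\<lambda>m. if m < n then dec (xs ! m) else 0)}"
proof -
  obtain \<phi> \<rho> where 1: "wf_fm L \<phi>" "\<And>e. P e \<longleftrightarrow> sat M (mix (j \<circ> e) (j \<circ> \<rho>)) \<phi>"
    using assms unfolding Dp_def by blast
  \<comment> \<open>All variables except the first \<open>n\<close> objects become parameters;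
    objects from \<open>n\<close> on get the value 0. Adding \<open>n\<close> keeps the parameters
    apart from the objects.\<close>
  define \<pi> where "\<pi> m = (if even m \<and> m div 2 < n then m div 2 else n + m)" for m
  define \<epsilon> where "\<epsilon> m = mix (j \<circ> (\<lambda>_. 0)) (j \<circ> \<rho>) (m - n)" for m
  have inj: "inj \<pi>"
    unfolding inj_def \<pi>_def by (auto split: if_splits elim!: evenE)
  have \<epsilon>: "range \<epsilon> \<subseteq> univ M" unfolding \<epsilon>_def mix_def by auto
  have "(\<lambda>m. if m < n then xs ! m else \<epsilon> m) \<circ> \<pi> = mix (j \<circ> (\<lambda>m. if m < n then dec (xs ! m) else 0)) (j \<circ> \<rho>)"
    if "length xs = n" "set xs \<subseteq> univ M" for xs
  proof -
    have "j (dec (xs ! m)) = xs ! m" if "m < n" for m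
      using \<open>length xs = n\<close> \<open>set xs \<subseteq> univ M\<close> that by (intro j_dec) (meson nth_mem subsetD)
    then show ?thesis by (auto simp: fun_eq_iff mix_def \<pi>_def \<epsilon>_def)
  qed
  then show ?thesis
    unfolding definable_def using 1 \<epsilon>
    by (intro exI[of _ "rename_fm \<pi> \<phi>"] exI[of _ \<epsilon>]) (auto simp: wf_rename_fm sat_rename[OF inj])
qed

lemma definable_set_of_Dp:
  assumes "Dp (\<lambda>e. Q (e 0))" shows "definable_set L M (j ` {x. Q x})"
proof -
  have "{[x] |x. x \<in> j ` {x. Q x}}
      = {xs. length xs = 1 \<and> set xs \<subseteq> univ M \<and> Q (if 0 < (1::nat) then dec (xs ! 0) else 0)}"
    by (auto simp: length_Suc_conv univ_eq)
  then show ?thesis unfolding definable_set_def using definable_of_Dp[OF assms, of 1] by simp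
qed

lemma completeness_coded:
  assumes W: "Dp (\<lambda>e. e 0 \<in> W (e 1))" and ball: "\<And>r. r \<noteq> 0 \<Longrightarrow> \<exists>a. W r = cb a r"
    and mono: "\<And>r s. r \<noteq> 0 \<Longrightarrow> s \<noteq> 0 \<Longrightarrow> vle r s \<Longrightarrow> W s \<subseteq> W r"
  shows "\<exists>x. \<forall>r. r \<noteq> 0 \<longrightarrow> x \<in> W r"
proof -
  define C where "C = {j ` W r |r. r \<noteq> 0}"
  define Y where "Y = {xs. length xs = 1 \<and> set xs \<subseteq> univ M \<and> dec (xs ! 0) \<noteq> 0}"
  define A where "A = {xs. length xs = Suc 1 \<and> set xs \<subseteq> univ M \<and> dec (xs ! 0) \<in> W (dec (xs ! 1))}"
  have "definable L M 1 Y" using definable_of_Dp[OF Dp_not[OF Dp_atoms(2)[of 0 0]], of 1] unfolding Y_def by simp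
  moreover have "definable L M (Suc 1) A" using definable_of_Dp[OF W, of "Suc 1"] unfolding A_def by simp
  moreover have "C = {{x. x # b \<in> A} |b. b \<in> Y}"
  proof -
    have Y_eq: "Y = {[j r] |r. r \<noteq> 0}" unfolding Y_def by (auto simp: length_Suc_conv univ_eq j_inj)
    have "{x. x # [j r] \<in> A} = j ` W r" for r unfolding A_def by (auto simp: univ_eq)
    then show ?thesis unfolding C_def Y_eq by (auto; metis)
  qed
  ultimately have "definable_family L M C" unfolding definable_family_def by blast
  moreover have C_ball: "ball_of_radius M (j r) (j ` W r)" if r: "r \<noteq> 0" for r
  proof -
    obtain a where "W r = cb a r" using ball[OF r] by blast
    then have "j ` W r = closed_ball M (j a) (j r)" by (simp add: closed_ball_j)
    then show ?thesis using r j_univ unfolding ball_of_radius_def R_zero j_inj by blast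
  qed
  then have "\<forall>B\<in>C. is_ball M B" unfolding C_def is_ball_def by blast
  moreover have "chain\<^sub>\<subseteq> C"
    unfolding chain_subset_def C_def using mono vle_total by (auto; blast)
  moreover have "\<exists>B\<in>C. \<exists>r. ball_of_radius M r B \<and> val_less M c r" if c: "c \<in> univ M" "c \<noteq> j 0" for c
  proof -
    obtain x where x: "c = j x" using c(1) unfolding univ_eq by blast
    then have "x \<noteq> 0" using c(2) by auto
    then obtain r where r: "r \<noteq> 0" "\<not> vle r x" using ex_vgt by blast
    then have "val_less M c (j r)" using vle_total unfolding val_less_def x vle_def by blast
    then show ?thesis using C_ball[OF r(1)] r(1) unfolding C_def by blast
  qed
  ultimately have "\<Inter>C \<noteq> {}" using complete unfolding definably_complete_def by simp
  then obtain y where y: "y \<in> \<Inter>C" by blast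
  have "j ` W 1 \<in> C" unfolding C_def by auto
  then obtain x where x: "y = j x" using y by blast
  have "x \<in> W r" if "r \<noteq> 0" for r
    using y that unfolding C_def x by (auto simp: j_inj)
  then show ?thesis by blast
qed

sublocale cmin_field vle Dp
proof unfold_locales
  show "A \<in> bcomb" if "Dp (\<lambda>e. e 0 \<in> A)" for A
    using bcomb_vimage[OF c_minimal[OF definable_set_of_Dp[OF that]]] by simp
  show "\<exists>y. \<forall>i. U i y" if U: "\<And>n. Dp (\<lambda>e. U n (e 0))" "\<And>n. \<exists>y. \<forall>i<n. U i y" for U :: "nat \<Rightarrow> 'k \<Rightarrow> bool"
  proof -
    have "\<exists>x\<in>univ M. \<forall>n. x \<in> j ` {y. U n y}"
    proof (rule countably_saturated)
      show "definable_set L M (j ` {y. U n y})" for n by (rule definable_set_of_Dp[OF U(1)])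
      show "\<exists>x\<in>univ M. \<forall>m<n. x \<in> j ` {y. U m y}" for n
        using U(2)[of n] by (metis image_eqI j_univ mem_Collect_eq)
    qed
    then show ?thesis by (auto simp: univ_eq image_iff j_inj)
  qed
  show "\<exists>x. \<forall>r. r \<noteq> 0 \<longrightarrow> x \<in> W r"
    if "Dp (\<lambda>e. e 0 \<in> W (e 1))" "\<And>r. r \<noteq> 0 \<Longrightarrow> \<exists>a. W r = cb a r"
      "\<And>r s. r \<noteq> 0 \<Longrightarrow> s \<noteq> 0 \<Longrightarrow> vle r s \<Longrightarrow> W s \<subseteq> W r" for W
    by (rule completeness_coded[OF that])
qed (rule Dp_not Dp_conj Dp_ex Dp_rename Dp_atoms; assumption?)+

section \<open>The valuation topology and differentiability in the model\<close>

lemma open_contains_ball: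
  assumes "openin (val_topology M) U" "j x \<in> U"
  shows "\<exists>r. r \<noteq> 0 \<and> j ` cb x r \<subseteq> U"
proof -
  have "generate_topology_on {B. is_ball M B} U"
    using assms(1) unfolding val_topology_def openin_topology_generated_by_iff .
  then show ?thesis
    using assms(2)
  proof (induction arbitrary: x rule: generate_topology_on.induct)
    case (Int U V)
    obtain r where r: "r \<noteq> 0" "j ` cb x r \<subseteq> U" using Int.IH(1)[of x] Int.prems by auto
    obtain s where s: "s \<noteq> 0" "j ` cb x s \<subseteq> V" using Int.IH(2)[of x] Int.prems by auto
    obtain z where z: "z \<noteq> 0" "vle r z" "vle s z" using ex_max2[OF r(1) s(1)] by blast
    have "cb x z \<subseteq> cb x r" "cb x z \<subseteq> cb x s" using cb_mono z by auto
    then have "j ` cb x z \<subseteq> U \<inter> V" using r(2) s(2) by (meson Int_greatest image_mono order_trans)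
    then show ?case using z(1) by blast
  next
    case (UN K)
    then obtain V where V: "V \<in> K" "j x \<in> V" by auto
    obtain r where "r \<noteq> 0" "j ` cb x r \<subseteq> V" using UN.IH[OF V] by auto
    then show ?case using V(1) by (intro exI[of _ r]) auto
  next
    case (Basis B)
    then obtain a r where r: "r \<noteq> 0" "B = j ` cb a r \<or> B = j ` ob a r" unfolding is_ball_iff by blast
    from r(2) show ?case
    proof
      assume B: "B = j ` cb a r"
      then have "cb x r = cb a r" using Basis(2) by (intro cb_recenter) (auto simp: j_inj)
      then show ?thesis using B r(1) by auto
    next
      assume B: "B = j ` ob a r"
      then have ob: "ob x r = ob a r" using Basis(2) by (intro ob_recenter) (auto simp: j_inj)
      obtain s where s: "s \<noteq> 0" "\<not> vle s r" using ex_vgt r(1) by blast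
      then have "cb x s \<subseteq> ob x r" unfolding cb_def ob_def using vle_trans by blast
      then show ?thesis using B ob s(1) by blast
    qed
  qed simp
qed

lemma open_ball: "r \<noteq> 0 \<Longrightarrow> openin (val_topology M) (j ` cb a r)"
  unfolding val_topology_def by (rule topology_generated_by_Basis) (auto simp: is_ball_iff)

lemma differentiable_of_lim0:
  assumes lim: "lim0 (\<lambda>d. (g (a + d) - g a) / d) l" and S: "j a \<in> S"
    and s: "s \<noteq> 0" and g: "\<And>x. x \<in> cb a s \<Longrightarrow> f (j x) = j (g x)"
  shows "differentiable_at_within M f (j a) S"
proof -
  have "limitin (val_topology M) (\<lambda>x. (f x \<ominus>\<^bsub>R\<^esub> f (j a)) \<otimes>\<^bsub>R\<^esub> inv\<^bsub>R\<^esub> (x \<ominus>\<^bsub>R\<^esub> j a)) (j l)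
      (atin_within (val_topology M) (j a) S)"
    unfolding limitin_def
  proof (intro conjI allI impI)
    show "j l \<in> topspace (val_topology M)"
      using open_ball[of 1 l] cb_center openin_subset by fastforce
    fix U assume "openin (val_topology M) U \<and> j l \<in> U"
    then obtain r where r: "r \<noteq> 0" "j ` cb l r \<subseteq> U" using open_contains_ball by blast
    have "\<forall>\<^sub>F d in nb0. vle r ((g (a + d) - g a) / d - l)" using lim r(1) unfolding lim0_def by blast
    then obtain t where t: "t \<noteq> 0" "\<And>d. d \<noteq> 0 \<Longrightarrow> vle t d \<Longrightarrow> vle r ((g (a + d) - g a) / d - l)"
      unfolding eventually_nb0 by blast
    obtain z where z: "z \<noteq> 0" "vle s z" "vle t z" using ex_max2[OF s t(1)] by blast
    have "(f x \<ominus>\<^bsub>R\<^esub> f (j a)) \<otimes>\<^bsub>R\<^esub> inv\<^bsub>R\<^esub> (x \<ominus>\<^bsub>R\<^esub> j a) \<in> U" if x: "x \<in> j ` cb a z" "x \<noteq> j a" for x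
    proof -
      obtain y where y: "x = j y" "vle z (y - a)" using x(1) unfolding cb_def by blast
      define d where "d = y - a"
      have d: "d \<noteq> 0" "vle t d" "y = a + d" using x(2) y z(3) vle_trans unfolding d_def by auto
      have "y \<in> cb a s" using y(2) z(2) vle_trans unfolding cb_def by blast
      then have "(f x \<ominus>\<^bsub>R\<^esub> f (j a)) \<otimes>\<^bsub>R\<^esub> inv\<^bsub>R\<^esub> (x \<ominus>\<^bsub>R\<^esub> j a) = j ((g (a + d) - g a) / d)"
        using g[of y] g[OF cb_center] d(1,3) y(1) by (simp add: R_inv divide_inverse)
      moreover have "(g (a + d) - g a) / d \<in> cb l r" using t(2)[OF d(1,2)] unfolding cb_def by simp
      ultimately show ?thesis using r(2) by auto
    qed
    then show "\<forall>\<^sub>F x in atin_within (val_topology M) (j a) S.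
        (f x \<ominus>\<^bsub>R\<^esub> f (j a)) \<otimes>\<^bsub>R\<^esub> inv\<^bsub>R\<^esub> (x \<ominus>\<^bsub>R\<^esub> j a) \<in> U"
      unfolding eventually_atin_within
      using open_ball[OF z(1), of a] cb_center[of a z] by blast
  qed
  then show ?thesis unfolding differentiable_at_within_def Let_def using j_univ by blast
qed

theorem generic_differentiability:
  assumes B: "is_ball M B" and f: "f \<in> B \<rightarrow> univ M" and def: "definable_fun L M B f"
  shows "(\<exists>B'. is_ball M B' \<and> B' \<subseteq> B \<and> (\<forall>a\<in>B'. differentiable_at_within M f a B')) \<and>
         finite {a \<in> B. \<not> differentiable_at_within M f a B}"
proof -
  define A where "A = j -` B"
  have B_eq: "B = j ` A" using B unfolding A_def is_ball_iff by auto
  obtain b r where "B = j ` cb b r \<or> B = j ` ob b r" using B unfolding is_ball_iff by blast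
  then have "A = cb b r \<or> A = ob b r" unfolding A_def by (elim disjE) simp_all
  moreover have "dset (ob b r)" unfolding ob_def mem_Collect_eq by (intro D_intros)
  ultimately have D_A: "dset A" using dset_cb by auto
  have A_open: "\<exists>s. s \<noteq> 0 \<and> cb a s \<subseteq> A" if a: "a \<in> A" for a
  proof -
    have "openin (val_topology M) B" unfolding val_topology_def using B by (intro topology_generated_by_Basis) simp
    then obtain s where "s \<noteq> 0" "j ` cb a s \<subseteq> B" using open_contains_ball a unfolding A_def by blast
    then show ?thesis unfolding A_def by blast
  qed
  \<comment> \<open>The value 0 outside \<open>A\<close> makes \<open>g\<close> total, as
    \<open>dfun\<close> demands; limits at points of \<open>A\<close> are unaffected because
    \<open>A\<close> is open.\<close>
  define g where "g x = (if x \<in> A then dec (f (j x)) else 0)" for x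
  have g: "f (j x) = j (g x)" if "x \<in> A" for x
  proof -
    have "f (j x) \<in> univ M" using that f funcset_mem unfolding A_def by fastforce
    then show ?thesis using that by (simp add: g_def j_dec)
  qed
  have "Dp (\<lambda>e. map (j \<circ> e) [0..<2] \<in> {[x, f x] |x. x \<in> B})"
    using def unfolding definable_fun_def by (rule Dp_of_definable)
  moreover have "map (j \<circ> e) [0..<2] \<in> {[x, f x] |x. x \<in> B} \<longleftrightarrow> e 0 \<in> A \<and> e (Suc 0) = g (e 0)" for e
    using g[of "e 0"] by (auto simp: B_eq upt_rec j_inj)
  ultimately have "Dp (\<lambda>e. e 0 \<in> A \<and> e (Suc 0) = g (e 0))" by simp
  \<comment> \<open>The argument comes first in \<open>definable_fun\<close> and the value first in
    \<open>dfun\<close>, so the two variables are exchanged.\<close>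
  from D_bin[of "\<lambda>x y. x \<in> A \<and> y = g x", OF this dt_var[of "Suc 0"] dt_var[of 0]]
  have "Dp (\<lambda>e. (e (Suc 0) \<in> A \<and> e 0 = g (e (Suc 0))) \<or> (e (Suc 0) \<notin> A \<and> e 0 = 0))"
    by (rule D_disj) (intro D_intros D_mem[OF D_A])
  moreover have "((x \<in> A \<and> y = g x) \<or> (x \<notin> A \<and> y = 0)) \<longleftrightarrow> y = g x" for x y
    unfolding g_def by auto
  ultimately have D_g: "dfun g" by simp
  define bad where "bad = {a \<in> A. \<not> (\<exists>l. lim0 (\<lambda>d. (g (a + d) - g a) / d) l)}"
  have D_bad: "dset bad"
    unfolding bad_def lim0_def mem_Collect_eq by (intro D_intros D_mem[OF D_A] dt_fun[OF D_g])
  have fin: "finite bad"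
  proof (rule ccontr)
    assume "infinite bad"
    then obtain b r where r: "r \<noteq> 0" "cb b r \<subseteq> bad" using definable_contains_ball[OF D_bad] by blast
    then show False using differentiable_somewhere[OF D_g r(1), of b] unfolding bad_def by blast
  qed
  have diff: "differentiable_at_within M f (j a) S" if a: "a \<in> A - bad" and S: "j a \<in> S" for a S
  proof -
    obtain l where l: "lim0 (\<lambda>d. (g (a + d) - g a) / d) l" using a unfolding bad_def by blast
    obtain s where s: "s \<noteq> 0" "cb a s \<subseteq> A" using A_open a by blast
    show ?thesis by (rule differentiable_of_lim0[OF l S s(1)]) (use g s(2) in blast)
  qed
  obtain a0 s0 where s0: "s0 \<noteq> 0" "cb a0 s0 \<subseteq> A"
    using B A_open unfolding is_ball_iff B_eq by (metis cb_center image_eqI imageE j_inj ob_center)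
  have "infinite (A - bad)"
  proof
    assume "finite (A - bad)"
    then have "finite A" using fin by (metis Diff_infinite_finite)
    then show False using infinite_cb[OF s0(1)] s0(2) finite_subset by blast
  qed
  moreover have "dset (A - bad)" unfolding Diff_iff by (intro D_intros D_mem[OF D_A] D_mem[OF D_bad])
  ultimately obtain b r where r: "r \<noteq> 0" "cb b r \<subseteq> A - bad" using definable_contains_ball by blast
  have "is_ball M (j ` cb b r)" using r(1) unfolding is_ball_iff by blast
  moreover have "j ` cb b r \<subseteq> B" using r(2) unfolding B_eq by blast
  moreover have "\<forall>a\<in>j ` cb b r. differentiable_at_within M f a (j ` cb b r)" using diff r(2) by blast
  moreover have "{a \<in> B. \<not> differentiable_at_within M f a B} \<subseteq> j ` bad"
    unfolding B_eq using diff by blast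
  then have "finite {a \<in> B. \<not> differentiable_at_within M f a B}" using fin finite_subset by blast
  ultimately show ?thesis by blast
qed

end

section \<open>A type for the counterexample\<close>

text \<open>Serves to put the field of a model and the rational numbers on the common type
  \<open>'a + rat\<close>.\<close>

definition img_ring :: "('a \<Rightarrow> 'b) \<Rightarrow> 'a ring \<Rightarrow> 'b ring" where
  "img_ring h R = \<lparr>carrier = h ` carrier R,
     monoid.mult = (\<lambda>x y. h (inv_into (carrier R) h x \<otimes>\<^bsub>R\<^esub> inv_into (carrier R) h y)),
     monoid.one = h \<one>\<^bsub>R\<^esub>, ring.zero = h \<zero>\<^bsub>R\<^esub>,
     ring.add = (\<lambda>x y. h (inv_into (carrier R) h x \<oplus>\<^bsub>R\<^esub> inv_into (carrier R) h y))\<rparr>"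

lemma img_ring_simps:
  assumes "inj_on h (carrier R)" "x \<in> carrier R" "y \<in> carrier R"
  shows "h x \<otimes>\<^bsub>img_ring h R\<^esub> h y = h (x \<otimes>\<^bsub>R\<^esub> y)" "h x \<oplus>\<^bsub>img_ring h R\<^esub> h y = h (x \<oplus>\<^bsub>R\<^esub> y)"
  using assms by (simp_all add: img_ring_def)

lemma field_img_ring:
  assumes h: "inj_on h (carrier R)" and "field R"
  shows "field (img_ring h R)"
proof -
  interpret field R by fact
  have "h \<in> ring_iso R (img_ring h R)"
  proof (rule ring_iso_memI)
    show "bij_betw h (carrier R) (carrier (img_ring h R))"
      using h by (simp add: bij_betw_def img_ring_def)
  qed (use img_ring_simps[OF h] in \<open>auto simp: img_ring_def\<close>)
  from ring_iso_imp_img_field[OF this] show ?thesis by (simp add: img_ring_def)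
qed

lemma add_pow_img_ring:
  fixes n :: nat
  assumes h: "inj_on h (carrier R)" and "field R"
  shows "[n] \<cdot>\<^bsub>img_ring h R\<^esub> \<one>\<^bsub>img_ring h R\<^esub> = h ([n] \<cdot>\<^bsub>R\<^esub> \<one>\<^bsub>R\<^esub>)"
proof -
  interpret R: field R by fact
  interpret S: field "img_ring h R" by (rule field_img_ring[OF assms])
  have one: "\<one>\<^bsub>img_ring h R\<^esub> = h \<one>\<^bsub>R\<^esub>" and zero: "\<zero>\<^bsub>img_ring h R\<^esub> = h \<zero>\<^bsub>R\<^esub>" by (simp_all add: img_ring_def)
  show ?thesis
  proof (induction n)
    case 0 show ?case using zero by simp
  next
    case (Suc n)
    then show ?case using img_ring_simps(2)[OF h] one by simp
  qed
qed

lemma char_zero_img_ring: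
  assumes h: "inj_on h (carrier R)" and R: "field R" and "char_zero R"
  shows "char_zero (img_ring h R)"
proof -
  interpret R: field R by fact
  have "[n] \<cdot>\<^bsub>R\<^esub> \<one>\<^bsub>R\<^esub> \<noteq> \<zero>\<^bsub>R\<^esub>" if "n > 0" for n :: nat using assms(3) that unfolding char_zero_def by blast
  then show ?thesis
    using inj_onD[OF h, of "[n] \<cdot>\<^bsub>R\<^esub> \<one>\<^bsub>R\<^esub>" "\<zero>\<^bsub>R\<^esub>" for n :: nat] unfolding char_zero_def add_pow_img_ring[OF h R]
    by (auto simp: img_ring_def)
qed

lemma rat_ring: "field (ring_of_type_algebra :: rat ring)" "char_zero (ring_of_type_algebra :: rat ring)"
proof -
  show f: "field (ring_of_type_algebra :: rat ring)" by (rule field_from_type_algebra)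
  interpret field "ring_of_type_algebra :: rat ring" by (rule f)
  have "[n] \<cdot>\<^bsub>ring_of_type_algebra\<^esub> \<one>\<^bsub>ring_of_type_algebra\<^esub> = (of_nat n :: rat)" for n :: nat
  proof (induction n)
    case (Suc n)
    then show ?case by (simp add: add_pow_def ring_of_type_algebra_def nat_pow_def)
  qed (simp add: ring_of_type_algebra_def add_pow_def nat_pow_def)
  then show "char_zero (ring_of_type_algebra :: rat ring)"
    unfolding char_zero_def by (simp add: ring_of_type_algebra_def)
qed

text \<open>This form of saturation mentions no cardinal, so that \<open>counterexample\<close> does
  not involve the type that carries \<open>\<kappa>\<close>.\<close>

definition countably_saturated ::
  "('f, 'r) lang \<Rightarrow> ('a, 'f, 'r) struct \<Rightarrow> bool" where
  "countably_saturated L M \<longleftrightarrow> (\<forall>P. (\<forall>n. definable_set L M (P n)) \<longrightarrow>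
      (\<forall>n. \<exists>x\<in>univ M. \<forall>i<n. x \<in> P i) \<longrightarrow> (\<exists>x\<in>univ M. \<forall>i::nat. x \<in> P i))"

lemma countable_imp_ordLess:
  assumes "countable A" "natLeq <o \<kappa>" shows "card_of A <o \<kappa>"
proof -
  have "card_of A \<le>o card_of (UNIV :: nat set)"
    using assms(1) unfolding countable_def by (simp flip: card_of_ordLeq)
  then have "card_of A \<le>o natLeq" using card_of_nat ordLeq_ordIso_trans by blast
  then show ?thesis using assms(2) ordLeq_ordLess_trans by blast
qed

lemma finite_tm_vars: "finite (tm_vars t)"
  by (induction t) auto

lemma finite_free_vars: "finite (free_vars \<phi>)"
  by (induction \<phi>) (auto simp: finite_tm_vars)

text \<open>Each of the definable sets is given by one formula, with finitely many free variables,
  so the sequence needs only countably many parameters.\<close>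

lemma saturated_countably:
  fixes M :: "('a, 'f, 'r) struct"
  assumes sat: "saturated \<kappa> L M" and \<kappa>: "natLeq <o \<kappa>" shows "countably_saturated L M"
  unfolding countably_saturated_def
proof (intro allI impI)
  fix P :: "nat \<Rightarrow> 'a set"
  assume def: "\<forall>n. definable_set L M (P n)" and fip: "\<forall>n. \<exists>x\<in>univ M. \<forall>i<n. x \<in> P i"
  have "\<exists>\<phi> e. wf_fm L \<phi> \<and> range e \<subseteq> univ M \<and> (\<forall>x\<in>univ M. x \<in> P n \<longleftrightarrow> sat M (e(0 := x)) \<phi>)" for n
  proof -
    have "definable L M 1 {[x] |x. x \<in> P n}" using def unfolding definable_set_def by blast
    then obtain \<phi> e where 1: "wf_fm L \<phi>" "range e \<subseteq> univ M"
      "{[x] |x. x \<in> P n} = {xs. length xs = 1 \<and> set xs \<subseteq> univ M \<and> sat M (\<lambda>i. if i < 1 then xs ! i else e i) \<phi>}"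
      unfolding definable_def by blast
    have "x \<in> P n \<longleftrightarrow> sat M (e(0 := x)) \<phi>" if "x \<in> univ M" for x
    proof -
      have "(\<lambda>i. if i < 1 then [x] ! i else e i) = e(0 := x)" by (auto simp: fun_eq_iff)
      moreover have "x \<in> P n \<longleftrightarrow> [x] \<in> {[x] |x. x \<in> P n}" by blast
      ultimately show ?thesis using that unfolding 1(3) by simp
    qed
    then show ?thesis using 1 by blast
  qed
  then obtain \<phi> e where 1: "\<And>n. wf_fm L (\<phi> n)" "\<And>n. range (e n) \<subseteq> univ M"
    "\<And>n x. x \<in> univ M \<Longrightarrow> x \<in> P n \<longleftrightarrow> sat M ((e n)(0 := x)) (\<phi> n)" by metis
  define A where "A = (\<Union>n. e n ` (free_vars (\<phi> n) - {0}))"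
  define p where "p = range (\<lambda>n. (\<phi> n, e n))"
  have "countable A" unfolding A_def
    by (intro countable_UN[OF countableI_type] countable_finite) (auto simp: finite_free_vars)
  have "\<exists>x\<in>univ M. \<forall>(\<phi>, e)\<in>p. sat M (e(0 := x)) \<phi>"
  proof (rule sat[unfolded saturated_def, THEN spec, THEN spec, THEN mp, of A p], intro conjI allI impI)
    show "card_of A <o \<kappa>" using \<open>countable A\<close> \<kappa> by (rule countable_imp_ordLess)
    show "A \<subseteq> univ M" unfolding A_def using 1(2) by blast
    show "\<forall>(\<phi>, e)\<in>p. wf_fm L \<phi> \<and> (\<forall>i\<in>free_vars \<phi> - {0}. e i \<in> A)"
      unfolding p_def A_def using 1(1) by auto
    show "\<exists>x\<in>univ M. \<forall>(\<phi>, e)\<in>q. sat M (e(0 := x)) \<phi>" if q: "finite q \<and> q \<subseteq> p" for q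
    proof -
      obtain N where N: "finite N" "q = (\<lambda>n. (\<phi> n, e n)) ` N"
        using finite_subset_image[of q "\<lambda>n. (\<phi> n, e n)" UNIV] q unfolding p_def by blast
      obtain m where m: "\<forall>n\<in>N. n < m" using N(1) by (metis finite_nat_set_iff_bounded)
      obtain x where "x \<in> univ M" "\<forall>i<m. x \<in> P i" using fip by blast
      then show ?thesis using m 1(3) unfolding N(2) by auto
    qed
  qed
  then show "\<exists>x\<in>univ M. \<forall>i. x \<in> P i" using 1(3) unfolding p_def by auto
qed

text \<open>All data apart from the structure are quantified away, so that choosing a structure
  alone determines the field to be made a type.\<close>

definition counterexample :: "('a, 'f vf_fun, 'r vf_rel) struct \<Rightarrow> bool" where
  "counterexample M \<longleftrightarrow> (\<exists>L B f. expands_vf_language L \<and> acvf M \<and> char_zero (ring_of M) \<and>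
     (\<forall>A. definable_set L M A \<longrightarrow> A \<in> ball_combinations M) \<and> countably_saturated L M \<and>
     definably_complete L M \<and> is_ball M B \<and> f \<in> B \<rightarrow> univ M \<and> definable_fun L M B f \<and>
     \<not> ((\<exists>B'. is_ball M B' \<and> B' \<subseteq> B \<and> (\<forall>a\<in>B'. differentiable_at_within M f a B')) \<and>
        finite {a \<in> B. \<not> differentiable_at_within M f a B}))"

text \<open>Higher-order logic has no local type definitions, so the field of a given model is not
  a type. A type is instead attached to one counterexample picked by Hilbert choice; the rational
  numbers serve as the field if there is none.\<close>

definition chosen_ring :: "('f \<times> 'r) itself \<Rightarrow> ('a + rat) ring" where
  "chosen_ring _ = (if \<exists>M :: ('a, 'f vf_fun, 'r vf_rel) struct. counterexample M
     then img_ring Inl (ring_of (SOME M :: ('a, 'f vf_fun, 'r vf_rel) struct. counterexample M))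
     else img_ring Inr ring_of_type_algebra)"

lemma chosen_ring:
  "field (chosen_ring TYPE('f \<times> 'r) :: ('a + rat) ring)"
  "char_zero (chosen_ring TYPE('f \<times> 'r) :: ('a + rat) ring)"
proof -
  have "field (chosen_ring TYPE('f \<times> 'r) :: ('a + rat) ring) \<and>
    char_zero (chosen_ring TYPE('f \<times> 'r) :: ('a + rat) ring)"
  proof (cases "\<exists>M :: ('a, 'f vf_fun, 'r vf_rel) struct. counterexample M")
    case True
    define M where "M = (SOME M :: ('a, 'f vf_fun, 'r vf_rel) struct. counterexample M)"
    have "counterexample M" unfolding M_def using True by (rule someI_ex)
    then have "field (ring_of M)" "char_zero (ring_of M)"
      unfolding counterexample_def acvf_def algebraically_closed_def by blast+
    then show ?thesis
      using True field_img_ring[of Inl "ring_of M"] char_zero_img_ring[of Inl "ring_of M"]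
      by (simp add: chosen_ring_def M_def inj_on_def)
  next
    case False
    then show ?thesis
      using field_img_ring[of Inr, OF _ rat_ring(1)] char_zero_img_ring[of Inr, OF _ rat_ring]
      by (simp add: chosen_ring_def inj_on_def)
  qed
  then show "field (chosen_ring TYPE('f \<times> 'r) :: ('a + rat) ring)"
    "char_zero (chosen_ring TYPE('f \<times> 'r) :: ('a + rat) ring)" by auto
qed

typedef ('a, 'f, 'r) chosen_field = "carrier (chosen_ring TYPE('f \<times> 'r) :: ('a + rat) ring)"
proof -
  interpret field "chosen_ring TYPE('f \<times> 'r) :: ('a + rat) ring" by (rule chosen_ring)
  show ?thesis by (rule exI[of _ "\<one>\<^bsub>chosen_ring TYPE('f \<times> 'r)\<^esub>"]) simp
qed

abbreviation Rep :: "('a, 'f, 'r) chosen_field \<Rightarrow> 'a + rat" where "Rep \<equiv> Rep_chosen_field"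

instantiation chosen_field :: (type, type, type) Fields.field
begin

definition "0 = (Abs_chosen_field \<zero>\<^bsub>chosen_ring TYPE('b \<times> 'c)\<^esub> :: ('a, 'b, 'c) chosen_field)"
definition "1 = (Abs_chosen_field \<one>\<^bsub>chosen_ring TYPE('b \<times> 'c)\<^esub> :: ('a, 'b, 'c) chosen_field)"
definition "x + y = (Abs_chosen_field (Rep x \<oplus>\<^bsub>chosen_ring TYPE('b \<times> 'c)\<^esub> Rep y) :: ('a, 'b, 'c) chosen_field)"
definition "x * y = (Abs_chosen_field (Rep x \<otimes>\<^bsub>chosen_ring TYPE('b \<times> 'c)\<^esub> Rep y) :: ('a, 'b, 'c) chosen_field)"
definition "- x = (Abs_chosen_field (\<ominus>\<^bsub>chosen_ring TYPE('b \<times> 'c)\<^esub> Rep x) :: ('a, 'b, 'c) chosen_field)"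
definition "x - y = (x + (- y) :: ('a, 'b, 'c) chosen_field)"
definition "inverse x = (if x = 0 then 0 else
  Abs_chosen_field (inv\<^bsub>chosen_ring TYPE('b \<times> 'c)\<^esub> Rep x) :: ('a, 'b, 'c) chosen_field)"
definition "x div y = (x * inverse y :: ('a, 'b, 'c) chosen_field)"

lemma Rep_simps:
  fixes x y :: "('a, 'b, 'c) chosen_field"
  shows "Rep (0 :: ('a, 'b, 'c) chosen_field) = \<zero>\<^bsub>chosen_ring TYPE('b \<times> 'c)\<^esub>"
    "Rep (1 :: ('a, 'b, 'c) chosen_field) = \<one>\<^bsub>chosen_ring TYPE('b \<times> 'c)\<^esub>"
    "Rep (x + y) = Rep x \<oplus>\<^bsub>chosen_ring TYPE('b \<times> 'c)\<^esub> Rep y"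
    "Rep (x * y) = Rep x \<otimes>\<^bsub>chosen_ring TYPE('b \<times> 'c)\<^esub> Rep y"
    "Rep (- x) = \<ominus>\<^bsub>chosen_ring TYPE('b \<times> 'c)\<^esub> Rep x"
    "x \<noteq> 0 \<Longrightarrow> Rep x \<in> Units (chosen_ring TYPE('b \<times> 'c))"
    "x \<noteq> 0 \<Longrightarrow> Rep (inverse x) = inv\<^bsub>chosen_ring TYPE('b \<times> 'c)\<^esub> Rep x"
proof -
  interpret R: field "chosen_ring TYPE('b \<times> 'c) :: ('a + rat) ring" by (rule chosen_ring)
  note Abs = Abs_chosen_field_inverse[where 'a = 'a and 'f = 'b and 'r = 'c]
  note car = Rep_chosen_field[where 'a = 'a and 'f = 'b and 'r = 'c]
  show 0: "Rep (0 :: ('a, 'b, 'c) chosen_field) = \<zero>\<^bsub>chosen_ring TYPE('b \<times> 'c)\<^esub>"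
    by (simp add: zero_chosen_field_def Abs)
  show "Rep (1 :: ('a, 'b, 'c) chosen_field) = \<one>\<^bsub>chosen_ring TYPE('b \<times> 'c)\<^esub>"
    by (simp add: one_chosen_field_def Abs)
  show "Rep (x + y) = Rep x \<oplus>\<^bsub>chosen_ring TYPE('b \<times> 'c)\<^esub> Rep y"
    "Rep (x * y) = Rep x \<otimes>\<^bsub>chosen_ring TYPE('b \<times> 'c)\<^esub> Rep y"
    "Rep (- x) = \<ominus>\<^bsub>chosen_ring TYPE('b \<times> 'c)\<^esub> Rep x"
    by (simp_all add: plus_chosen_field_def times_chosen_field_def uminus_chosen_field_def Abs car)
  show units: "Rep x \<in> Units (chosen_ring TYPE('b \<times> 'c))" if "x \<noteq> 0"
    using that 0 car[of x] unfolding R.field_Units by (simp flip: Rep_chosen_field_inject)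
  show "Rep (inverse x) = inv\<^bsub>chosen_ring TYPE('b \<times> 'c)\<^esub> Rep x" if "x \<noteq> 0"
    using that units by (simp add: inverse_chosen_field_def Abs)
qed

instance
proof
  fix a b c :: "('a, 'b, 'c) chosen_field"
  interpret R: field "chosen_ring TYPE('b \<times> 'c) :: ('a + rat) ring" by (rule chosen_ring)
  note car [simp] = Rep_chosen_field[where 'a = 'a and 'f = 'b and 'r = 'c]
  note eq = Rep_chosen_field_inject[where 'a = 'a and 'f = 'b and 'r = 'c, symmetric]
  show "a + b + c = a + (b + c)" "a + b = b + a" "0 + a = a" "- a + a = 0"
    "a * b * c = a * (b * c)" "a * b = b * a" "1 * a = a" "(a + b) * c = a * c + b * c"
    "(0 :: ('a, 'b, 'c) chosen_field) \<noteq> 1"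
    unfolding eq Rep_simps by (simp_all add: R.a_ac R.m_ac R.l_distr R.r_distr R.l_neg R.r_neg)
  show "a - b = a + - b" by (simp add: minus_chosen_field_def)
  show "inverse a * a = 1" if "a \<noteq> 0"
    using Rep_simps(6)[OF that] unfolding eq Rep_simps(2,4) Rep_simps(7)[OF that] by simp
  show "a div b = a * inverse b" by (simp add: divide_chosen_field_def)
  show "inverse (0 :: ('a, 'b, 'c) chosen_field) = 0" by (simp add: inverse_chosen_field_def)
qed

end

instance chosen_field :: (type, type, type) field_char_0
proof
  interpret R: field "chosen_ring TYPE('b \<times> 'c) :: ('a + rat) ring" by (rule chosen_ring)
  have of_nat: "Rep (of_nat n :: ('a, 'b, 'c) chosen_field) = [n] \<cdot>\<^bsub>chosen_ring TYPE('b \<times> 'c)\<^esub> \<one>\<^bsub>chosen_ring TYPE('b \<times> 'c)\<^esub>" for n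
    by (induction n) (simp_all add: R.a_comm Rep_simps)
  have nz: "(of_nat n :: ('a, 'b, 'c) chosen_field) \<noteq> 0" if "n > 0" for n
    using chosen_ring(2)[where 'f = 'b and 'r = 'c and 'a = 'a] that
    unfolding char_zero_def by (simp add: of_nat Rep_simps flip: Rep_chosen_field_inject)
  have le: "m = n" if "m \<le> n" "(of_nat m :: ('a, 'b, 'c) chosen_field) = of_nat n" for m n
  proof (rule ccontr)
    assume "m \<noteq> n"
    then have "(of_nat (n - m) :: ('a, 'b, 'c) chosen_field) \<noteq> 0" using that(1) by (intro nz) simp
    moreover have "(of_nat (n - m) :: ('a, 'b, 'c) chosen_field) + of_nat m = of_nat n"
      using that(1) by (simp flip: of_nat_add)
    ultimately show False using that(2) by simp
  qed
  show "inj (of_nat :: nat \<Rightarrow> ('a, 'b, 'c) chosen_field)"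
    by (rule injI) (metis le nat_le_linear)
qed

text \<open>It suffices to refute the structure selected by choice, which is a counterexample if
  there is any; for that one, \<open>chosen_field\<close> is the type that \<open>coded\<close>
  requires.\<close>

theorem no_counterexample: "\<not> counterexample (M :: ('a, 'f vf_fun, 'r vf_rel) struct)"
proof
  assume "counterexample M"
  then have ex: "\<exists>M :: ('a, 'f vf_fun, 'r vf_rel) struct. counterexample M" by blast
  define N where "N = (SOME M :: ('a, 'f vf_fun, 'r vf_rel) struct. counterexample M)"
  have N: "counterexample N" unfolding N_def using ex by (rule someI_ex)
  let ?S = "chosen_ring TYPE('f \<times> 'r) :: ('a + rat) ring"
  have S: "?S = img_ring Inl (ring_of N)" using ex by (simp add: chosen_ring_def N_def)
  obtain L B f where h: "expands_vf_language L" "acvf N" "char_zero (ring_of N)"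
    "\<And>A. definable_set L N A \<Longrightarrow> A \<in> ball_combinations N" "countably_saturated L N"
    "definably_complete L N" "is_ball N B" "f \<in> B \<rightarrow> univ N" "definable_fun L N B f"
    and contra: "\<not> ((\<exists>B'. is_ball N B' \<and> B' \<subseteq> B \<and> (\<forall>a\<in>B'. differentiable_at_within N f a B')) \<and>
        finite {a \<in> B. \<not> differentiable_at_within N f a B})"
    using N unfolding counterexample_def by blast
  interpret R: field "ring_of N" using h(2) unfolding acvf_def algebraically_closed_def by blast
  interpret S: field ?S by (rule chosen_ring)
  define j :: "('a, 'f, 'r) chosen_field \<Rightarrow> 'a" where "j x = projl (Rep x)" for x
  have car: "carrier ?S = Inl ` univ N" unfolding S by (simp add: img_ring_def ring_of_def)
  have Rep_j: "Rep x = Inl (j x)" and j_univ: "j x \<in> univ N" for x :: "('a, 'f, 'r) chosen_field"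
    using Rep_chosen_field[of x] unfolding car j_def by auto
  have j_Abs: "j (Abs_chosen_field (Inl a)) = a" if "a \<in> univ N" for a
    using that unfolding j_def by (simp add: Abs_chosen_field_inverse car)
  have simps: "Inl x \<otimes>\<^bsub>?S\<^esub> Inl y = Inl (Fn N Mult [x, y])" "Inl x \<oplus>\<^bsub>?S\<^esub> Inl y = Inl (Fn N Add [x, y])"
    if "x \<in> univ N" "y \<in> univ N" for x y
    using img_ring_simps[of Inl "ring_of N" x y] that unfolding S by (simp_all add: ring_of_def inj_on_def)
  have closed: "Fn N Mult [x, y] \<in> univ N" "Fn N Add [x, y] \<in> univ N" if "x \<in> univ N" "y \<in> univ N" for x y
    using R.m_closed[of x y] R.a_closed[of x y] that by (simp_all add: ring_of_def)
  have zero_one: "\<zero>\<^bsub>?S\<^esub> = Inl (Fn N Zero [])" "\<one>\<^bsub>?S\<^esub> = Inl (Fn N One [])" "Fn N Zero [] \<in> univ N" "Fn N One [] \<in> univ N"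
    using R.zero_closed R.one_closed unfolding S by (simp_all add: ring_of_def img_ring_def)
  interpret coded L N j
  proof
    show "bij_betw j UNIV (univ N)"
    proof (rule bij_betwI[where g = "\<lambda>a. Abs_chosen_field (Inl a)"])
      show "Abs_chosen_field (Inl (j x)) = x" for x by (simp flip: Rep_j add: Rep_chosen_field_inverse)
    qed (use j_univ j_Abs in auto)
    show "j (x + y) = Fn N Add [j x, j y]" "j (x * y) = Fn N Mult [j x, j y]" for x y
      using j_univ closed by (simp_all add: plus_chosen_field_def times_chosen_field_def Rep_j simps j_Abs)
    show "j 0 = Fn N Zero []" "j 1 = Fn N One []"
      using zero_one by (simp_all add: zero_chosen_field_def one_chosen_field_def j_Abs)
    show "\<exists>x\<in>univ N. \<forall>i. x \<in> P i" if "\<And>n. definable_set L N (P n)" "\<And>n. \<exists>x\<in>univ N. \<forall>i<n. x \<in> P i" for P :: "nat \<Rightarrow> 'a set"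
      using h(5)[unfolded countably_saturated_def, rule_format, of P] that by blast
  qed (use h in auto)
  show False using generic_differentiability[OF h(7-9)] contra by blast
qed

theorem theorem9p1:
  fixes L :: "('f vf_fun, 'r vf_rel) lang"
    and T :: "('f vf_fun, 'r vf_rel) fm set"
    and M :: "('a, 'f vf_fun, 'r vf_rel) struct"
    and \<kappa> :: "'k rel"
    and t :: "'f vf_fun"
    and B :: "'a set"
    and f :: "'a \<Rightarrow> 'a"
  assumes "complete_theory TYPE('a) L T"
    and "C_minimal_ACVF_expansion TYPE('a) L T"
    and "t \<in> fsyms L" and "farity L t = 0"
    and "\<forall>N\<in>(models L T :: ('a, 'f vf_fun, 'r vf_rel) struct set).
           val_less N \<one>\<^bsub>ring_of N\<^esub> (Fn N t [])"
    and "monster_model \<kappa> L T M"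
    and "char_zero (ring_of M)"
    and "definably_complete L M"
    and "is_ball M B"
    and "f \<in> B \<rightarrow> univ M"
    and "definable_fun L M B f"
  shows "(\<exists>B'. is_ball M B' \<and> B' \<subseteq> B \<and> (\<forall>a\<in>B'. differentiable_at_within M f a B')) \<and>
         finite {a \<in> B. \<not> differentiable_at_within M f a B}"
proof -
  have M: "M \<in> models L T" "saturated \<kappa> L M" "natLeq <o \<kappa>"
    using assms(6) unfolding monster_model_def by auto
  have "expands_vf_language L" "acvf M" "\<forall>A. definable_set L M A \<longrightarrow> A \<in> ball_combinations M"
    using assms(2) M(1) unfolding C_minimal_ACVF_expansion_def by auto
  moreover have "countably_saturated L M" using saturated_countably M by blast
  ultimately show ?thesis
    using no_counterexample[of M] assms(7-11) unfolding counterexample_def by blast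
qed

end
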